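(* Suppose that the following three assumptions hold. (A1) Sub-exponential number of partitions: the orbit partition $\pi_{\mathcal G}$ of the hidden subgroup $\mathcal G$ belongs to a small subclass $\mathcal Q_{d,\le d_0}\subset\mathcal P_{d,\le d_0}$ of the partitions of $[d]$ with at most $d_0$ classes. In particular $\pi_{\mathcal G}\in\mathcal Q_{d,d_\star}$ for some $d_\star\le d_0$, and for each $k\in[d_0]$, $|\mathcal Q_{d,k}|\le O(d^{ck})$ for a constant $c>0$. (A2) Bounded set of arms: there are positive numbers $K_x,R_{\max}$ such that for all $x\in\mathcal X$ and all $m\in\overline{\mathcal M}$, $\|\Pi_m(x)\|_2^2\le K_x$ and $|\langle x,\theta_\star\rangle|\le R_{\max}$. (A3) Well-separated partitioning: for some $\varepsilon_0>0$, $|\theta_{\star,i}-\theta_{\star,j}|\ge\varepsilon_0$ for all $(i,j)$ such that $i$ and $j$ lie in different classes of $\pi_{\mathcal G}$. Let the exploration length be $$t_2=\Omega\Big(\frac{\sigma^2K_x^2d_0\log(dT)}{C_{\min}^2(\mathcal X)\,\varepsilon_0^2}\Big),$$ i.e. of this order with a sufficiently large multiplicative constant. Then the algorithm "Exploring model then commit with well-separated partition" (defined in the context) returns a model $\widehat m$ with $\theta_\star\in\widehat m$ with probability at least $1-1/T$, and its regret is upper bounded as $$\mathbf R_T=O\Big(\frac{R_{\max}\sigma^2K_x^2d_0\log(dT)}{C_{\min}^2(\mathcal X)\,\varepsilon_0^2}+\sigma d_0\sqrt{T\log(K_xT)}\Big).$$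
   Context: Constants: the dependence of $t_2$ and of the regret bound on $T,d,d_0,\sigma,K_x,R_{\max},C_{\min}(\mathcal X),\varepsilon_0$ is the one displayed; the constants hidden in $\Omega(\cdot)$ and $O(\cdot)$ do not depend on these quantities (they may depend on the constants in (A1)). In particular $\varepsilon_0$ may vary with $T$. Bandit model: in each round $t=1,\dots,T$ ($T$ known in advance) the learner picks an arm $x_t\in\mathcal X\subset\mathbb R^d$ and observes $y_t=\langle x_t,\theta_\star\rangle+\eta_t$, with $\eta_t$ i.i.d. $\sigma$-Gaussian noise, i.e. $N(0,\sigma^2)$. The expected cumulative regret is $\mathbf R_T=\mathbb E[\sum_{t=1}^T\langle x_\star-x_t,\theta_\star\rangle]$, where $x_\star=\arg\max_{x\in\mathcal X}\langle x,\theta_\star\rangle$. Symmetry: $[d]=\{1,\dots,d\}$; the group $\mathcal S_d$ of bijections of $[d]$ acts on $\mathbb R^d$ by $g\cdot x=(x_{g(i)})_{i\in[d]}$. A hidden (unknown to the learner) subgroup $\mathcal G\le\mathcal S_d$ satisfies $g\cdot\theta_\star=\theta_\star$ for all $g\in\mathcal G$. $\pi_{\mathcal G}$ is the partition of $[d]$ into $\mathcal G$-orbits. $\mathcal P_{d,\le d_0}$ is the set of partitions of $[d]$ with at most $d_0$ classes. $\mathcal Q_{d,\le d_0}$ is known to the learner, and $\mathcal Q_{d,k}$ is the set of its members with exactly $k$ classes. Models: a partition $p$ of $[d]$ corresponds to the fixed-point subspace $m_p=\{\theta\in\mathbb R^d\mid\theta_i=\theta_j\text{ whenever }i,j\text{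 are in the same class of }p\}$. $\mathcal M=\{m_p\mid p\in\mathcal Q_{d,\le d_0}\}$ and $\overline{\mathcal M}=\{\mathrm{conv}(m\cup m')\mid m,m'\in\mathcal M\}$, where $\mathrm{conv}$ is the convex hull; each $\mathrm{conv}(m\cup m')$ is a subspace. $\Pi_S$ denotes Euclidean projection onto $S$. Exploratory distribution: $\nu=\arg\max_{\omega}\lambda_{\min}(\mathbb E_{x\sim\omega}[xx^\top])$ over probability measures $\omega$ supported on $\mathcal X$; $C_{\min}(\mathcal X)=\lambda_{\min}(\mathbb E_{x\sim\nu}[xx^\top])$, which is positive (the arm set is exploratory). Algorithm "Exploring model then commit with well-separated partition" (input $T,\nu,t_2$): in rounds $t=1,\dots,t_2$ independently pull $x_t$ according to $\nu$ and receive $y_t$. Put $X=[x_1,\dots,x_{t_2}]^\top$, $Y=(y_1,\dots,y_{t_2})^\top$. For $m\in\mathcal M$ let $X_m=[\Pi_m(x_1),\dots,\Pi_m(x_{t_2})]^\top$, let $S_m$ be the column space of $X_m$, and choose $\widehat m\in\arg\min_{m\in\mathcal M}\|Y-\Pi_{S_m}(Y)\|_2^2$. In rounds $t=t_2+1,\dots,T$ play on $\widehat m$ the OFUL algorithm, i.e. the standard optimism-in-the-face-of-uncertainty linear bandit algorithm of Abbasi-Yadkori, Pál and Szepesvári (2011), with the unknown parameter taken to lie in the subspace $\widehat m$ of dimension at most $d_0$.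
   Formalization: Proved for T≥2, K_x≥κ, σ≥κε_0 and log(K_xT)≥κ, for each κ>0; hidden constants may depend on κ, since fully uniform constants fail (e.g. σ/ε_0→0). OFUL's unspecified regularisation, norm bound and confidence level are suitably chosen from T,d,d_0,σ,K_x,R_max,C_min. *)

theory Defs
  imports
    "HOL-Probability.Probability"
    "HOL-Library.Function_Algebras"
    "HOL-Algebra.Sym_Groups"
    "HOL-Algebra.Group_Action"
    "Jordan_Normal_Form.Char_Poly"
begin

section \<open>Euclidean spaces of varying dimension\<close>

text \<open>
  The constants of the regret bound are uniform in the dimension, so the dimension has to be a term.
  A vector of dimension \<open>n\<close> is a function vanishing outside \<open>{1..n}\<close>. The instance below makes
  the library's \<open>span\<close> and \<open>convex hull\<close> available; on \<open>nat \<Rightarrow> real\<close> the type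
  class topology is the product topology, so \<open>borel\<close> is generated by the coordinates.
\<close>

instantiation "fun" :: (type, real_vector) real_vector
begin

definition scaleR_fun :: "real \<Rightarrow> ('a \<Rightarrow> 'b) \<Rightarrow> 'a \<Rightarrow> 'b"
  where "scaleR_fun r f = (\<lambda>i. r *\<^sub>R f i)"

instance
  by standard (auto simp: scaleR_fun_def fun_eq_iff scaleR_add_right scaleR_add_left)

end

type_synonym vector = "nat \<Rightarrow> real"

definition euclid :: "nat \<Rightarrow> vector set"
  where "euclid n = {x. \<forall>i. i \<notin> {1..n} \<longrightarrow> x i = 0}"

definition dot :: "nat \<Rightarrow> vector \<Rightarrow> vector \<Rightarrow> real"
  where "dot n x y = (\<Sum>i=1..n. x i * y i)"

definition sqnorm :: "nat \<Rightarrow> vector \<Rightarrow> real"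
  where "sqnorm n x = dot n x x"

definition proj :: "nat \<Rightarrow> vector set \<Rightarrow> vector \<Rightarrow> vector"
  where "proj n S x = arg_min_on (\<lambda>z. sqnorm n (x - z)) S"


section \<open>Hidden symmetry, partitions and models\<close>

definition orbit_partition :: "nat \<Rightarrow> (nat \<Rightarrow> nat) set \<Rightarrow> nat set set"
  where "orbit_partition d G = Group_Action.orbits (sym_group d\<lparr>carrier := G\<rparr>) {1..d} id"

definition partitions_le :: "nat \<Rightarrow> nat \<Rightarrow> nat set set set"
  where "partitions_le d d0 = {p. partition_on {1..d} p \<and> card p \<le> d0}"

definition fixed_space :: "nat \<Rightarrow> nat set set \<Rightarrow> vector set"
  where "fixed_space d p = {\<theta> \<in> euclid d. \<forall>c\<in>p. \<forall>i\<in>c. \<forall>j\<in>c. \<theta> i = \<theta> j}"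

definition models :: "nat \<Rightarrow> nat set set set \<Rightarrow> vector set set"
  where "models d Q = fixed_space d ` Q"

definition models_bar :: "nat \<Rightarrow> nat set set set \<Rightarrow> vector set set"
  where "models_bar d Q = {convex hull (m \<union> m') | m m'. m \<in> models d Q \<and> m' \<in> models d Q}"

definition symmetric_bandit ::
  "nat \<Rightarrow> vector set \<Rightarrow> vector \<Rightarrow> vector \<Rightarrow> (nat \<Rightarrow> nat) set \<Rightarrow> bool"
  where "symmetric_bandit d X \<theta> xs G \<longleftrightarrow>
    X \<subseteq> euclid d \<and> \<theta> \<in> euclid d \<and>
    is_arg_max (\<lambda>x. dot d x \<theta>) (\<lambda>x. x \<in> X) xs \<and>
    subgroup G (sym_group d) \<and> (\<forall>g\<in>G. (\<lambda>i. \<theta> (g i)) = \<theta>)"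

definition few_partitions ::
  "real \<Rightarrow> real \<Rightarrow> nat \<Rightarrow> nat \<Rightarrow> (nat \<Rightarrow> nat) set \<Rightarrow> nat set set set \<Rightarrow> bool"
  where "few_partitions c B d d0 G Q \<longleftrightarrow>
    Q \<subseteq> partitions_le d d0 \<and> orbit_partition d G \<in> Q \<and>
    (\<forall>k\<in>{1..d0}. real (card {p \<in> Q. card p = k}) \<le> B * real d powr (c * real k))"

definition bounded_arms ::
  "nat \<Rightarrow> real \<Rightarrow> real \<Rightarrow> vector set \<Rightarrow> vector \<Rightarrow> nat set set set \<Rightarrow> bool"
  where "bounded_arms d Kx Rmax X \<theta> Q \<longleftrightarrow>
    0 < Kx \<and> 0 < Rmax \<and>
    (\<forall>x\<in>X. (\<forall>m\<in>models_bar d Q. sqnorm d (proj d m x) \<le> Kx) \<and> \<bar>dot d x \<theta>\<bar> \<le> Rmax)"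

definition well_separated ::
  "nat \<Rightarrow> real \<Rightarrow> vector \<Rightarrow> (nat \<Rightarrow> nat) set \<Rightarrow> bool"
  where "well_separated d \<epsilon>0 \<theta> G \<longleftrightarrow>
    0 < \<epsilon>0 \<and>
    (\<forall>a\<in>orbit_partition d G. \<forall>b\<in>orbit_partition d G. a \<noteq> b \<longrightarrow>
      (\<forall>i\<in>a. \<forall>j\<in>b. \<epsilon>0 \<le> \<bar>\<theta> i - \<theta> j\<bar>))"


section \<open>Exploratory distribution\<close>

text \<open>Coordinates run from 1 to \<open>d\<close>, matrix indices from 0 to \<open>d - 1\<close>.\<close>

definition second_moment :: "nat \<Rightarrow> vector measure \<Rightarrow> real mat"
  where "second_moment d \<omega> = Matrix.mat d d (\<lambda>(i, j). \<integral>x. x (Suc i) * x (Suc j) \<partial>\<omega>)"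

definition lambda_min :: "real mat \<Rightarrow> real"
  where "lambda_min A = Min {k. eigenvalue A k}"

text \<open>Integrability only says that the second moment matrix exists.\<close>

definition arm_distribution :: "nat \<Rightarrow> vector set \<Rightarrow> vector measure \<Rightarrow> bool"
  where "arm_distribution d X \<omega> \<longleftrightarrow>
    prob_space \<omega> \<and> sets \<omega> = sets borel \<and> (AE x in \<omega>. x \<in> X) \<and>
    (\<forall>i\<in>{1..d}. \<forall>j\<in>{1..d}. integrable \<omega> (\<lambda>x. x i * x j))"

definition exploratory :: "nat \<Rightarrow> vector set \<Rightarrow> vector measure \<Rightarrow> bool"
  where "exploratory d X \<nu> \<longleftrightarrow>
    is_arg_max (\<lambda>\<omega>. lambda_min (second_moment d \<omega>)) (arm_distribution d X) \<nu> \<and>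
    0 < lambda_min (second_moment d \<nu>)"


section \<open>Model selection by least squares\<close>

text \<open>A history lists the pairs (arm, reward) of the rounds played so far.\<close>

type_synonym history = "(vector \<times> real) list"

definition rewards :: "history \<Rightarrow> vector"
  where "rewards h = (\<lambda>t. if t \<in> {1..length h} then snd (h ! (t - 1)) else 0)"

definition projected_column :: "nat \<Rightarrow> vector set \<Rightarrow> history \<Rightarrow> nat \<Rightarrow> vector"
  where "projected_column d m h i =
    (\<lambda>t. if t \<in> {1..length h} then proj d m (fst (h ! (t - 1))) i else 0)"

definition column_space :: "nat \<Rightarrow> vector set \<Rightarrow> history \<Rightarrow> vector set"
  where "column_space d m h = span (projected_column d m h ` {1..d})"

definition residual :: "nat \<Rightarrow> history \<Rightarrow> vector set \<Rightarrow> real"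
  where "residual d h m =
    sqnorm (length h) (rewards h - proj (length h) (column_space d m h) (rewards h))"

definition least_squares_selector ::
  "nat \<Rightarrow> nat set set set \<Rightarrow> nat \<Rightarrow> (history \<Rightarrow> vector set) \<Rightarrow> bool"
  where "least_squares_selector d Q t2 sel \<longleftrightarrow>
    (\<forall>h. length h = t2 \<longrightarrow> is_arg_min (residual d h) (\<lambda>m. m \<in> models d Q) (sel h))"


section \<open>OFUL on a subspace\<close>

text \<open>
  OFUL with regularisation \<open>l\<close>, a bound \<open>S\<close> on the norm of the parameter, noise level
  \<open>\<sigma>\<close> and confidence \<open>1 - \<delta>\<close>, run on the subspace \<open>m\<close>: the arm \<open>x\<close>
  enters through its projection to \<open>m\<close>, which does not change the inner products with elements
  of \<open>m\<close>. The regularised Gram matrix is taken on all of the \<open>d\<close>-dimensional space; it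
  is \<open>l\<close> times the identity on the orthogonal complement of \<open>m\<close>, so its determinant
  divided by \<open>l ^ d\<close> is the ratio of the determinants on \<open>m\<close>. On \<open>m\<close> the
  ridge estimate is the usual inverse Gram matrix applied to the reward-weighted sum of the arms.
\<close>

definition gram :: "nat \<Rightarrow> real \<Rightarrow> vector set \<Rightarrow> history \<Rightarrow> real mat"
  where "gram d l m h = Matrix.mat d d (\<lambda>(i, j).
    (if i = j then l else 0) + (\<Sum>(x, y)\<leftarrow>h. proj d m x (Suc i) * proj d m x (Suc j)))"

definition ridge :: "nat \<Rightarrow> real \<Rightarrow> vector set \<Rightarrow> history \<Rightarrow> vector"
  where "ridge d l m h =
    arg_min_on (\<lambda>\<theta>. (\<Sum>(x, y)\<leftarrow>h. (y - dot d x \<theta>)\<^sup>2) + l * sqnorm d \<theta>) m"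

definition matrix_norm :: "nat \<Rightarrow> real mat \<Rightarrow> vector \<Rightarrow> real"
  where "matrix_norm d V u = sqrt (\<Sum>i<d. \<Sum>j<d. u (Suc i) * V $$ (i, j) * u (Suc j))"

definition confidence_radius ::
  "nat \<Rightarrow> real \<Rightarrow> real \<Rightarrow> real \<Rightarrow> real \<Rightarrow> real mat \<Rightarrow> real"
  where "confidence_radius d \<sigma> l S \<delta> V =
    \<sigma> * sqrt (2 * ln (sqrt (Determinant.det V) / sqrt (l ^ d) / \<delta>)) + sqrt l * S"

definition confidence_set ::
  "nat \<Rightarrow> real \<Rightarrow> real \<Rightarrow> real \<Rightarrow> real \<Rightarrow> vector set \<Rightarrow> history \<Rightarrow> vector set"
  where "confidence_set d \<sigma> l S \<delta> m h =
    {\<theta> \<in> m. matrix_norm d (gram d l m h) (\<theta> - ridge d l m h)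
              \<le> confidence_radius d \<sigma> l S \<delta> (gram d l m h)}"

definition oful_arm ::
  "nat \<Rightarrow> vector set \<Rightarrow> real \<Rightarrow> real \<Rightarrow> real \<Rightarrow> real \<Rightarrow> vector set \<Rightarrow> history \<Rightarrow> vector \<Rightarrow> bool"
  where "oful_arm d X \<sigma> l S \<delta> m h x \<longleftrightarrow>
    (\<exists>\<theta>. is_arg_max (\<lambda>(x', \<theta>'). dot d x' \<theta>')
          (\<lambda>p. p \<in> X \<times> confidence_set d \<sigma> l S \<delta> m h) (x, \<theta>))"


section \<open>Explore, then commit to the selected model\<close>

text \<open>
  The randomness is the sequence of independent exploratory arms together with the sequence of
  independent Gaussian noise variables. Ties in model selection and in the choice of the optimistic
  arm are broken by arbitrary rules \<open>sel\<close> and \<open>pol\<close>, which see the history only. OFUL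
  is started afresh after the exploration, on the data of the later rounds.
\<close>

definition sample_space :: "vector measure \<Rightarrow> real \<Rightarrow> ((nat \<Rightarrow> vector) \<times> (nat \<Rightarrow> real)) measure"
  where "sample_space \<nu> \<sigma> =
    (\<Pi>\<^sub>M t\<in>UNIV. \<nu>) \<Otimes>\<^sub>M (\<Pi>\<^sub>M t\<in>UNIV. density lborel (normal_density 0 \<sigma>))"

primrec run ::
  "nat \<Rightarrow> vector \<Rightarrow> nat \<Rightarrow> (history \<Rightarrow> vector) \<Rightarrow> nat \<Rightarrow> (nat \<Rightarrow> vector) \<times> (nat \<Rightarrow> real) \<Rightarrow> history"
  where
    "run d \<theta> t2 pol 0 \<omega> = []"
  | "run d \<theta> t2 pol (Suc n) \<omega> =
      (let h = run d \<theta> t2 pol n \<omega>;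
           x = (if Suc n \<le> t2 then fst \<omega> (Suc n) else pol h)
       in h @ [(x, dot d x \<theta> + snd \<omega> (Suc n))])"

definition arm_at ::
  "nat \<Rightarrow> vector \<Rightarrow> nat \<Rightarrow> (history \<Rightarrow> vector) \<Rightarrow> nat \<Rightarrow> (nat \<Rightarrow> vector) \<times> (nat \<Rightarrow> real) \<Rightarrow> vector"
  where "arm_at d \<theta> t2 pol t \<omega> = fst (last (run d \<theta> t2 pol t \<omega>))"

definition selected_model ::
  "nat \<Rightarrow> vector \<Rightarrow> nat \<Rightarrow> (history \<Rightarrow> vector set) \<Rightarrow> (history \<Rightarrow> vector) \<Rightarrow>
    (nat \<Rightarrow> vector) \<times> (nat \<Rightarrow> real) \<Rightarrow> vector set"
  where "selected_model d \<theta> t2 sel pol \<omega> = sel (run d \<theta> t2 pol t2 \<omega>)"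

definition oful_after_exploration ::
  "nat \<Rightarrow> vector set \<Rightarrow> real \<Rightarrow> real \<Rightarrow> real \<Rightarrow> real \<Rightarrow> nat \<Rightarrow> nat \<Rightarrow>
    (history \<Rightarrow> vector set) \<Rightarrow> (history \<Rightarrow> vector) \<Rightarrow> bool"
  where "oful_after_exploration d X \<sigma> l S \<delta> T t2 sel pol \<longleftrightarrow>
    (\<forall>h. fst ` set h \<subseteq> X \<longrightarrow> t2 \<le> length h \<longrightarrow> length h < T \<longrightarrow>
      oful_arm d X \<sigma> l S \<delta> (sel (take t2 h)) (drop t2 h) (pol h))"

text \<open>The last two conjuncts say that the tie-breaking rules are measurable along the run.\<close>

definition explore_then_commit ::
  "nat \<Rightarrow> vector set \<Rightarrow> vector \<Rightarrow> nat set set set \<Rightarrow> vector measure \<Rightarrow> real \<Rightarrow> real \<Rightarrow> real \<Rightarrow> real \<Rightarrow>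
    nat \<Rightarrow> nat \<Rightarrow> (history \<Rightarrow> vector set) \<Rightarrow> (history \<Rightarrow> vector) \<Rightarrow> bool"
  where "explore_then_commit d X \<theta> Q \<nu> \<sigma> l S \<delta> T t2 sel pol \<longleftrightarrow>
    least_squares_selector d Q t2 sel \<and>
    oful_after_exploration d X \<sigma> l S \<delta> T t2 sel pol \<and>
    selected_model d \<theta> t2 sel pol \<in> sample_space \<nu> \<sigma> \<rightarrow>\<^sub>M count_space (models d Q) \<and>
    (\<forall>t\<in>{1..T}. arm_at d \<theta> t2 pol t \<in> sample_space \<nu> \<sigma> \<rightarrow>\<^sub>M borel)"

definition expected_regret ::
  "nat \<Rightarrow> vector \<Rightarrow> vector \<Rightarrow> vector measure \<Rightarrow> real \<Rightarrow> nat \<Rightarrow> nat \<Rightarrow> (history \<Rightarrow> vector) \<Rightarrow> real"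
  where "expected_regret d \<theta> xs \<nu> \<sigma> T t2 pol =
    (\<integral>\<omega>. (\<Sum>t=1..T. dot d (xs - arm_at d \<theta> t2 pol t \<omega>) \<theta>) \<partial>sample_space \<nu> \<sigma>)"

definition exploration_rate ::
  "real \<Rightarrow> real \<Rightarrow> nat \<Rightarrow> nat \<Rightarrow> nat \<Rightarrow> real \<Rightarrow> real \<Rightarrow> real"
  where "exploration_rate \<sigma> Kx d0 d T Cmin \<epsilon>0 =
    \<sigma>\<^sup>2 * Kx\<^sup>2 * real d0 * ln (real d * real T) / (Cmin\<^sup>2 * \<epsilon>0\<^sup>2)"

text \<open>
  The regime in which the asymptotic notation is read. Only one-sided bounds define \<open>Kx\<close>,
  \<open>Rmax\<close> and \<open>\<epsilon>0\<close>, and neither the exploration rate nor \<open>ln (Kx * T)\<close> is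
  invariant under rescaling arms against parameter, so both can be made arbitrarily small on a fixed
  problem. The constants are therefore uniform over all parameters with \<open>Kx\<close>,
  \<open>\<sigma> / \<epsilon>0\<close> and the logarithms bounded away from 0 by \<open>\<kappa>\<close>, for every
  \<open>\<kappa> > 0\<close>; any instance with \<open>T \<ge> 2\<close> and \<open>Kx * T > 1\<close> is covered by
  some \<open>\<kappa>\<close>.
\<close>

definition nondegenerate :: "real \<Rightarrow> nat \<Rightarrow> real \<Rightarrow> real \<Rightarrow> real \<Rightarrow> bool"
  where "nondegenerate \<kappa> T \<sigma> Kx \<epsilon>0 \<longleftrightarrow>
    2 \<le> T \<and> \<kappa> \<le> Kx \<and> \<kappa> * \<epsilon>0 \<le> \<sigma> \<and> \<kappa> \<le> ln (Kx * real T)"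

end

theory Submission
  imports Defs
begin

text \<open>
  Exploration. If a model \<open>m\<close> not containing \<open>\<theta>\<close> beats the true one, then some
  \<open>v = \<beta> - \<theta>\<close> with \<open>\<beta> \<in> m\<close> satisfies
  \<open>\<Sum> \<langle>x\<^sub>t, v\<rangle>\<^sup>2 \<le> 2 \<Sum> \<eta>\<^sub>t \<langle>x\<^sub>t, v\<rangle>\<close>, while separation forces \<open>\<parallel>v\<parallel>\<^sup>2 \<ge> \<epsilon>0\<^sup>2 / 2\<close>. The
  left-hand side is bounded below by a Chernoff bound over a lattice net, the right-hand side above
  by the self-normalised Gaussian martingale \<open>exp (\<parallel>S\<parallel>\<^sup>2 / (2 \<sigma>\<^sup>2)) / sqrt (det V / l ^ d)\<close>, where
  \<open>S\<close> is the noise-weighted sum of the arms, with norm taken with respect to the inverse of the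
  regularised Gram matrix \<open>V\<close>. That this is a martingale reduces, by the Sherman--Morrison
  formula, to a one-dimensional Gaussian integral.

  Commitment. The usual elliptical potential argument would lose a factor \<open>sqrt (ln T)\<close>. As
  the arm set is fixed and the confidence level may be taken so small that the confidence radius is
  twice the actual estimation error, optimism implies that an arm played at a round \<open>t\<close> was
  not much more uncertain at an earlier round \<open>s\<close> than the arms played at \<open>s\<close> and at \<open>t\<close> were at
  their own rounds. Hence during each dyadic level of uncertainty the determinant of the Gram matrix
  grows only by a constant factor per dimension, and the uncertainties add up to
  \<open>O(sqrt (d0 T))\<close>.
\<close>

text \<open>The target \<open>\<sigma> * d0 * sqrt (T * ln T)\<close> is the confidence radius
  \<open>O(\<sigma> * sqrt (d0 * ln T))\<close> times the sum of the uncertainties, so the latter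
  has to be \<open>O(sqrt (d0 * T))\<close> without any logarithm. Neither \<open>d\<close> nor the
  number of models may enter this term. All differences between \<open>\<theta>\<close> and elements
  of one model lie in \<open>sep_model\<close>, of dimension at most \<open>2 * d0\<close>, and
  \<open>Kx\<close> controls projections to such spaces; nets and determinants of the exploration
  are formed there. A union bound over the models is paid for only in the exploration, where
  \<open>ln (card Q)\<close> is \<open>O(d0 * ln (d * T))\<close>. In the OFUL phase it would put
  \<open>ln d\<close> into the radius. Instead the martingale is restarted at the first OFUL round
  and integrated against the indicator of the selected model; these events are disjoint, so their
  probabilities add up to at most 1. Conditional expectations do not occur. A process is adapted if
  overwriting later noise leaves it unchanged, and a martingale step integrates out one resampled
  coordinate.\<close>

section \<open>Inner products\<close>

text \<open>Induction leaves vectors eta-expanded; pointwise simplification rules would then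
  destroy the vector space structure.\<close>

declare plus_fun_apply [simp del] zero_fun_apply [simp del] minus_apply [simp del] uminus_apply [simp del]

lemma sum_fun_apply: "(\<Sum>a\<in>A. f a) i = (\<Sum>a\<in>A. f a i)"
  for f :: "'a \<Rightarrow> 'b \<Rightarrow> 'c::comm_monoid_add"
  by (induction A rule: infinite_finite_induct) (auto simp: plus_fun_apply zero_fun_apply)

lemma scaleR_fun_apply: "(r *\<^sub>R f) i = r *\<^sub>R f i"
  by (simp add: scaleR_fun_def)

lemmas vector_apply = plus_fun_apply zero_fun_apply minus_apply uminus_apply scaleR_fun_apply

lemma dot_commute: "dot d u v = dot d v u"
  by (simp add: dot_def mult.commute)

lemma dot_linear [simp]:
  "dot d (u + v) w = dot d u w + dot d v w"
  "dot d (u - v) w = dot d u w - dot d v w"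
  "dot d (r *\<^sub>R u) w = r * dot d u w"
  "dot d 0 w = 0"
  "dot d (- u) w = - dot d u w"
  "dot d w (u + v) = dot d w u + dot d w v"
  "dot d w (u - v) = dot d w u - dot d w v"
  "dot d w (r *\<^sub>R u) = r * dot d w u"
  "dot d w 0 = 0"
  "dot d w (- u) = - dot d w u"
  by (auto simp: vector_apply dot_def algebra_simps sum.distrib sum_subtractf sum_distrib_left sum_negf)

lemma dot_sum_left: "dot d (\<Sum>a\<in>A. f a) w = (\<Sum>a\<in>A. dot d (f a) w)"
  by (induction A rule: infinite_finite_induct) auto

lemma dot_sum_right: "dot d w (\<Sum>a\<in>A. f a) = (\<Sum>a\<in>A. dot d w (f a))"
  by (induction A rule: infinite_finite_induct) auto

lemma sqnorm_nonneg [simp]: "0 \<le> sqnorm d v"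
  by (simp add: sqnorm_def dot_def sum_nonneg)

lemma sqnorm_scaleR [simp]: "sqnorm d (r *\<^sub>R v) = r\<^sup>2 * sqnorm d v"
  by (simp add: sqnorm_def power2_eq_square)

lemma sqnorm_0 [simp]: "sqnorm d 0 = 0"
  by (simp add: sqnorm_def)

lemma sqnorm_add: "sqnorm d (u + v) = sqnorm d u + 2 * dot d u v + sqnorm d v"
  by (simp add: sqnorm_def dot_commute)

lemma sqnorm_eq_0_iff:
  assumes "v \<in> euclid d"
  shows "sqnorm d v = 0 \<longleftrightarrow> v = 0"
proof
  assume "sqnorm d v = 0"
  then have "\<forall>i\<in>{1..d}. v i * v i = 0"
    unfolding sqnorm_def dot_def by (subst (asm) sum_nonneg_eq_0_iff) auto
  then show "v = 0"
    using assms by (force simp: euclid_def fun_eq_iff vector_apply)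
qed auto

lemma dot_squared_le: "(dot d u v)\<^sup>2 \<le> sqnorm d u * sqnorm d v"
  using Cauchy_Schwarz_ineq_sum[of u v "{1..d}"]
  by (simp add: dot_def sqnorm_def power2_eq_square)

lemma euclid_closed [simp]:
  "0 \<in> euclid d" "u \<in> euclid d \<Longrightarrow> v \<in> euclid d \<Longrightarrow> u + v \<in> euclid d"
  "u \<in> euclid d \<Longrightarrow> v \<in> euclid d \<Longrightarrow> u - v \<in> euclid d"
  "u \<in> euclid d \<Longrightarrow> r *\<^sub>R u \<in> euclid d"
  by (auto simp: euclid_def vector_apply)

lemma subspace_euclid: "subspace (euclid d)"
  by (auto simp: subspace_def)

section \<open>Rank-one updates of a regularised Gram operator\<close>

text \<open>Inequalities are derived for operators on function vectors; Gram matrices enter only for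
  determinants and to unfold the confidence sets. The newest vector is the head of the list, so that
  one recursion step is one round.\<close>

primrec gram_op :: "nat \<Rightarrow> real \<Rightarrow> vector list \<Rightarrow> vector \<Rightarrow> vector" where
  "gram_op d l [] v = l *\<^sub>R v"
| "gram_op d l (z # zs) v = gram_op d l zs v + dot d z v *\<^sub>R z"

text \<open>The inverse of \<open>gram_op\<close>, updated by the Sherman--Morrison formula.\<close>

primrec gram_inv :: "nat \<Rightarrow> real \<Rightarrow> vector list \<Rightarrow> vector \<Rightarrow> vector" where
  "gram_inv d l [] v = (1 / l) *\<^sub>R v"
| "gram_inv d l (z # zs) v = gram_inv d l zs v -
     (dot d z (gram_inv d l zs v) / (1 + dot d z (gram_inv d l zs z))) *\<^sub>R gram_inv d l zs z"

text \<open>The determinant of the Gram operator divided by that of its regularisation.\<close>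

primrec gram_det :: "nat \<Rightarrow> real \<Rightarrow> vector list \<Rightarrow> real" where
  "gram_det d l [] = 1"
| "gram_det d l (z # zs) = gram_det d l zs * (1 + dot d z (gram_inv d l zs z))"

lemma gram_op_linear [simp]:
  "gram_op d l zs (u + v) = gram_op d l zs u + gram_op d l zs v"
  "gram_op d l zs (u - v) = gram_op d l zs u - gram_op d l zs v"
  "gram_op d l zs (r *\<^sub>R u) = r *\<^sub>R gram_op d l zs u"
  "gram_op d l zs 0 = 0"
  by (induction zs) (auto simp: algebra_simps)

lemma gram_inv_linear [simp]:
  "gram_inv d l zs (u + v) = gram_inv d l zs u + gram_inv d l zs v"
  "gram_inv d l zs (u - v) = gram_inv d l zs u - gram_inv d l zs v"
  "gram_inv d l zs (r *\<^sub>R u) = r *\<^sub>R gram_inv d l zs u"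
  "gram_inv d l zs 0 = 0"
proof -
  show add: "gram_inv d l zs (u + v) = gram_inv d l zs u + gram_inv d l zs v" for u v
  proof (induction zs arbitrary: u v)
    case (Cons z zs)
    show ?case by (simp add: Cons add_divide_distrib scaleR_add_left)
  qed (simp add: scaleR_add_right)
  show scale: "gram_inv d l zs (r *\<^sub>R u) = r *\<^sub>R gram_inv d l zs u" for r u
  proof (induction zs arbitrary: u)
    case (Cons z zs)
    show ?case by (simp add: Cons scaleR_diff_right)
  qed simp
  show "gram_inv d l zs (u - v) = gram_inv d l zs u - gram_inv d l zs v"
    using add[of u "(- 1) *\<^sub>R v"] scale[of "- 1" v] by simp
  show "gram_inv d l zs 0 = 0"
    using scale[of 0 0] by simp
qed

lemma dot_gram_op_commute: "dot d u (gram_op d l zs v) = dot d (gram_op d l zs u) v"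
  by (induction zs) (auto simp: dot_commute)

lemma dot_gram_inv_commute: "dot d u (gram_inv d l zs v) = dot d (gram_inv d l zs u) v"
proof (induction zs arbitrary: u v)
  case (Cons z zs)
  have "dot d u (gram_inv d l zs z) = dot d z (gram_inv d l zs u)"
    using Cons[of u z] by (simp only: dot_commute)
  moreover have "dot d (gram_inv d l zs z) v = dot d z (gram_inv d l zs v)"
    using Cons[of z v] by simp
  ultimately show ?case
    using Cons[of u v] by (simp only: gram_inv.simps dot_linear times_divide_eq_left times_divide_eq_right mult.commute)
qed simp

lemma dot_gram_op: "dot d u (gram_op d l zs v) = l * dot d u v + (\<Sum>z\<leftarrow>zs. dot d z u * dot d z v)"
  by (induction zs) (auto simp: dot_commute)

lemma dot_gram_op_self: "dot d v (gram_op d l zs v) = l * sqnorm d v + (\<Sum>z\<leftarrow>zs. (dot d z v)\<^sup>2)"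
  by (simp add: dot_gram_op sqnorm_def power2_eq_square)

lemma dot_gram_op_ge: "l * sqnorm d v \<le> dot d v (gram_op d l zs v)"
  by (auto simp: dot_gram_op_self intro!: sum_list_nonneg)

lemma dot_gram_op_nonneg: "0 < l \<Longrightarrow> 0 \<le> dot d v (gram_op d l zs v)"
  by (rule order_trans[OF _ dot_gram_op_ge]) simp

text \<open>Sherman--Morrison divides by \<open>1 + ?w\<close>. That \<open>?w\<close> is
  nonnegative follows from the inverse property for the shorter list, because \<open>?w\<close> is
  the Gram form at the vector \<open>gram_inv d l zs z\<close>.\<close>

lemma gram_op_gram_inv_and_nonneg:
  assumes "0 < l"
  shows "gram_op d l zs (gram_inv d l zs v) = v \<and> 0 \<le> dot d v (gram_inv d l zs v)"
proof -
  have *: "gram_op d l zs (gram_inv d l zs v) = v" for v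
  proof (induction zs arbitrary: v)
    case (Cons z zs)
    let ?w = "dot d z (gram_inv d l zs z)" and ?c = "dot d z (gram_inv d l zs v)"
    have "0 \<le> ?w"
      using dot_gram_op_nonneg[OF assms, of d "gram_inv d l zs z" zs] Cons[of z]
      by (simp add: dot_commute)
    then have "?c - ?c / (1 + ?w) * (1 + ?w) = 0"
      by simp
    moreover have "gram_op d l (z # zs) (gram_inv d l (z # zs) v) = v + (?c - ?c / (1 + ?w) * (1 + ?w)) *\<^sub>R z"
      by (simp add: Cons scaleR_add_left scaleR_add_right scaleR_diff_left distrib_left)
    ultimately show ?case
      by (simp only: scaleR_zero_left add_0_right)
  qed (use assms in auto)
  have "0 \<le> dot d v (gram_inv d l zs v)"
    using dot_gram_op_nonneg[OF assms, of d "gram_inv d l zs v" zs] *[of v]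
    by (simp add: dot_commute)
  with * show ?thesis by simp
qed

lemma gram_op_gram_inv [simp]: "0 < l \<Longrightarrow> gram_op d l zs (gram_inv d l zs v) = v"
  using gram_op_gram_inv_and_nonneg by blast

lemma dot_gram_inv_nonneg [simp]: "0 < l \<Longrightarrow> 0 \<le> dot d v (gram_inv d l zs v)"
  using gram_op_gram_inv_and_nonneg by blast

lemma gram_inv_gram_op [simp]:
  assumes "0 < l"
  shows "gram_inv d l zs (gram_op d l zs v) = v"
proof (induction zs arbitrary: v)
  case (Cons z zs)
  let ?w = "dot d z (gram_inv d l zs z)"
  have "0 \<le> ?w" using assms by simp
  then have "dot d z v - dot d z v / (1 + ?w) * (1 + ?w) = 0"
    by simp
  moreover have "gram_inv d l (z # zs) (gram_op d l (z # zs) v)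
      = v + (dot d z v - dot d z v / (1 + ?w) * (1 + ?w)) *\<^sub>R gram_inv d l zs z"
    by (simp add: Cons scaleR_add_left scaleR_add_right scaleR_diff_left scaleR_diff_right distrib_left add_divide_distrib)
  ultimately show ?case
    by (simp only: scaleR_zero_left add_0_right)
qed (use assms in auto)

text \<open>Cauchy--Schwarz for a norm and its dual: the Gram form at
  \<open>?p + s *\<^sub>R v\<close> is a quadratic polynomial in \<open>s\<close> without negative
  values, and its discriminant is the claim.\<close>

lemma dot_squared_le_gram:
  assumes "0 < l"
  shows "(dot d u v)\<^sup>2 \<le> dot d u (gram_inv d l zs u) * dot d v (gram_op d l zs v)"
proof -
  let ?p = "gram_inv d l zs u"
  let ?a = "dot d v (gram_op d l zs v)" and ?b = "dot d u v" and ?c = "dot d u ?p"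
  have q: "0 \<le> ?c + 2 * s * ?b + s\<^sup>2 * ?a" for s
  proof -
    have "0 \<le> dot d (?p + s *\<^sub>R v) (gram_op d l zs (?p + s *\<^sub>R v))"
      using assms by (rule dot_gram_op_nonneg)
    also have "\<dots> = ?c + 2 * s * ?b + s\<^sup>2 * ?a"
      using assms dot_gram_op_commute[of d ?p l zs v] dot_commute[of d ?p u] dot_commute[of d v u]
      by (simp add: algebra_simps power2_eq_square)
    finally show ?thesis .
  qed
  show ?thesis
  proof (cases "?a = 0")
    case True
    have "?b = 0"
    proof (rule ccontr)
      assume "?b \<noteq> 0"
      \<comment> \<open>With \<open>?a = 0\<close> the polynomial is linear in \<open>s\<close>; at
        the chosen point its value is -1.\<close>
      then show False
        using q[of "- (?c + 1) / (2 * ?b)"] True by (simp add: field_simps)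
    qed
    with True show ?thesis by simp
  next
    case False
    then have "0 < ?a" using dot_gram_op_nonneg[OF assms, of d v zs] by linarith
    then show ?thesis
      using q[of "- ?b / ?a"] by (simp add: field_simps power2_eq_square)
  qed
qed

lemma gram_op_append: "gram_op d l (ys @ zs) v = gram_op d l zs v + (\<Sum>y\<leftarrow>ys. dot d y v *\<^sub>R y)"
  by (induction ys) (auto simp: algebra_simps)

lemma dot_gram_inv_Cons:
  "dot d u (gram_inv d l (z # zs) v) = dot d u (gram_inv d l zs v)
    - dot d z (gram_inv d l zs u) * dot d z (gram_inv d l zs v) / (1 + dot d z (gram_inv d l zs z))"
  by (simp add: dot_gram_inv_commute[of d u l zs z] dot_commute[of d _ z])

lemma dot_gram_inv_Cons_le:
  assumes "0 < l"
  shows "dot d v (gram_inv d l (z # zs) v) \<le> dot d v (gram_inv d l zs v)"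
  unfolding dot_gram_inv_Cons using dot_gram_inv_nonneg[OF assms, of d z zs]
  by (simp add: power2_eq_square[symmetric])

lemma dot_gram_inv_append_le:
  assumes "0 < l"
  shows "dot d v (gram_inv d l (ys @ zs) v) \<le> dot d v (gram_inv d l zs v)"
proof (induction ys)
  case (Cons y ys)
  then show ?case
    using dot_gram_inv_Cons_le[OF assms, of d v y "ys @ zs"] by (simp only: append_Cons)
qed simp

lemma dot_gram_inv_le:
  assumes "0 < l"
  shows "dot d v (gram_inv d l zs v) \<le> sqnorm d v / l"
  using dot_gram_inv_append_le[OF assms, of d v zs "[]"] by (simp add: sqnorm_def)

lemma gram_inv_closed:
  assumes "subspace M" "set zs \<subseteq> M" "v \<in> M"
  shows "gram_inv d l zs v \<in> M"
  using assms(2,3) 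
  by (induction zs arbitrary: v) (auto intro!: subspace_diff[OF assms(1)] subspace_scale[OF assms(1)])

lemma gram_det_ge_1:
  assumes "0 < l"
  shows "1 \<le> gram_det d l zs"
proof (induction zs)
  case (Cons z zs)
  have "1 * 1 \<le> gram_det d l zs * (1 + dot d z (gram_inv d l zs z))"
    using Cons assms by (intro mult_mono) auto
  then show ?case by simp
qed simp

lemma gram_det_append_ge:
  assumes "0 < l"
  shows "gram_det d l zs \<le> gram_det d l (ys @ zs)"
proof (induction ys)
  case (Cons z ys)
  have "gram_det d l (ys @ zs) * 1 \<le> gram_det d l (ys @ zs) * (1 + dot d z (gram_inv d l (ys @ zs) z))"
    using assms gram_det_ge_1[OF assms, of d "ys @ zs"] by (intro mult_left_mono) auto
  with Cons show ?case by simp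
qed simp

section \<open>The determinant of the Gram matrix\<close>

definition gram_mat :: "nat \<Rightarrow> real \<Rightarrow> vector list \<Rightarrow> real mat" where
  "gram_mat d l zs = Matrix.mat d d (\<lambda>(i, j). (if i = j then l else 0) + (\<Sum>z\<leftarrow>zs. z (Suc i) * z (Suc j)))"

definition to_vec :: "nat \<Rightarrow> vector \<Rightarrow> real vec" where
  "to_vec d v = Matrix.vec d (\<lambda>i. v (Suc i))"

lemma dot_eq_scalar_prod: "dot d u v = scalar_prod (to_vec d u) (to_vec d v)"
  by (simp add: dot_def scalar_prod_def to_vec_def sum.atLeast1_atMost_eq atLeast0LessThan)

lemma gram_mat_carrier [simp]: "gram_mat d l zs \<in> carrier_mat d d"
  by (simp add: gram_mat_def)

text \<open>Matrix determinant lemma. \<open>?A\<close> has determinant 1 and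
  \<open>?A * ?B = ?C * ?A\<close>, so the block triangular matrices \<open>?B\<close> and
  \<open>?C\<close> have equal determinants, which are the two sides.\<close>

lemma det_rank_one_update:
  fixes x y :: "real vec"
  assumes "x \<in> carrier_vec n" "y \<in> carrier_vec n"
  shows "Determinant.det (1\<^sub>m n + Matrix.mat n n (\<lambda>(i, j). x $ i * y $ j)) = 1 + scalar_prod x y"
proof -
  let ?U = "Matrix.mat n 1 (\<lambda>(i, j). x $ i)" and ?V = "Matrix.mat 1 n (\<lambda>(i, j). y $ j)"
  let ?S = "1\<^sub>m n + Matrix.mat n n (\<lambda>(i, j). x $ i * y $ j)"
  let ?A = "four_block_mat (1\<^sub>m n) (0\<^sub>m n 1) ?V (1\<^sub>m 1)"
  let ?B = "four_block_mat ?S ?U (0\<^sub>m 1 n) (1\<^sub>m 1)"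
  let ?C = "four_block_mat (1\<^sub>m n) ?U (0\<^sub>m 1 n) (1\<^sub>m 1 + ?V * ?U)"
  have UV: "?U * ?V = Matrix.mat n n (\<lambda>(i, j). x $ i * y $ j)"
    by (rule eq_matI) (auto simp: scalar_prod_def)
  have VU: "Determinant.det (1\<^sub>m 1 + ?V * ?U) = 1 + scalar_prod x y"
    using assms by (subst det_single) (auto simp: scalar_prod_def mult.commute)
  have "?A * ?B = four_block_mat (1\<^sub>m n * ?S + 0\<^sub>m n 1 * 0\<^sub>m 1 n) (1\<^sub>m n * ?U + 0\<^sub>m n 1 * 1\<^sub>m 1)
     (?V * ?S + 1\<^sub>m 1 * 0\<^sub>m 1 n) (?V * ?U + 1\<^sub>m 1 * 1\<^sub>m 1)"
    by (rule mult_four_block_mat) auto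
  also have "\<dots> = four_block_mat ?S ?U (?V * ?S) (1\<^sub>m 1 + ?V * ?U)"
    by (intro arg_cong4[where f=four_block_mat]) (auto simp: comm_add_mat[of _ 1 1])
  finally have AB: "?A * ?B = four_block_mat ?S ?U (?V * ?S) (1\<^sub>m 1 + ?V * ?U)" .
  have "?C * ?A = four_block_mat (1\<^sub>m n * 1\<^sub>m n + ?U * ?V) (1\<^sub>m n * 0\<^sub>m n 1 + ?U * 1\<^sub>m 1)
     (0\<^sub>m 1 n * 1\<^sub>m n + (1\<^sub>m 1 + ?V * ?U) * ?V) (0\<^sub>m 1 n * 0\<^sub>m n 1 + (1\<^sub>m 1 + ?V * ?U) * 1\<^sub>m 1)"
    by (rule mult_four_block_mat) auto
  also have "\<dots> = four_block_mat ?S ?U (?V * ?S) (1\<^sub>m 1 + ?V * ?U)"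
  proof (intro arg_cong4[where f=four_block_mat])
    have "(1\<^sub>m 1 + ?V * ?U) * ?V = 1\<^sub>m 1 * ?V + ?V * ?U * ?V"
      by (rule add_mult_distrib_mat[of _ 1 1]) auto
    also have "?V * ?U * ?V = ?V * (?U * ?V)"
      by (rule assoc_mult_mat[of _ 1 n _ 1]) auto
    also have "1\<^sub>m 1 * ?V + ?V * (?U * ?V) = ?V * 1\<^sub>m n + ?V * (?U * ?V)"
      by simp
    also have "\<dots> = ?V * ?S"
      unfolding UV by (rule mult_add_distrib_mat[symmetric, of _ 1 n]) auto
    finally have eq: "(1\<^sub>m 1 + ?V * ?U) * ?V = ?V * ?S" .
    show "0\<^sub>m 1 n * 1\<^sub>m n + (1\<^sub>m 1 + ?V * ?U) * ?V = ?V * ?S"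
      unfolding eq left_mult_zero_mat[OF one_carrier_mat] by (rule left_add_zero_mat[of _ 1 n]) auto
  qed (use UV in \<open>auto simp: left_add_zero_mat[of _ 1 1] right_add_zero_mat[of _ 1 1]\<close>)
  finally have "?A * ?B = ?C * ?A"
    using AB by simp
  moreover have c: "?A \<in> carrier_mat (n + 1) (n + 1)" "?B \<in> carrier_mat (n + 1) (n + 1)"
      "?C \<in> carrier_mat (n + 1) (n + 1)"
    by (intro four_block_carrier_mat; auto simp del: One_nat_def)+
  ultimately have "Determinant.det ?A * Determinant.det ?B = Determinant.det ?C * Determinant.det ?A"
    by (simp only: det_mult[OF c(1,2), symmetric] det_mult[OF c(3,1), symmetric])
  moreover have "Determinant.det ?A = 1"
    by (subst det_four_block_mat_upper_right_zero[of _ n _ 1]) auto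
  moreover have "Determinant.det ?B = Determinant.det ?S"
    by (subst det_four_block_mat_lower_left_zero[of _ n _ 1]) auto
  moreover have "Determinant.det ?C = 1 + scalar_prod x y"
  proof -
    have "Determinant.det ?C = Determinant.det (1\<^sub>m n :: real mat) * Determinant.det (1\<^sub>m 1 + ?V * ?U)"
      by (rule det_four_block_mat_lower_left_zero[of _ n _ 1]) auto
    then show ?thesis by (simp only: VU det_one mult_1)
  qed
  ultimately show ?thesis by simp
qed

lemma dot_eq_sum_lessThan: "dot d u v = (\<Sum>i<d. u (Suc i) * v (Suc i))"
  by (simp add: dot_def sum.atLeast1_atMost_eq)

lemma gram_op_apply:
  assumes "i < d"
  shows "gram_op d l zs v (Suc i) = (\<Sum>j<d. gram_mat d l zs $$ (i, j) * v (Suc j))"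
  using assms
proof (induction zs)
  case Nil
  have "(\<Sum>j<d. (if i = j then l else 0) * v (Suc j)) = l * v (Suc i)"
    using Nil by (subst sum.remove[of _ i]) auto
  then show ?case using Nil by (simp add: gram_mat_def vector_apply)
next
  case (Cons z zs)
  then show ?case
    by (simp add: vector_apply gram_mat_def dot_eq_sum_lessThan algebra_simps sum.distrib sum_distrib_left sum_distrib_right)
qed

text \<open>The factorisation V + z z' = V (1 + (V^-1 z) z'), with z' the transpose. The second
  factor is a rank-one update of the identity, which explains the recursion of
  \<open>gram_det\<close>.\<close>

lemma gram_mat_Cons:
  assumes "0 < l"
  shows "gram_mat d l (z # zs) = gram_mat d l zs *
    (1\<^sub>m d + Matrix.mat d d (\<lambda>(i, j). to_vec d (gram_inv d l zs z) $ i * to_vec d z $ j))"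
proof (rule eq_matI)
  let ?p = "gram_inv d l zs z"
  let ?G = "gram_mat d l zs"
  fix i j
  assume "i < dim_row (?G * (1\<^sub>m d + Matrix.mat d d (\<lambda>(i, j). to_vec d ?p $ i * to_vec d z $ j)))"
    and "j < dim_col (?G * (1\<^sub>m d + Matrix.mat d d (\<lambda>(i, j). to_vec d ?p $ i * to_vec d z $ j)))"
  then have ij: "i < d" "j < d" by (auto simp: gram_mat_def)
  have "(?G * (1\<^sub>m d + Matrix.mat d d (\<lambda>(i, j). to_vec d ?p $ i * to_vec d z $ j))) $$ (i, j)
    = (\<Sum>k<d. ?G $$ (i, k) * ((if k = j then 1 else 0) + ?p (Suc k) * z (Suc j)))"
    using ij by (simp add: scalar_prod_def to_vec_def gram_mat_def atLeast0LessThan)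
  also have "\<dots> = ?G $$ (i, j) + (\<Sum>k<d. ?G $$ (i, k) * ?p (Suc k)) * z (Suc j)"
  proof -
    have "(\<Sum>k<d. ?G $$ (i, k) * ((if k = j then 1 else 0) + ?p (Suc k) * z (Suc j)))
      = (\<Sum>k<d. if k = j then ?G $$ (i, k) else 0) + (\<Sum>k<d. ?G $$ (i, k) * ?p (Suc k) * z (Suc j))"
      unfolding sum.distrib[symmetric] by (intro sum.cong) (auto simp: algebra_simps)
    with ij show ?thesis by (simp add: sum_distrib_right)
  qed
  also have "(\<Sum>k<d. ?G $$ (i, k) * ?p (Suc k)) = z (Suc i)"
    using gram_op_apply[OF ij(1), of l zs ?p] assms by simp
  finally show "gram_mat d l (z # zs) $$ (i, j) =
      (?G * (1\<^sub>m d + Matrix.mat d d (\<lambda>(i, j). to_vec d ?p $ i * to_vec d z $ j))) $$ (i, j)"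
    using ij by (simp add: gram_mat_def)
qed (auto simp: gram_mat_def)

lemma gram_mat_Nil: "gram_mat d l [] = l \<cdot>\<^sub>m 1\<^sub>m d"
  by (rule eq_matI) (auto simp: gram_mat_def)

lemma det_gram_mat:
  assumes "0 < l"
  shows "Determinant.det (gram_mat d l zs) = l ^ d * gram_det d l zs"
proof (induction zs)
  case Nil
  then show ?case by (simp add: gram_mat_Nil)
next
  case (Cons z zs)
  have "to_vec d (gram_inv d l zs z) \<in> carrier_vec d" "to_vec d z \<in> carrier_vec d"
    by (auto simp: to_vec_def)
  from det_rank_one_update[OF this] show ?case
    unfolding gram_mat_Cons[OF assms]
    by (subst det_mult[of _ d]) (auto simp: Cons dot_eq_scalar_prod[symmetric] dot_commute[of d _ z])
qed

text \<open>The recursion defining \<open>gram_det\<close> sees the order of the vectors, the Gram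
  matrix does not. This permits inserting vectors below the top of a list.\<close>

lemma gram_det_cong:
  assumes "0 < l" and "mset ys = mset zs"
  shows "gram_det d l ys = gram_det d l zs"
proof -
  have "(\<Sum>z\<leftarrow>ys. f z) = (\<Sum>z\<leftarrow>zs. f z)" for f :: "vector \<Rightarrow> real"
    using assms(2) by (metis mset_map sum_mset_sum_list)
  then have "gram_mat d l ys = gram_mat d l zs"
    by (simp add: gram_mat_def)
  then show ?thesis
    using det_gram_mat[OF assms(1), of d] assms(1) by (metis mult_cancel_left power_not_zero less_irrefl)
qed

section \<open>Orthonormal bases and projections\<close>

text \<open>The type of vectors is not an inner product class, so this predicate carries the
  geometry of subspaces; \<open>card E\<close> plays the role of the dimension in all later
  bounds.\<close>

definition onb :: "nat \<Rightarrow> vector set \<Rightarrow> vector set \<Rightarrow> bool" where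
  "onb d E M \<longleftrightarrow> finite E \<and> subspace M \<and> M \<subseteq> euclid d \<and> E \<subseteq> M \<and>
     (\<forall>a\<in>E. \<forall>b\<in>E. dot d a b = (if a = b then 1 else 0)) \<and>
     (\<forall>v\<in>M. v = (\<Sum>e\<in>E. dot d v e *\<^sub>R e))"

lemma onbD:
  assumes "onb d E M"
  shows "finite E" "subspace M" "M \<subseteq> euclid d" "E \<subseteq> M"
    "\<And>a b. a \<in> E \<Longrightarrow> b \<in> E \<Longrightarrow> dot d a b = (if a = b then 1 else 0)"
    "\<And>v. v \<in> M \<Longrightarrow> (\<Sum>e\<in>E. dot d v e *\<^sub>R e) = v"
  using assms unfolding onb_def by auto

lemma span_subset_euclid: "F \<subseteq> euclid d \<Longrightarrow> span F \<subseteq> euclid d"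
  by (rule span_minimal[OF _ subspace_euclid])

lemma dot_onb_sum:
  assumes "finite E" "\<And>a b. a \<in> E \<Longrightarrow> b \<in> E \<Longrightarrow> dot d a b = (if a = b then 1 else 0)" "b \<in> E"
  shows "dot d (\<Sum>e\<in>E. f e *\<^sub>R e) b = f b"
proof -
  have "dot d (\<Sum>e\<in>E. f e *\<^sub>R e) b = (\<Sum>e\<in>E. if e = b then f e else 0)"
    unfolding dot_sum_left using assms by (intro sum.cong) auto
  with assms show ?thesis by simp
qed

text \<open>Gram--Schmidt, one generator at a time. A generator already in the span contributes
  nothing, hence only an inequality between the cardinalities.\<close>

lemma onb_exists:
  assumes "finite F" "F \<subseteq> euclid d"
  shows "\<exists>E. onb d E (span F) \<and> card E \<le> card F"
  using assms
proof (induction F)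
  case empty
  have "onb d {} (span {})" by (auto simp: onb_def)
  then show ?case by (intro exI[of _ "{}"]) auto
next
  case (insert f F)
  then obtain E where E: "onb d E (span F)" "card E \<le> card F" by auto
  note ED = onbD[OF E(1)]
  define q where "q = (\<Sum>e\<in>E. dot d f e *\<^sub>R e)"
  define r where "r = f - q"
  have q: "q \<in> span F" unfolding q_def using ED by (auto intro!: span_sum span_scale)
  have fr: "f = r + q" by (simp add: r_def)
  have er: "dot d r e = 0" if "e \<in> E" for e
    using dot_onb_sum[OF ED(1,5) that, of "\<lambda>e. dot d f e"] by (simp add: r_def q_def)
  have re: "r \<in> euclid d" unfolding r_def using insert ED q by auto
  have sub: "span F \<subseteq> span (insert f F)" by (intro span_mono) auto
  show ?case
  proof (cases "r = 0")
    case True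
    then have "f \<in> span F" using q fr by simp
    then have "span (insert f F) = span F" by (simp add: span_redundant)
    with E insert show ?thesis by (intro exI[of _ E]) auto
  next
    case False
    then have r: "0 < sqnorm d r"
      using sqnorm_eq_0_iff[OF re] sqnorm_nonneg[of d r] by linarith
    define g where "g = (1 / sqrt (sqnorm d r)) *\<^sub>R r"
    have gr: "r = sqrt (sqnorm d r) *\<^sub>R g" unfolding g_def using r by simp
    have gg: "dot d g g = 1" unfolding g_def using r by (simp add: sqnorm_def)
    have eg: "dot d g e = 0" "dot d e g = 0" if "e \<in> E" for e
      using er[OF that] by (simp_all add: g_def dot_commute[of d e])
    have "g \<notin> E" using gg eg by force
    have gs: "g \<in> span (insert f F)"
      unfolding g_def r_def using q sub by (intro span_scale span_diff) (auto intro: span_base)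
    have ug: "dot d u g = 0" if "u \<in> span F" for u
    proof -
      have "dot d (\<Sum>e\<in>E. dot d u e *\<^sub>R e) g = 0" unfolding dot_sum_left using eg by simp
      with ED(6)[OF that] show ?thesis by simp
    qed
    have "onb d (insert g E) (span (insert f F))"
      unfolding onb_def
    proof (intro conjI ballI)
      show "span (insert f F) \<subseteq> euclid d" using insert by (intro span_subset_euclid) auto
      fix v assume "v \<in> span (insert f F)"
      then obtain k where k: "v - k *\<^sub>R f \<in> span F" by (auto simp: span_breakdown_eq)
      define u where "u = v - k *\<^sub>R f + k *\<^sub>R q"
      have u: "u \<in> span F" unfolding u_def using k q by (intro span_add span_scale) auto
      have v: "v = u + (k * sqrt (sqnorm d r)) *\<^sub>R g"
        unfolding u_def using gr fr by (metis (no_types, lifting) add.assoc diff_add_cancel add.commute scaleR_add_right scaleR_scaleR)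
      have "(\<Sum>e\<in>insert g E. dot d v e *\<^sub>R e) = dot d v g *\<^sub>R g + (\<Sum>e\<in>E. dot d v e *\<^sub>R e)"
        using \<open>g \<notin> E\<close> ED(1) by simp
      also have "dot d v g = k * sqrt (sqnorm d r)" unfolding v using gg ug[OF u] by simp
      also have "(\<Sum>e\<in>E. dot d v e *\<^sub>R e) = (\<Sum>e\<in>E. dot d u e *\<^sub>R e)"
        unfolding v using eg by (intro sum.cong) auto
      also have "\<dots> = u" by (rule ED(6)[OF u])
      finally show "v = (\<Sum>e\<in>insert g E. dot d v e *\<^sub>R e)" using v by (simp add: add.commute)
    qed (use ED gs gg eg sub in auto)
    moreover have "card (insert g E) \<le> card (insert f F)"
      using insert E(2) ED(1) \<open>g \<notin> E\<close> by simp
    ultimately show ?thesis by blast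
  qed
qed

text \<open>Since \<open>proj\<close> chooses some minimiser, uniqueness is needed as well as
  minimality. Both come from Pythagoras, as the difference of \<open>x\<close> and the sum is
  orthogonal to \<open>M\<close>.\<close>

lemma proj_onb:
  assumes "onb d E M"
  shows "proj d M x = (\<Sum>e\<in>E. dot d x e *\<^sub>R e)" (is "_ = ?p")
proof -
  note ED = onbD[OF assms]
  have pM: "?p \<in> M" using ED by (auto intro!: subspace_sum subspace_scale)
  have orth: "dot d (x - ?p) z = 0" if "z \<in> M" for z
  proof -
    have "dot d (x - ?p) z = dot d (x - ?p) (\<Sum>e\<in>E. dot d z e *\<^sub>R e)" using ED(6)[OF that] by simp
    also have "\<dots> = (\<Sum>e\<in>E. dot d z e * dot d (x - ?p) e)" by (simp only: dot_sum_right dot_linear)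
    also have "\<dots> = 0"
    proof (rule sum.neutral, rule ballI)
      fix e assume "e \<in> E"
      then show "dot d z e * dot d (x - ?p) e = 0"
        using dot_onb_sum[OF ED(1,5) \<open>e \<in> E\<close>, of "\<lambda>e. dot d x e"] by simp
    qed
    finally show ?thesis .
  qed
  have dec: "sqnorm d (x - z) = sqnorm d (x - ?p) + sqnorm d (?p - z)" if "z \<in> M" for z
  proof -
    have "?p - z \<in> M" using pM that ED(2) by (simp add: subspace_diff)
    then have "dot d (x - ?p) (?p - z) = 0" by (rule orth)
    moreover have "sqnorm d (x - z) = sqnorm d ((x - ?p) + (?p - z))" by simp
    ultimately show ?thesis by (simp only: sqnorm_add mult_zero_right add_0_right)
  qed
  have min: "is_arg_min (\<lambda>z. sqnorm d (x - z)) (\<lambda>z. z \<in> M) ?p"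
    unfolding is_arg_min_def not_less not_ex de_Morgan_conj
  proof (intro conjI allI pM)
    fix z show "z \<notin> M \<or> sqnorm d (x - ?p) \<le> sqnorm d (x - z)"
    proof (cases "z \<in> M")
      case True then show ?thesis using dec[OF True] sqnorm_nonneg[of d "?p - z"] by linarith
    qed simp
  qed
  show ?thesis
    unfolding proj_def arg_min_on_def arg_min_def
  proof (rule some_equality[where P="is_arg_min (\<lambda>z. sqnorm d (x - z)) (\<lambda>z. z \<in> M)", OF min])
    fix z assume z: "is_arg_min (\<lambda>z. sqnorm d (x - z)) (\<lambda>z. z \<in> M) z"
    then have zM: "z \<in> M" unfolding is_arg_min_def by blast
    have "\<not> sqnorm d (x - ?p) < sqnorm d (x - z)" using z pM unfolding is_arg_min_def by blast
    with dec[OF zM] have "sqnorm d (?p - z) = 0" using sqnorm_nonneg[of d "?p - z"] by linarith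
    moreover have "?p - z \<in> euclid d" using pM zM ED(2,3) by (auto simp: subspace_diff)
    ultimately show "z = ?p" by (simp add: sqnorm_eq_0_iff)
  qed
qed

lemma proj_mem: "onb d E M \<Longrightarrow> proj d M x \<in> M"
  by (auto simp: proj_onb dest: onbD intro!: subspace_sum subspace_scale)

lemma dot_proj_left:
  assumes "onb d E M" "v \<in> M"
  shows "dot d (proj d M x) v = dot d x v"
proof -
  have "dot d (proj d M x) v = (\<Sum>e\<in>E. dot d v e * dot d x e)"
    unfolding proj_onb[OF assms(1)] dot_sum_left dot_linear
    by (rule sum.cong[OF refl]) (simp only: dot_commute[of d v] mult.commute)
  also have "\<dots> = dot d x (\<Sum>e\<in>E. dot d v e *\<^sub>R e)" by (simp add: dot_sum_right)
  also have "\<dots> = dot d x v" using onbD(6)[OF assms] by simp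
  finally show ?thesis .
qed

lemma proj_commute:
  assumes "onb d E M"
  shows "dot d (proj d M x) y = dot d x (proj d M y)"
  using dot_proj_left[OF assms proj_mem[OF assms, of y], of x]
    dot_proj_left[OF assms proj_mem[OF assms, of x], of y] by (simp add: dot_commute)

lemma sqnorm_onb:
  assumes "onb d E M" "v \<in> M"
  shows "sqnorm d v = (\<Sum>e\<in>E. (dot d v e)\<^sup>2)"
proof -
  have "sqnorm d v = dot d v (\<Sum>e\<in>E. dot d v e *\<^sub>R e)"
    using onbD(6)[OF assms] by (simp only: sqnorm_def)
  also have "\<dots> = (\<Sum>e\<in>E. (dot d v e)\<^sup>2)"
    by (simp only: dot_sum_right dot_linear power2_eq_square)
  finally show ?thesis .
qed

section \<open>Growth of the Gram determinant on a subspace\<close>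

lemma gram_inv_orthogonal:
  assumes "\<And>z. z \<in> set zs \<Longrightarrow> dot d z v = 0"
  shows "gram_inv d l zs v = (1 / l) *\<^sub>R v"
  using assms by (induction zs) auto

text \<open>This is the determinant of 1 + a P with P the projection to the span of
  \<open>es\<close>: by orthogonality the earlier updates leave the next basis vector fixed.\<close>

lemma gram_det_orthonormal:
  assumes "distinct es" "0 \<le> a" "\<And>x y. x \<in> set es \<Longrightarrow> y \<in> set es \<Longrightarrow> dot d x y = (if x = y then 1 else 0)"
  shows "gram_det d 1 (map ((*\<^sub>R) (sqrt a)) es) = (1 + a) ^ length es"
  using assms
proof (induction es)
  case (Cons e es)
  have "gram_inv d 1 (map ((*\<^sub>R) (sqrt a)) es) e = e"
    using Cons.prems by (subst gram_inv_orthogonal) auto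
  moreover have "dot d e e = 1" using Cons.prems by simp
  moreover have "gram_det d 1 (map ((*\<^sub>R) (sqrt a)) es) = (1 + a) ^ length es"
    using Cons by simp
  ultimately show ?case using Cons.prems(2) by (simp add: mult.assoc[symmetric])
qed simp

text \<open>Write V for the Gram matrix of \<open>bs\<close> and P for the projection to
  \<open>M\<close>. As \<open>bs\<close> lies in \<open>M\<close>, V P is \<open>l\<close> P plus
  the outer products of \<open>bs\<close>; the added vectors contribute exactly a V P, and V + a V P
  = V (1 + a P).\<close>

lemma gram_mat_scale:
  assumes "onb d (set es) M" "distinct es" "0 < l" "0 \<le> a" "set bs \<subseteq> M"
  shows "gram_mat d l (map ((*\<^sub>R) (sqrt a)) bs @ map ((*\<^sub>R) (sqrt (a * l))) es @ bs)
    = gram_mat d l bs * gram_mat d 1 (map ((*\<^sub>R) (sqrt a)) es)" (is "?L = ?G * ?E")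
proof (rule eq_matI)
  note ED = onbD[OF assms(1)]
  fix i j assume "i < dim_row (?G * ?E)" "j < dim_col (?G * ?E)"
  then have ij: "i < d" "j < d" by (auto simp: gram_mat_def)
  have dist: "(\<Sum>e\<leftarrow>es. f e) = (\<Sum>e\<in>set es. f e)" for f :: "vector \<Rightarrow> real"
    using assms(2) by (simp add: sum_list_distinct_conv_sum_set)
  have expand: "(\<Sum>e\<in>set es. dot d b e * e (Suc j)) = b (Suc j)" if "b \<in> set bs" for b
    using fun_cong[OF ED(6)[of b], of "Suc j"] that assms(5) by (auto simp: sum_fun_apply vector_apply)
  have sq: "sqrt c * x * (sqrt c * y) = c * (x * y)" if "0 \<le> c" for c x y :: real
  proof -
    have "sqrt c * x * (sqrt c * y) = (sqrt c * sqrt c) * (x * y)" by (simp only: mult_ac)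
    with that show ?thesis by simp
  qed
  have E: "?E $$ (k, j) = (if k = j then 1 else 0) + (\<Sum>e\<in>set es. a * (e (Suc k) * e (Suc j)))" if "k < d" for k
    using that ij assms(4) by (simp add: gram_mat_def vector_apply o_def dist sq)
  have "(?G * ?E) $$ (i, j) = (\<Sum>k<d. ?G $$ (i, k) * ?E $$ (k, j))"
    using ij by (simp add: scalar_prod_def gram_mat_def atLeast0LessThan)
  also have "\<dots> = (\<Sum>k<d. ?G $$ (i, k) * (if k = j then 1 else 0))
      + (\<Sum>k<d. \<Sum>e\<in>set es. a * (?G $$ (i, k) * e (Suc k)) * e (Suc j))"
    unfolding sum.distrib[symmetric]
    by (intro sum.cong refl) (simp add: E distrib_left sum_distrib_left mult_ac)
  also have "(\<Sum>k<d. ?G $$ (i, k) * (if k = j then 1 else 0)) = ?G $$ (i, j)"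
    using ij by (simp add: if_distrib cong: if_cong)
  also have "(\<Sum>k<d. \<Sum>e\<in>set es. a * (?G $$ (i, k) * e (Suc k)) * e (Suc j))
      = (\<Sum>e\<in>set es. a * gram_op d l bs e (Suc i) * e (Suc j))"
    using ij by (subst sum.swap) (simp add: gram_op_apply sum_distrib_left sum_distrib_right mult.assoc)
  also have "\<dots> = (\<Sum>e\<in>set es. a * (l * e (Suc i)) * e (Suc j))
      + (\<Sum>e\<in>set es. \<Sum>b\<leftarrow>bs. a * b (Suc i) * (dot d b e * e (Suc j)))"
  proof -
    have "gram_op d l bs e (Suc i) = l * e (Suc i) + (\<Sum>b\<leftarrow>bs. dot d b e * b (Suc i))" for e
      by (induction bs) (auto simp: vector_apply)
    then show ?thesis
      unfolding sum.distrib[symmetric]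
      by (intro sum.cong refl) (simp add: algebra_simps sum_list_const_mult[symmetric])
  qed
  also have "(\<Sum>e\<in>set es. \<Sum>b\<leftarrow>bs. a * b (Suc i) * (dot d b e * e (Suc j)))
      = (\<Sum>b\<leftarrow>bs. \<Sum>e\<in>set es. a * b (Suc i) * (dot d b e * e (Suc j)))"
    by (induction bs) (auto simp: sum.distrib)
  also have "\<dots> = (\<Sum>b\<leftarrow>bs. a * b (Suc i) * b (Suc j))"
    using expand by (intro arg_cong[where f=sum_list] map_cong refl) (simp add: sum_distrib_left[symmetric])
  finally show "?L $$ (i, j) = (?G * ?E) $$ (i, j)"
    using ij assms(3,4)
    by (simp add: gram_mat_def vector_apply o_def dist sq del: real_sqrt_mult) (simp add: mult_ac)
qed (auto simp: gram_mat_def)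

text \<open>Adding \<open>a\<close> times the Gram form restricted to \<open>M\<close> costs a factor \<open>(1 + a) ^ card E\<close>
  in the determinant, but divides the norms of all further vectors by \<open>1 + a\<close>.\<close>

lemma gram_det_append_le:
  assumes "onb d E M" "0 < l" "0 \<le> a" "set bs \<subseteq> M" "set ys \<subseteq> M"
  shows "gram_det d l (ys @ bs) \<le>
    gram_det d l bs * (1 + a) ^ card E * exp (\<Sum>y\<leftarrow>ys. dot d y (gram_inv d l bs y) / (1 + a))"
proof -
  note ED = onbD[OF assms(1)]
  obtain es where es: "set es = E" "distinct es" using finite_distinct_list[OF ED(1)] by auto
  have len: "length es = card E" using es distinct_card by metis
  define cs where "cs = map ((*\<^sub>R) (sqrt a)) bs @ map ((*\<^sub>R) (sqrt (a * l))) es"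
  have "l ^ d * gram_det d l (cs @ bs) = l ^ d * gram_det d l bs * gram_det d 1 (map ((*\<^sub>R) (sqrt a)) es)"
    using gram_mat_scale[of d es M l a bs] assms es det_gram_mat[OF assms(2), of d "cs @ bs"]
      det_gram_mat[OF assms(2), of d bs] det_gram_mat[of 1 d "map ((*\<^sub>R) (sqrt a)) es"]
    by (simp add: cs_def det_mult[of _ d])
  then have det: "gram_det d l (cs @ bs) = gram_det d l bs * (1 + a) ^ card E"
    using gram_det_orthonormal[OF es(2) assms(3), of d] ED es len assms(2) by simp
  \<comment> \<open>On \<open>M\<close> the enlarged Gram operator is \<open>1 + a\<close> times the
    old one, and its inverse is scaled accordingly.\<close>
  have inv: "dot d y (gram_inv d l (cs @ bs) y) = dot d y (gram_inv d l bs y) / (1 + a)" if "y \<in> M" for y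
  proof -
    define u where "u = gram_inv d l bs y"
    have uM: "u \<in> M" unfolding u_def using gram_inv_closed[OF ED(2) assms(4) that] .
    have "(\<Sum>c\<leftarrow>map ((*\<^sub>R) (sqrt (a * l))) es. dot d c u *\<^sub>R c) = (a * l) *\<^sub>R (\<Sum>e\<leftarrow>es. dot d u e *\<^sub>R e)"
      using assms(2,3) by (induction es) (auto simp: dot_commute algebra_simps real_sqrt_mult[symmetric])
    also have "(\<Sum>e\<leftarrow>es. dot d u e *\<^sub>R e) = u"
      using ED(6)[OF uM] es by (simp add: sum_list_distinct_conv_sum_set)
    finally have 1: "(\<Sum>c\<leftarrow>map ((*\<^sub>R) (sqrt (a * l))) es. dot d c u *\<^sub>R c) = (a * l) *\<^sub>R u" .
    have 2: "l *\<^sub>R u + (\<Sum>c\<leftarrow>bs. dot d c u *\<^sub>R c) = gram_op d l bs u"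
      using gram_op_append[of d l bs "[]" u] by simp
    have 3: "(\<Sum>c\<leftarrow>map ((*\<^sub>R) (sqrt a)) bs. dot d c u *\<^sub>R c) = a *\<^sub>R (\<Sum>c\<leftarrow>bs. dot d c u *\<^sub>R c)"
      using assms(3) by (induction bs) (auto simp: algebra_simps)
    have "gram_op d l (cs @ bs) u = gram_op d l bs u + (a *\<^sub>R (\<Sum>c\<leftarrow>bs. dot d c u *\<^sub>R c) + (a * l) *\<^sub>R u)"
      unfolding gram_op_append cs_def map_append sum_list_append 1 3 ..
    also have "\<dots> = (1 + a) *\<^sub>R gram_op d l bs u"
      unfolding 2[symmetric] by (simp add: algebra_simps)
    also have "\<dots> = (1 + a) *\<^sub>R y" unfolding u_def using assms(2) by simp
    finally have "gram_inv d l (cs @ bs) ((1 + a) *\<^sub>R y) = u"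
      using gram_inv_gram_op[OF assms(2)] by metis
    then have "(1 + a) * dot d y (gram_inv d l (cs @ bs) y) = dot d y u"
      by (metis dot_linear(8) gram_inv_linear(3))
    then show ?thesis using assms(3) by (simp add: u_def field_simps)
  qed
  \<comment> \<open>Adding \<open>cs\<close> only increases the determinant, and reordering puts
    \<open>ys\<close> on top of \<open>cs @ bs\<close>, where each of its vectors has small
    norm.\<close>
  have "gram_det d l (ys @ bs) \<le> gram_det d l (cs @ ys @ bs)"
    by (rule gram_det_append_ge[OF assms(2)])
  also have "\<dots> = gram_det d l (ys @ cs @ bs)"
    by (rule gram_det_cong[OF assms(2)]) simp
  also have "\<dots> \<le> gram_det d l (cs @ bs) * exp (\<Sum>y\<leftarrow>ys. dot d y (gram_inv d l bs y) / (1 + a))"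
    using assms(5)
  proof (induction ys)
    case (Cons y ys)
    let ?s = "\<Sum>y\<leftarrow>ys. dot d y (gram_inv d l bs y) / (1 + a)"
    have "dot d y (gram_inv d l (ys @ cs @ bs) y) \<le> dot d y (gram_inv d l bs y) / (1 + a)"
      using dot_gram_inv_append_le[OF assms(2), of d y ys "cs @ bs"] inv[of y] Cons.prems by simp
    then have "1 + dot d y (gram_inv d l (ys @ cs @ bs) y) \<le> exp (dot d y (gram_inv d l bs y) / (1 + a))"
      using exp_ge_add_one_self[of "dot d y (gram_inv d l bs y) / (1 + a)"] by linarith
    then have "gram_det d l (ys @ cs @ bs) * (1 + dot d y (gram_inv d l (ys @ cs @ bs) y))
      \<le> (gram_det d l (cs @ bs) * exp ?s) * exp (dot d y (gram_inv d l bs y) / (1 + a))"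
      using Cons gram_det_ge_1[OF assms(2), of d "cs @ bs"] assms(2)
      by (intro mult_mono) (auto intro!: add_nonneg_nonneg)
    then show ?case by (simp add: exp_add mult_ac)
  qed simp
  finally show ?thesis by (simp add: det)
qed

text \<open>The preceding bound with empty base and \<open>a = n * K / l\<close>: each vector has
  squared inverse norm at most \<open>K / l\<close>, so after division by \<open>1 + a\<close> these
  sum to at most 1. The remaining cost is \<open>(1 + a) ^ card E\<close>.\<close>

lemma ln_gram_det_le:
  assumes "onb d E M" "0 < l" "0 < K" "set ys \<subseteq> M" "\<And>y. y \<in> set ys \<Longrightarrow> sqnorm d y \<le> K"
    and "length ys \<le> n"
  shows "ln (gram_det d l ys) \<le> card E * ln (1 + n * K / l) + 1"
proof -
  define a where "a = n * K / l"
  have a: "0 \<le> a" unfolding a_def using assms by simp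
  have "(\<Sum>y\<leftarrow>ys. dot d y (gram_inv d l [] y) / (1 + a)) \<le> (\<Sum>y\<leftarrow>ys. K / l / (1 + a))"
    using assms a by (intro sum_list_mono) (auto intro!: divide_right_mono simp: sqnorm_def[symmetric])
  also have "\<dots> = length ys * (K / l / (1 + a))" by (simp add: sum_list_triv)
  also have "\<dots> \<le> n * (K / l / (1 + a))"
    using assms a by (intro mult_right_mono) auto
  also have "\<dots> = a / (1 + a)" by (simp add: a_def)
  also have "\<dots> \<le> 1" using a by (simp add: field_simps)
  finally have s: "(\<Sum>y\<leftarrow>ys. dot d y (gram_inv d l [] y) / (1 + a)) \<le> 1" .
  have "gram_det d l ys \<le> (1 + a) ^ card E * exp (\<Sum>y\<leftarrow>ys. dot d y (gram_inv d l [] y) / (1 + a))"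
    using gram_det_append_le[OF assms(1,2) a, of "[]" ys] assms(4) by simp
  also have "\<dots> \<le> (1 + a) ^ card E * exp 1"
    using s a by (intro mult_left_mono) auto
  finally have "ln (gram_det d l ys) \<le> ln ((1 + a) ^ card E * exp 1)"
    using gram_det_ge_1[OF assms(2), of d ys] by (subst ln_le_cancel_iff) (use a in auto)
  also have "\<dots> = card E * ln (1 + a) + 1"
    using a by (subst ln_mult) (auto simp: ln_realpow)
  finally show ?thesis by (simp add: a_def)
qed

section \<open>The norms of the Gram operator and of its inverse\<close>

definition vnorm :: "nat \<Rightarrow> real \<Rightarrow> vector list \<Rightarrow> vector \<Rightarrow> real" where
  "vnorm d l zs u = sqrt (dot d u (gram_op d l zs u))"

definition inorm :: "nat \<Rightarrow> real \<Rightarrow> vector list \<Rightarrow> vector \<Rightarrow> real" where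
  "inorm d l zs u = sqrt (dot d u (gram_inv d l zs u))"

lemma vnorm_nonneg [simp]: "0 < l \<Longrightarrow> 0 \<le> vnorm d l zs u"
  by (simp add: vnorm_def dot_gram_op_nonneg)

lemma inorm_nonneg [simp]: "0 < l \<Longrightarrow> 0 \<le> inorm d l zs u"
  by (simp add: inorm_def)

lemma inorm_squared: "0 < l \<Longrightarrow> (inorm d l zs u)\<^sup>2 = dot d u (gram_inv d l zs u)"
  by (simp add: inorm_def)

lemma vnorm_squared: "0 < l \<Longrightarrow> (vnorm d l zs u)\<^sup>2 = dot d u (gram_op d l zs u)"
  by (simp add: vnorm_def dot_gram_op_nonneg)

lemma dot_le_inorm_vnorm:
  assumes "0 < l"
  shows "dot d u v \<le> inorm d l zs u * vnorm d l zs v"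
proof -
  have "(dot d u v)\<^sup>2 \<le> (inorm d l zs u * vnorm d l zs v)\<^sup>2"
    using dot_squared_le_gram[OF assms, of d u v zs] assms
    by (simp only: power_mult_distrib inorm_squared vnorm_squared)
  then show ?thesis
    by (rule power2_le_imp_le) (simp add: assms)
qed

lemma vnorm_scaleR: "vnorm d l zs (r *\<^sub>R u) = \<bar>r\<bar> * vnorm d l zs u"
proof -
  have "vnorm d l zs (r *\<^sub>R u) = sqrt (r\<^sup>2 * dot d u (gram_op d l zs u))"
    by (simp add: vnorm_def power2_eq_square mult.assoc)
  then show ?thesis by (simp add: real_sqrt_mult vnorm_def)
qed

lemma vnorm_gram_inv: "0 < l \<Longrightarrow> vnorm d l zs (gram_inv d l zs u) = inorm d l zs u"
  by (simp add: vnorm_def inorm_def dot_commute)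

lemma inorm_gram_op: "0 < l \<Longrightarrow> inorm d l zs (gram_op d l zs u) = vnorm d l zs u"
  by (simp add: vnorm_def inorm_def dot_commute)

lemma vnorm_add_le:
  assumes "0 < l"
  shows "vnorm d l zs (u + v) \<le> vnorm d l zs u + vnorm d l zs v"
proof -
  have "dot d v (gram_op d l zs u) \<le> vnorm d l zs u * vnorm d l zs v"
    using dot_le_inorm_vnorm[OF assms, of d "gram_op d l zs u" v zs]
    unfolding inorm_gram_op[OF assms] dot_commute[of d v] .
  moreover have "dot d u (gram_op d l zs v) = dot d v (gram_op d l zs u)"
    by (simp only: dot_gram_op_commute[of d u l zs v] dot_commute)
  ultimately have "(vnorm d l zs (u + v))\<^sup>2 \<le> (vnorm d l zs u + vnorm d l zs v)\<^sup>2"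
    unfolding power2_sum vnorm_squared[OF assms] gram_op_linear dot_linear by linarith
  then show ?thesis
    by (rule power2_le_imp_le) (simp add: assms)
qed

lemma vnorm_minus_commute: "vnorm d l zs (u - v) = vnorm d l zs (v - u)"
  using vnorm_scaleR[of d l zs "- 1" "u - v"] by simp

lemma vnorm_diff_triangle:
  assumes "0 < l"
  shows "vnorm d l zs (u - w) \<le> vnorm d l zs (u - v) + vnorm d l zs (v - w)"
  using vnorm_add_le[OF assms, of d zs "u - v" "v - w"] by simp

text \<open>Inversion reverses the order of positive forms: apply Cauchy--Schwarz for the smaller
  form to \<open>v\<close> and its image under the inverse of the larger one.\<close>

lemma dot_gram_inv_mono:
  assumes "0 < l" "\<And>v. dot d v (gram_op d l ys v) \<le> dot d v (gram_op d l zs v)"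
  shows "dot d v (gram_inv d l zs v) \<le> dot d v (gram_inv d l ys v)"
proof -
  define u where "u = gram_inv d l zs v"
  have 0: "0 \<le> dot d v u" "0 \<le> dot d v (gram_inv d l ys v)" using assms by (auto simp: u_def)
  have "(dot d v u)\<^sup>2 \<le> dot d v (gram_inv d l ys v) * dot d u (gram_op d l ys u)"
    by (rule dot_squared_le_gram[OF assms(1)])
  also have "\<dots> \<le> dot d v (gram_inv d l ys v) * dot d u (gram_op d l zs u)"
    using 0 assms by (intro mult_left_mono) auto
  also have "dot d u (gram_op d l zs u) = dot d v u"
    using assms(1) by (simp add: u_def dot_commute)
  finally show ?thesis
    using 0 unfolding u_def[symmetric] power2_eq_square
    by (cases "dot d v u = 0") (auto simp: mult_le_cancel_right)
qed

section \<open>Ridge regression and confidence sets\<close>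

text \<open>Reversed, since histories grow at the end and the lists of the Gram recursion at the
  head.\<close>

definition arm_projs :: "nat \<Rightarrow> vector set \<Rightarrow> history \<Rightarrow> vector list" where
  "arm_projs d m h = rev (map (\<lambda>p. proj d m (fst p)) h)"

definition noise_sum :: "nat \<Rightarrow> vector set \<Rightarrow> vector \<Rightarrow> history \<Rightarrow> vector" where
  "noise_sum d m \<theta> h = (\<Sum>p\<leftarrow>h. (snd p - dot d (fst p) \<theta>) *\<^sub>R proj d m (fst p))"

lemma gram_eq: "gram d l m h = gram_mat d l (arm_projs d m h)"
  unfolding gram_def gram_mat_def arm_projs_def
  by (simp add: rev_map[symmetric] sum_list_rev case_prod_unfold o_def)

lemma matrix_norm_gram_mat: "matrix_norm d (gram_mat d l zs) u = vnorm d l zs u"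
  unfolding matrix_norm_def vnorm_def dot_eq_sum_lessThan
  by (simp add: gram_op_apply sum_distrib_left mult.assoc)

lemma confidence_radius_gram_mat:
  assumes "0 < l"
  shows "confidence_radius d \<sigma> l S \<delta> (gram_mat d l zs) =
    \<sigma> * sqrt (2 * ln (sqrt (gram_det d l zs) / \<delta>)) + sqrt l * S"
  using assms by (simp add: confidence_radius_def det_gram_mat real_sqrt_mult)

text \<open>Completing the square: up to a constant the objective is the Gram form at
  \<open>t - c\<close>. As \<open>l\<close> is positive the minimiser is unique, so the choice in
  \<open>ridge\<close> is determined.\<close>

lemma ridge_eq:
  assumes "onb d E m" "0 < l"
  shows "ridge d l m h = gram_inv d l (arm_projs d m h) (\<Sum>p\<leftarrow>h. snd p *\<^sub>R proj d m (fst p))"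
proof -
  note ED = onbD[OF assms(1)]
  let ?zs = "arm_projs d m h" and ?b = "\<Sum>p\<leftarrow>h. snd p *\<^sub>R proj d m (fst p)"
  define c where "c = gram_inv d l ?zs ?b"
  let ?f = "\<lambda>t. (\<Sum>(x, y)\<leftarrow>h. (y - dot d x t)\<^sup>2) + l * sqnorm d t"
  have bm: "?b \<in> m"
    by (induction h) (auto intro!: subspace_add[OF ED(2)] subspace_scale[OF ED(2)] subspace_0[OF ED(2)] proj_mem[OF assms(1)])
  have cm: "c \<in> m"
    unfolding c_def by (rule gram_inv_closed[OF ED(2) _ bm]) (auto simp: arm_projs_def intro: proj_mem[OF assms(1)])
  have f: "?f t = (\<Sum>p\<leftarrow>h. (snd p)\<^sup>2) - dot d ?b c + dot d (t - c) (gram_op d l ?zs (t - c))" if "t \<in> m" for t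
  proof -
    have 1: "(\<Sum>(x, y)\<leftarrow>h. (y - dot d x t)\<^sup>2)
      = (\<Sum>p\<leftarrow>h. (snd p)\<^sup>2) - 2 * dot d t ?b + (\<Sum>p\<leftarrow>h. (dot d (proj d m (fst p)) t)\<^sup>2)"
      using dot_proj_left[OF assms(1) that]
      by (induction h) (auto simp: power2_diff dot_commute[of d t] algebra_simps)
    have 2: "(\<Sum>p\<leftarrow>h. (dot d (proj d m (fst p)) t)\<^sup>2) + l * sqnorm d t = dot d t (gram_op d l ?zs t)"
      by (simp add: dot_gram_op_self arm_projs_def rev_map[symmetric] sum_list_rev o_def)
    have Vc: "gram_op d l ?zs c = ?b" unfolding c_def using assms(2) by simp
    have "dot d c (gram_op d l ?zs t) = dot d t ?b"
      by (simp only: dot_gram_op_commute[of d c] Vc dot_commute)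
    then have "dot d (t - c) (gram_op d l ?zs (t - c)) = dot d t (gram_op d l ?zs t) - 2 * dot d t ?b + dot d c ?b"
      by (simp add: Vc)
    moreover have "dot d c ?b = dot d ?b c" by (rule dot_commute)
    ultimately show ?thesis using 1 2 by linarith
  qed
  have ge: "l * sqnorm d (t - c) \<le> dot d (t - c) (gram_op d l ?zs (t - c))" for t
    by (rule dot_gram_op_ge)
  have fc: "?f c = (\<Sum>p\<leftarrow>h. (snd p)\<^sup>2) - dot d ?b c" using f[OF cm] by simp
  have min: "is_arg_min ?f (\<lambda>t. t \<in> m) c"
    unfolding is_arg_min_def not_less not_ex de_Morgan_conj
  proof (intro conjI allI cm)
    fix t show "t \<notin> m \<or> ?f c \<le> ?f t"
    proof (cases "t \<in> m")
      case True
      have "0 \<le> l * sqnorm d (t - c)" using assms(2) by simp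
      then show ?thesis using f[OF True] fc ge[of t] by linarith
    qed simp
  qed
  show ?thesis
    unfolding ridge_def arg_min_on_def arg_min_def c_def[symmetric]
  proof (rule some_equality[where P="is_arg_min ?f (\<lambda>t. t \<in> m)", OF min])
    fix t assume t: "is_arg_min ?f (\<lambda>t. t \<in> m) t"
    then have tm: "t \<in> m" unfolding is_arg_min_def by blast
    have "\<not> ?f c < ?f t" using t cm unfolding is_arg_min_def by blast
    then have "l * sqnorm d (t - c) \<le> 0" using f[OF tm] fc ge[of t] by linarith
    then have "sqnorm d (t - c) = 0" using assms(2) sqnorm_nonneg[of d "t - c"]
      by (simp add: mult_le_0_iff)
    moreover have "t - c \<in> euclid d" using cm tm ED(3) by (intro euclid_closed(3)) auto
    ultimately show "t = c" by (simp add: sqnorm_eq_0_iff)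
  qed
qed

text \<open>The reward-weighted sum of arms is the noise sum plus (V - l) \<open>\<theta>\<close>,
  with V the Gram operator. Applying the inverse of V leaves a bias proportional to \<open>l\<close>
  and a noise term, bounded separately.\<close>

lemma ridge_error:
  assumes "onb d E m" "0 < l" "\<theta> \<in> m"
  shows "vnorm d l (arm_projs d m h) (\<theta> - ridge d l m h)
    \<le> sqrt l * sqrt (sqnorm d \<theta>) + inorm d l (arm_projs d m h) (noise_sum d m \<theta> h)"
proof -
  let ?zs = "arm_projs d m h" and ?n = "noise_sum d m \<theta> h"
  have "(\<Sum>p\<leftarrow>h. snd p *\<^sub>R proj d m (fst p))
    = ?n + (\<Sum>p\<leftarrow>h. dot d (proj d m (fst p)) \<theta> *\<^sub>R proj d m (fst p))"
    unfolding noise_sum_def using dot_proj_left[OF assms(1,3)]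
    by (induction h) (auto simp: algebra_simps)
  moreover have "gram_op d l ?zs \<theta> = l *\<^sub>R \<theta> + (\<Sum>p\<leftarrow>h. dot d (proj d m (fst p)) \<theta> *\<^sub>R proj d m (fst p))"
    using gram_op_append[of d l ?zs "[]" \<theta>]
    by (simp add: arm_projs_def rev_map[symmetric] sum_list_rev o_def)
  ultimately have "(\<Sum>p\<leftarrow>h. snd p *\<^sub>R proj d m (fst p)) = ?n + (gram_op d l ?zs \<theta> - l *\<^sub>R \<theta>)"
    by simp
  then have "ridge d l m h = gram_inv d l ?zs ?n + (\<theta> - l *\<^sub>R gram_inv d l ?zs \<theta>)"
    using assms(2) by (simp add: ridge_eq[OF assms(1,2)])
  then have "\<theta> - ridge d l m h = l *\<^sub>R gram_inv d l ?zs \<theta> + (- 1) *\<^sub>R gram_inv d l ?zs ?n"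
    by simp
  then have "vnorm d l ?zs (\<theta> - ridge d l m h) \<le> l * inorm d l ?zs \<theta> + inorm d l ?zs ?n"
    using vnorm_add_le[OF assms(2), of d ?zs "l *\<^sub>R gram_inv d l ?zs \<theta>" "(- 1) *\<^sub>R gram_inv d l ?zs ?n"] assms(2)
    by (simp only: vnorm_scaleR vnorm_gram_inv)
  moreover have "l * inorm d l ?zs \<theta> \<le> l * sqrt (sqnorm d \<theta> / l)"
    using assms(2) dot_gram_inv_le[OF assms(2), of d \<theta> ?zs] by (simp add: inorm_def)
  moreover have "l * sqrt (sqnorm d \<theta> / l) = sqrt l * sqrt (sqnorm d \<theta>)"
    using assms(2) by (simp add: real_sqrt_divide real_div_sqrt field_simps)
  ultimately show ?thesis by linarith
qed

text \<open>If the confidence radius is twice the actual estimation error, then optimism leaves room for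
  the exploration bonus of every other arm.\<close>

lemma oful_arm_optimistic:
  assumes "onb d E m" "0 < l" "\<theta> \<in> m"
    and "oful_arm d X \<sigma> l S \<delta> m h x"
    and \<beta>: "\<beta> = confidence_radius d \<sigma> l S \<delta> (gram d l m h)"
    and "0 \<le> \<beta>" "vnorm d l (arm_projs d m h) (\<theta> - ridge d l m h) \<le> \<beta> / 2"
  shows "x \<in> X"
    and "\<And>x'. x' \<in> X \<Longrightarrow> dot d x' \<theta> + \<beta> / 2 * inorm d l (arm_projs d m h) (proj d m x')
      \<le> dot d x \<theta> + 3 / 2 * \<beta> * inorm d l (arm_projs d m h) (proj d m x)"
proof -
  note ED = onbD[OF assms(1)]
  let ?zs = "arm_projs d m h"
  obtain \<phi> where \<phi>: "is_arg_max (\<lambda>(x', \<theta>'). dot d x' \<theta>')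
          (\<lambda>p. p \<in> X \<times> confidence_set d \<sigma> l S \<delta> m h) (x, \<phi>)"
    using assms(4) unfolding oful_arm_def by auto
  have C: "\<theta>' \<in> confidence_set d \<sigma> l S \<delta> m h \<longleftrightarrow> \<theta>' \<in> m \<and> vnorm d l ?zs (\<theta>' - ridge d l m h) \<le> \<beta>" for \<theta>'
    unfolding confidence_set_def \<beta> gram_eq matrix_norm_gram_mat by simp
  show "x \<in> X" using \<phi> by (simp add: is_arg_max_def)
  have \<phi>m: "\<phi> \<in> m" and \<phi>r: "vnorm d l ?zs (\<phi> - ridge d l m h) \<le> \<beta>"
    using \<phi> C by (auto simp: is_arg_max_def)
  have max: "dot d x' \<theta>' \<le> dot d x \<phi>" if "x' \<in> X" "\<theta>' \<in> m" "vnorm d l ?zs (\<theta>' - ridge d l m h) \<le> \<beta>" for x' \<theta>'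
    using \<phi> C[of \<theta>'] that by (force simp: is_arg_max_def not_less)
  fix x' assume x': "x' \<in> X"
  let ?z = "proj d m x'"
  let ?r = "inorm d l ?zs ?z"
  \<comment> \<open>The step of length \<open>\<beta> / 2\<close> from \<open>\<theta>\<close> that
    gains most against \<open>?z\<close>. If \<open>?r = 0\<close>, division by zero makes the step
    zero, and the claimed bonus vanishes too.\<close>
  define \<theta>' where "\<theta>' = \<theta> + (\<beta> / 2 / ?r) *\<^sub>R gram_inv d l ?zs ?z"
  have im: "gram_inv d l ?zs ?z \<in> m"
    by (rule gram_inv_closed[OF ED(2)]) (auto simp: arm_projs_def intro: proj_mem[OF assms(1)])
  have \<theta>'m: "\<theta>' \<in> m"
    unfolding \<theta>'_def using assms(3) im ED(2) by (intro subspace_add subspace_scale)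
  have "vnorm d l ?zs (\<theta>' - ridge d l m h) \<le> vnorm d l ?zs (\<theta>' - \<theta>) + vnorm d l ?zs (\<theta> - ridge d l m h)"
    by (rule vnorm_diff_triangle[OF assms(2)])
  also have "vnorm d l ?zs (\<theta>' - \<theta>) = \<bar>\<beta> / 2 / ?r\<bar> * ?r"
    unfolding \<theta>'_def using assms(2) by (simp add: vnorm_scaleR vnorm_gram_inv)
  also have "\<dots> \<le> \<beta> / 2"
    using assms(2,6) by (cases "?r = 0") auto
  finally have r': "vnorm d l ?zs (\<theta>' - ridge d l m h) \<le> \<beta>"
    using assms(7) by linarith
  have "dot d x' \<theta>' = dot d x' \<theta> + \<beta> / 2 / ?r * dot d ?z (gram_inv d l ?zs ?z)"
    unfolding \<theta>'_def using dot_proj_left[OF assms(1) im, of x'] by simp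
  also have "dot d ?z (gram_inv d l ?zs ?z) = ?r * ?r"
    using inorm_squared[OF assms(2), of d ?zs ?z] by (simp add: power2_eq_square)
  finally have "dot d x' \<theta> + \<beta> / 2 * ?r = dot d x' \<theta>'"
    by (cases "?r = 0") auto
  also have "\<dots> \<le> dot d x \<phi>"
    by (rule max[OF x' \<theta>'m r'])
  also have "\<dots> = dot d x \<theta> + dot d (proj d m x) (\<phi> - \<theta>)"
    using dot_proj_left[OF assms(1), of "\<phi> - \<theta>" x] \<phi>m assms(3) ED(2) by (simp add: subspace_diff)
  also have "dot d (proj d m x) (\<phi> - \<theta>) \<le> inorm d l ?zs (proj d m x) * vnorm d l ?zs (\<phi> - \<theta>)"
    by (rule dot_le_inorm_vnorm[OF assms(2)])
  also have "\<dots> \<le> inorm d l ?zs (proj d m x) * (3 / 2 * \<beta>)"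
  proof (intro mult_left_mono)
    \<comment> \<open>The optimistic parameter is within \<open>\<beta>\<close> of the ridge
      estimate and the true one within \<open>\<beta> / 2\<close>.\<close>
    show "vnorm d l ?zs (\<phi> - \<theta>) \<le> 3 / 2 * \<beta>"
      using vnorm_diff_triangle[OF assms(2), of d ?zs \<phi> \<theta> "ridge d l m h"] \<phi>r assms(7)
        vnorm_minus_commute[of d l ?zs \<theta> "ridge d l m h"] by linarith
  qed (use assms(2) in auto)
  finally show "dot d x' \<theta> + \<beta> / 2 * ?r \<le> dot d x \<theta> + 3 / 2 * \<beta> * inorm d l ?zs (proj d m x)"
    by (simp add: mult_ac)
qed

section \<open>The elliptical potential under optimism\<close>

definition prefix_vecs :: "(nat \<Rightarrow> vector) \<Rightarrow> nat \<Rightarrow> vector list" where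
  "prefix_vecs z n = rev (map z [0..<n])"

definition bonus :: "nat \<Rightarrow> real \<Rightarrow> (nat \<Rightarrow> vector) \<Rightarrow> nat \<Rightarrow> real" where
  "bonus d l z s = inorm d l (prefix_vecs z s) (z s)"

lemma prefix_vecs_Suc [simp]: "prefix_vecs z (Suc n) = z n # prefix_vecs z n"
  by (simp add: prefix_vecs_def)

lemma prefix_vecs_0 [simp]: "prefix_vecs z 0 = []"
  by (simp add: prefix_vecs_def)

lemma set_prefix_vecs: "set (prefix_vecs z n) = z ` {..<n}"
  by (auto simp: prefix_vecs_def)

lemma length_prefix_vecs [simp]: "length (prefix_vecs z n) = n"
  by (simp add: prefix_vecs_def)

lemma bonus_nonneg [simp]: "0 < l \<Longrightarrow> 0 \<le> bonus d l z s"
  by (simp add: bonus_def)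

lemma bonus_squared: "0 < l \<Longrightarrow> (bonus d l z s)\<^sup>2 = dot d (z s) (gram_inv d l (prefix_vecs z s) (z s))"
  by (simp add: bonus_def inorm_squared)

lemma ln_add_one_ge_half:
  assumes "0 \<le> x" "x \<le> (1 :: real)"
  shows "x / 2 \<le> ln (1 + x)"
proof -
  have "ln (1 / (1 + x)) \<le> 1 / (1 + x) - 1"
    using assms by (intro ln_le_minus_one) auto
  then have "1 - 1 / (1 + x) \<le> ln (1 + x)"
    using assms by (simp add: ln_div)
  moreover have "1 - 1 / (1 + x) = x / (1 + x)" using assms by (simp add: field_simps)
  moreover have "x / 2 \<le> x / (1 + x)" using assms by (intro divide_left_mono) auto
  ultimately show ?thesis by linarith
qed

text \<open>Each such round at least doubles the determinant; the factor 2 comes from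
  \<open>ln 2 \<ge> 1 / 2\<close>.\<close>

lemma card_large_bonus:
  assumes "0 < l"
  shows "card {s. s < n \<and> 1 \<le> bonus d l z s} \<le> 2 * ln (gram_det d l (prefix_vecs z n))"
proof -
  have "2 ^ card {s. s < n \<and> 1 \<le> bonus d l z s} \<le> gram_det d l (prefix_vecs z n)"
  proof (induction n)
    case (Suc n)
    let ?A = "{s. s < n \<and> 1 \<le> bonus d l z s}"
    have g: "gram_det d l (prefix_vecs z (Suc n)) = gram_det d l (prefix_vecs z n) * (1 + (bonus d l z n)\<^sup>2)"
      using assms by (simp add: bonus_squared)
    have f: "finite ?A" "n \<notin> ?A" by auto
    show ?case
    proof (cases "1 \<le> bonus d l z n")
      case True
      then have "{s. s < Suc n \<and> 1 \<le> bonus d l z s} = insert n ?A" by (auto simp: less_Suc_eq)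
      then have c: "card {s. s < Suc n \<and> 1 \<le> bonus d l z s} = Suc (card ?A)" using f by simp
      have "1 \<le> (bonus d l z n)\<^sup>2" using True by simp
      then have "2 ^ card ?A * 2 \<le> gram_det d l (prefix_vecs z n) * (1 + (bonus d l z n)\<^sup>2)"
        using Suc gram_det_ge_1[OF assms, of d "prefix_vecs z n"] by (intro mult_mono) auto
      then show ?thesis unfolding c g by (simp add: mult.commute)
    next
      case False
      then have "{s. s < Suc n \<and> 1 \<le> bonus d l z s} = ?A" by (auto simp: less_Suc_eq)
      moreover have "gram_det d l (prefix_vecs z n) * 1 \<le> gram_det d l (prefix_vecs z (Suc n))"
        unfolding g using gram_det_ge_1[OF assms, of d "prefix_vecs z n"] by (intro mult_left_mono) auto
      ultimately show ?thesis using Suc by simp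
    qed
  qed simp
  then have "ln (2 ^ card {s. s < n \<and> 1 \<le> bonus d l z s}) \<le> ln (gram_det d l (prefix_vecs z n))"
    using gram_det_ge_1[OF assms, of d "prefix_vecs z n"] by (subst ln_le_cancel_iff) auto
  then have "card {s. s < n \<and> 1 \<le> bonus d l z s} * ln 2 \<le> ln (gram_det d l (prefix_vecs z n))"
    by (simp add: ln_realpow)
  moreover have "1 / 2 \<le> ln (2 :: real)" using ln_add_one_ge_half[of 1] by simp
  then have "card {s. s < n \<and> 1 \<le> bonus d l z s} * (1 / 2) \<le> card {s. s < n \<and> 1 \<le> bonus d l z s} * ln (2 :: real)"
    by (intro mult_left_mono) auto
  ultimately show ?thesis by linarith
qed

text \<open>Holds for optimistically chosen arms, since the arm of round \<open>t\<close> was rejected at round \<open>s\<close>.\<close>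

definition comparable_bonuses :: "nat \<Rightarrow> real \<Rightarrow> (nat \<Rightarrow> vector) \<Rightarrow> nat \<Rightarrow> bool" where
  "comparable_bonuses d l z n \<longleftrightarrow> (\<forall>s t. s < t \<longrightarrow> t < n \<longrightarrow>
     inorm d l (prefix_vecs z s) (z t) \<le> 6 * (bonus d l z s + bonus d l z t))"

text \<open>By comparability all vectors of one dyadic level already have size \<open>O(\<epsilon>)\<close> at the first round
  of that level, so the determinant gains only a bounded factor per dimension during the level.\<close>

lemma card_bonus_level:
  fixes \<epsilon> :: real
  assumes "onb d E M" "0 < l" "\<And>s. s < n \<Longrightarrow> z s \<in> M" "comparable_bonuses d l z n"
    and A: "A \<subseteq> {..<n}" "\<And>s. s \<in> A \<Longrightarrow> \<epsilon> \<le> bonus d l z s \<and> bonus d l z s \<le> 2 * \<epsilon>"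
    and "0 < \<epsilon>" "\<epsilon> \<le> 1"
  shows "card A * \<epsilon>\<^sup>2 \<le> 48 * card E"
proof (cases "A = {}")
  case False
  have finA: "finite A" using A(1) finite_subset by blast
  define s0 where "s0 = Min A"
  have s0: "s0 \<in> A" "\<And>s. s \<in> A \<Longrightarrow> s0 \<le> s" using False finA by (auto simp: s0_def)
  \<comment> \<open>\<open>bs\<close> holds all rounds before the first round of the level,
    \<open>ys k\<close> only the rounds of the level from there up to \<open>k\<close>, both newest
    first.\<close>
  define bs where "bs = prefix_vecs z s0"
  define ys where "ys k = rev (map z (filter (\<lambda>s. s \<in> A) [s0..<k]))" for k
  have \<epsilon>2: "0 < \<epsilon>\<^sup>2" "\<epsilon>\<^sup>2 \<le> 1" using assms(7,8) by (auto simp: power_le_one)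
  \<comment> \<open>Omitting the rounds outside \<open>A\<close> makes the Gram form smaller and
    inverse norms larger, so every round of \<open>A\<close> still multiplies the determinant by at
    least \<open>1 + \<epsilon>\<^sup>2\<close>.\<close>
  have lower: "(1 + \<epsilon>\<^sup>2) ^ card (A \<inter> {s0..<k}) * gram_det d l bs \<le> gram_det d l (ys k @ bs)"
    if "s0 \<le> k" "k \<le> n" for k
    using that
  proof (induction k rule: dec_induct)
    case base
    then show ?case by (simp add: ys_def)
  next
    case (step k)
    show ?case
    proof (cases "k \<in> A")
      case True
      have ysk: "ys (Suc k) = z k # ys k" using step True by (simp add: ys_def)
      have "A \<inter> {s0..<Suc k} = insert k (A \<inter> {s0..<k})" using step True by auto
      then have c: "card (A \<inter> {s0..<Suc k}) = Suc (card (A \<inter> {s0..<k}))" by simp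
      have "dot d v (gram_op d l (ys k @ bs) v) \<le> dot d v (gram_op d l (prefix_vecs z k) v)" for v
      proof -
        have "(\<Sum>y\<leftarrow>ys k. (dot d y v)\<^sup>2) = (\<Sum>s\<leftarrow>filter (\<lambda>s. s \<in> A) [s0..<k]. (dot d (z s) v)\<^sup>2)"
          by (simp add: ys_def rev_map[symmetric] sum_list_rev o_def)
        also have "\<dots> \<le> (\<Sum>s\<leftarrow>[s0..<k]. (dot d (z s) v)\<^sup>2)"
          by (induction "[s0..<k]") (auto simp: sum_list_filter_le_nat sum_list_map_filter' intro!: sum_list_mono)
        finally have 1: "(\<Sum>y\<leftarrow>ys k. (dot d y v)\<^sup>2) \<le> (\<Sum>s\<leftarrow>[s0..<k]. (dot d (z s) v)\<^sup>2)" .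
        have "[0..<k] = [0..<s0] @ [s0..<k]" using step upt_add_eq_append[of 0 s0 "k - s0"] by simp
        then have "(\<Sum>y\<leftarrow>prefix_vecs z k. (dot d y v)\<^sup>2)
            = (\<Sum>y\<leftarrow>bs. (dot d y v)\<^sup>2) + (\<Sum>s\<leftarrow>[s0..<k]. (dot d (z s) v)\<^sup>2)"
          by (simp add: prefix_vecs_def bs_def rev_map[symmetric] sum_list_rev o_def)
        with 1 show ?thesis by (simp add: dot_gram_op_self)
      qed
      then have "(bonus d l z k)\<^sup>2 \<le> dot d (z k) (gram_inv d l (ys k @ bs) (z k))"
        unfolding bonus_squared[OF assms(2)] by (rule dot_gram_inv_mono[OF assms(2)])
      moreover have "\<epsilon>\<^sup>2 \<le> (bonus d l z k)\<^sup>2" using A(2)[OF True] assms(7) by (intro power_mono) auto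
      ultimately have "(1 + \<epsilon>\<^sup>2) ^ card (A \<inter> {s0..<k}) * gram_det d l bs * (1 + \<epsilon>\<^sup>2)
          \<le> gram_det d l (ys k @ bs) * (1 + dot d (z k) (gram_inv d l (ys k @ bs) (z k)))"
        using step gram_det_ge_1[OF assms(2), of d "ys k @ bs"] \<epsilon>2 by (intro mult_mono) auto
      then show ?thesis unfolding c ysk by (simp add: mult_ac)
    next
      case False
      have "A \<inter> {s0..<Suc k} = A \<inter> {s0..<k}" using False by (auto simp: less_Suc_eq)
      moreover have "ys (Suc k) = ys k" using step False by (simp add: ys_def)
      ultimately show ?thesis using step by simp
    qed
  qed
  have s0n: "s0 < n" using s0 A(1) by auto
  have An: "A \<inter> {s0..<n} = A" using s0 A(1) by auto
  have inM: "set (ys n) \<subseteq> M" "set bs \<subseteq> M"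
    using assms(3) s0n by (auto simp: ys_def bs_def set_prefix_vecs)
  have lenys: "length (ys n) = card A"
  proof -
    have "card (set (filter (\<lambda>s. s \<in> A) [s0..<n])) = length (filter (\<lambda>s. s \<in> A) [s0..<n])"
      by (intro distinct_card) auto
    moreover have "set (filter (\<lambda>s. s \<in> A) [s0..<n]) = A" using An by auto
    ultimately show ?thesis by (simp add: ys_def)
  qed
  have small: "dot d (z s) (gram_inv d l bs (z s)) \<le> 576 * \<epsilon>\<^sup>2" if "s \<in> A" for s
  proof -
    have "inorm d l bs (z s) \<le> 24 * \<epsilon>"
    proof (cases "s = s0")
      case True
      then have "inorm d l bs (z s) \<le> 2 * \<epsilon>" using A(2)[OF s0(1)] by (simp add: bs_def bonus_def)
      then show ?thesis using assms(7) by linarith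
    next
      case False
      then have "s0 < s" "s < n" using s0(2)[OF that] that A(1) by auto
      then have "inorm d l bs (z s) \<le> 6 * (bonus d l z s0 + bonus d l z s)"
        using assms(4) by (simp add: comparable_bonuses_def bs_def)
      also have "\<dots> \<le> 6 * (2 * \<epsilon> + 2 * \<epsilon>)"
        using A(2)[OF s0(1)] A(2)[OF that] by (intro mult_left_mono add_mono) auto
      finally show ?thesis by simp
    qed
    then have "(inorm d l bs (z s))\<^sup>2 \<le> (24 * \<epsilon>)\<^sup>2" using assms(2) by (intro power_mono) auto
    then show ?thesis using assms(2) by (simp add: inorm_squared power_mult_distrib)
  qed
  \<comment> \<open>The value \<open>a = 2303\<close> makes 576 / (1 + a) = 1/4. Thus the exponent
    is \<open>card A * \<epsilon>\<^sup>2 / 4\<close>, half of the growth that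
    \<open>ln (1 + \<epsilon>\<^sup>2) \<ge> \<epsilon>\<^sup>2 / 2\<close> guarantees.\<close>
  have "(\<Sum>y\<leftarrow>ys n. dot d y (gram_inv d l bs y) / (1 + 2303)) \<le> (\<Sum>y\<leftarrow>ys n. \<epsilon>\<^sup>2 / 4)"
  proof (rule sum_list_mono)
    fix y assume "y \<in> set (ys n)"
    then obtain s where "s \<in> A" "y = z s" by (auto simp: ys_def)
    then show "dot d y (gram_inv d l bs y) / (1 + 2303) \<le> \<epsilon>\<^sup>2 / 4" using small[of s] by simp
  qed
  also have "\<dots> = card A * (\<epsilon>\<^sup>2 / 4)" by (simp add: sum_list_triv lenys)
  finally have s: "(\<Sum>y\<leftarrow>ys n. dot d y (gram_inv d l bs y) / (1 + 2303)) \<le> card A * (\<epsilon>\<^sup>2 / 4)" .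
  have g1: "0 < gram_det d l bs" using gram_det_ge_1[OF assms(2), of d bs] by linarith
  have "(1 + \<epsilon>\<^sup>2) ^ card A * gram_det d l bs \<le> gram_det d l (ys n @ bs)"
    using lower[of n] s0n An by simp
  also have "\<dots> \<le> gram_det d l bs * (1 + 2303) ^ card E * exp (\<Sum>y\<leftarrow>ys n. dot d y (gram_inv d l bs y) / (1 + 2303))"
    by (rule gram_det_append_le[OF assms(1,2) _ inM(2,1)]) simp
  also have "\<dots> \<le> gram_det d l bs * 2304 ^ card E * exp (card A * (\<epsilon>\<^sup>2 / 4))"
    using s g1 by (intro mult_mono) auto
  finally have "gram_det d l bs * (1 + \<epsilon>\<^sup>2) ^ card A \<le> gram_det d l bs * (2304 ^ card E * exp (card A * (\<epsilon>\<^sup>2 / 4)))"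
    by (simp add: mult_ac)
  then have "(1 + \<epsilon>\<^sup>2) ^ card A \<le> 2304 ^ card E * exp (card A * (\<epsilon>\<^sup>2 / 4))"
    using g1 by simp
  then have "ln ((1 + \<epsilon>\<^sup>2) ^ card A) \<le> ln (2304 ^ card E * exp (card A * (\<epsilon>\<^sup>2 / 4)))"
    using assms(7) by (subst ln_le_cancel_iff) (auto intro!: zero_less_power add_pos_pos)
  then have 1: "card A * ln (1 + \<epsilon>\<^sup>2) \<le> card E * ln 2304 + card A * (\<epsilon>\<^sup>2 / 4)"
    using \<epsilon>2 by (simp add: ln_mult ln_realpow)
  \<comment> \<open>Hence \<open>card A * \<epsilon>\<^sup>2 / 4\<close> is at most
    \<open>12 * card E\<close>, which is where 48 comes from.\<close>
  have "ln 2304 \<le> ln ((2 :: real) ^ 12)" by (subst ln_le_cancel_iff) auto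
  also have "\<dots> = 12 * ln 2" by (subst ln_realpow) auto
  also have "\<dots> \<le> 12" using ln_2_less_1 by simp
  finally have "card E * ln 2304 \<le> card E * (12 :: real)" by (intro mult_left_mono) auto
  moreover have "card A * (\<epsilon>\<^sup>2 / 2) \<le> card A * ln (1 + \<epsilon>\<^sup>2)"
    using \<epsilon>2 by (intro mult_left_mono ln_add_one_ge_half) auto
  ultimately show ?thesis using 1 by linarith
qed auto

text \<open>A level \<open>\<epsilon> = (1 / 2) ^ Suc J\<close> has at most
  \<open>48 * card E / \<epsilon>\<^sup>2\<close> rounds of bonus at most
  \<open>2 * \<epsilon>\<close>, in total \<open>192 * card E * 2 ^ J\<close>. These contributions
  double from level to level, so the finest one dominates.\<close>

lemma sum_small_bonus_level:
  assumes "onb d E M" "0 < l" "\<And>s. s < n \<Longrightarrow> z s \<in> M" "comparable_bonuses d l z n"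
  shows "(\<Sum>s | s < n \<and> (1 / 2) ^ J \<le> bonus d l z s \<and> bonus d l z s < 1. bonus d l z s) \<le> 192 * card E * 2 ^ J"
proof (induction J)
  case (Suc J)
  let ?b = "bonus d l z"
  let ?\<epsilon> = "(1 / 2 :: real) ^ Suc J"
  define A where "A = {s. s < n \<and> ?\<epsilon> \<le> ?b s \<and> ?b s < (1 / 2) ^ J}"
  define B where "B = {s. s < n \<and> (1 / 2) ^ J \<le> ?b s \<and> ?b s < 1}"
  have e1: "(1 / 2 :: real) ^ J \<le> 1" by (simp add: power_le_one)
  have eq0: "{s. s < n \<and> e \<le> ?b s \<and> ?b s < 1}
      = {s. s < n \<and> e \<le> ?b s \<and> ?b s < p} \<union> {s. s < n \<and> p \<le> ?b s \<and> ?b s < 1}"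
    if "e \<le> p" "p \<le> 1" for e p
    using that by auto
  have "?\<epsilon> \<le> (1 / 2 :: real) ^ J" by simp
  note eq = eq0[OF this e1, folded A_def B_def]
  have AB: "A \<inter> B = {}" "finite A" "finite B"
    unfolding A_def B_def by auto
  have "card A * ?\<epsilon>\<^sup>2 \<le> 48 * card E"
    by (rule card_bonus_level[OF assms]) (use e1 in \<open>auto simp: A_def\<close>)
  then have cA: "card A * ?\<epsilon> \<le> 48 * card E * 2 ^ Suc J"
    by (simp add: power2_eq_square power_one_over field_simps)
  have "(\<Sum>s\<in>A. ?b s) \<le> (\<Sum>s\<in>A. 2 * ?\<epsilon>)" by (intro sum_mono) (auto simp: A_def)
  also have "\<dots> = 2 * (card A * ?\<epsilon>)" by simp
  also have "\<dots> \<le> 192 * card E * 2 ^ J" using cA by simp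
  finally have "(\<Sum>s\<in>A. ?b s) \<le> 192 * card E * 2 ^ J" .
  moreover have "(\<Sum>s\<in>B. ?b s) \<le> 192 * card E * 2 ^ J" using Suc by (simp add: B_def)
  ultimately show ?case unfolding eq using AB by (simp add: sum.union_disjoint)
next
  case 0
  have "{s. s < n \<and> (1 / 2) ^ 0 \<le> bonus d l z s \<and> bonus d l z s < 1} = {}" by auto
  then show ?case by (simp only: sum.empty)
qed

text \<open>The dyadic levels stop at \<open>(1 / 2) ^ J\<close> of order
  \<open>sqrt (k / n)\<close>: above it they sum to \<open>192 * sqrt (k * n)\<close>, below it the
  \<open>n\<close> rounds together give at most \<open>2 * sqrt (k * n)\<close>. For
  \<open>n < k\<close> the trivial bound \<open>n\<close> suffices.\<close>

lemma sum_small_bonus: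
  assumes "onb d E M" "0 < l" "\<And>s. s < n \<Longrightarrow> z s \<in> M" "comparable_bonuses d l z n"
    and "card E \<le> k" "1 \<le> k"
  shows "(\<Sum>s | s < n \<and> bonus d l z s < 1. bonus d l z s) \<le> 194 * sqrt (real k * real n)"
proof (cases "k \<le> n")
  case False
  have "(\<Sum>s | s < n \<and> bonus d l z s < 1. bonus d l z s) \<le> (\<Sum>s | s < n \<and> bonus d l z s < 1. 1)"
    by (intro sum_mono) auto
  also have "\<dots> \<le> real (card {..<n})"
    using card_mono[of "{..<n}" "{s. s < n \<and> bonus d l z s < 1}"] by auto
  also have "\<dots> = sqrt (real n * real n)" by simp
  also have "\<dots> \<le> sqrt (real k * real n)" using False by (intro real_sqrt_le_mono mult_right_mono) auto
  also have "\<dots> \<le> 194 * sqrt (real k * real n)" by simp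
  finally show ?thesis .
next
  case True
  let ?b = "bonus d l z"
  have "1 \<le> n div k" using True assms(6) by (simp add: div_greater_zero_iff Suc_leI)
  then obtain J where J: "4 ^ J \<le> n div k" "n div k < 4 ^ (J + 1)"
    using ex_power_ivl1[of 4 "n div k"] by auto
  have J1: "4 ^ J * k \<le> n" using J(1) assms(6) by (simp add: less_eq_div_iff_mult_less_eq)
  have J2: "n \<le> 4 ^ (J + 1) * k" using J(2) assms(6) by (simp add: div_less_iff_less_mult)
  have J': "4 ^ J * real k \<le> real n" "real n \<le> 4 * 4 ^ J * real k"
    using of_nat_mono[OF J1, where 'a=real] of_nat_mono[OF J2, where 'a=real] by auto
  have four: "(4 :: real) ^ J = (2 ^ J)\<^sup>2" by (simp add: power2_eq_square flip: power_mult_distrib)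
  have a: "2 ^ J * real k \<le> sqrt (real k * real n)"
  proof (rule real_le_rsqrt)
    have "(2 ^ J * real k)\<^sup>2 = real k * (4 ^ J * real k)" by (simp add: four power2_eq_square)
    also have "\<dots> \<le> real k * real n" using J'(1) by (intro mult_left_mono) auto
    finally show "(2 ^ J * real k)\<^sup>2 \<le> real k * real n" .
  qed
  have b: "real n * (1 / 2) ^ J \<le> 2 * sqrt (real k * real n)"
  proof -
    have "real n * (1 / 2) ^ J \<le> sqrt (4 * (real k * real n))"
    proof (rule real_le_rsqrt)
      have "(real n * (1 / 2) ^ J)\<^sup>2 = real n * (real n / 4 ^ J)"
        by (simp add: four power2_eq_square power_one_over)
      also have "\<dots> \<le> real n * (4 * real k)"
        using J'(2) by (intro mult_left_mono) (auto simp: field_simps)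
      finally show "(real n * (1 / 2) ^ J)\<^sup>2 \<le> 4 * (real k * real n)" by (simp add: mult_ac)
    qed
    then show ?thesis by (simp add: real_sqrt_mult)
  qed
  define A where "A = {s. s < n \<and> (1 / 2) ^ J \<le> ?b s \<and> ?b s < 1}"
  define B where "B = {s. s < n \<and> ?b s < (1 / 2) ^ J}"
  have e1: "(1 / 2 :: real) ^ J \<le> 1" by (simp add: power_le_one)
  then have eq: "{s. s < n \<and> ?b s < 1} = A \<union> B" "A \<inter> B = {}" "finite A" "finite B"
    unfolding A_def B_def by auto
  have "(\<Sum>s\<in>A. ?b s) \<le> 192 * card E * 2 ^ J"
    unfolding A_def by (rule sum_small_bonus_level[OF assms(1-4)])
  also have "\<dots> \<le> 192 * (2 ^ J * real k)" using assms(5) by simp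
  also have "\<dots> \<le> 192 * sqrt (real k * real n)" using a by simp
  finally have 1: "(\<Sum>s\<in>A. ?b s) \<le> 192 * sqrt (real k * real n)" .
  have "(\<Sum>s\<in>B. ?b s) \<le> (\<Sum>s\<in>B. (1 / 2) ^ J)" by (intro sum_mono) (auto simp: B_def)
  also have "\<dots> = card B * (1 / 2) ^ J" by simp
  also have "\<dots> \<le> real n * (1 / 2) ^ J"
  proof (intro mult_right_mono)
    have "card B \<le> card {..<n}" by (intro card_mono) (auto simp: B_def)
    then show "real (card B) \<le> real n" by simp
  qed auto
  also note b
  finally have "(\<Sum>s\<in>B. ?b s) \<le> 2 * sqrt (real k * real n)" .
  with 1 show ?thesis unfolding eq(1) using eq by (simp add: sum.union_disjoint)
qed

text \<open>Optimism with \<open>xs\<close> as competitor bounds the regret of a round by its bonus.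
  With the arm of a later round \<open>t\<close> as competitor at \<open>s\<close>, it bounds the
  norm of that arm at \<open>s\<close> by the bonuses of \<open>s\<close> and \<open>t\<close>;
  since all radii agree up to a factor 2, this is comparability with constant 6. Rounds of bonus at
  least 1 are few and pay \<open>2 * R\<close> each.\<close>

lemma optimistic_regret:
  fixes \<beta> :: "nat \<Rightarrow> real"
  assumes onb: "onb d E M" "card E \<le> k" "1 \<le> k" and l: "0 < l"
    and x: "\<And>s. s < n \<Longrightarrow> x s \<in> X" and z: "\<And>s. z s = proj d M (x s)"
    and best: "xs \<in> X" "\<And>x. x \<in> X \<Longrightarrow> dot d x \<theta> \<le> dot d xs \<theta>"
    and R: "\<And>x. x \<in> X \<Longrightarrow> \<bar>dot d x \<theta>\<bar> \<le> R"
    and \<beta>: "0 < \<beta>0" "\<And>s. s < n \<Longrightarrow> \<beta>0 \<le> \<beta> s \<and> \<beta> s \<le> 2 * \<beta>0"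
    and opt: "\<And>s x'. s < n \<Longrightarrow> x' \<in> X \<Longrightarrow>
      dot d x' \<theta> + \<beta> s / 2 * inorm d l (prefix_vecs z s) (proj d M x') \<le> dot d (x s) \<theta> + 3 / 2 * \<beta> s * bonus d l z s"
  shows "(\<Sum>s<n. dot d (xs - x s) \<theta>)
    \<le> 4 * R * ln (gram_det d l (prefix_vecs z n)) + 582 * \<beta>0 * sqrt (real k * real n)"
proof -
  let ?b = "bonus d l z"
  have b0: "0 \<le> ?b s" for s using l by simp
  have zM: "z s \<in> M" for s unfolding z by (rule proj_mem[OF onb(1)])
  have up: "3 / 2 * \<beta> s * ?b s \<le> 3 * \<beta>0 * ?b s" if "s < n" for s
    using \<beta>(2)[OF that] b0 by (intro mult_right_mono) auto
  have r: "dot d (xs - x s) \<theta> \<le> 3 / 2 * \<beta> s * ?b s" if "s < n" for s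
  proof -
    have "0 \<le> \<beta> s / 2 * inorm d l (prefix_vecs z s) (proj d M xs)"
      using \<beta>(1) \<beta>(2)[OF that] l by (intro mult_nonneg_nonneg) auto
    then show ?thesis using opt[OF that best(1)] by simp
  qed
  have comp: "comparable_bonuses d l z n"
    unfolding comparable_bonuses_def
  proof (intro allI impI)
    fix s t assume st: "s < t" "t < n"
    let ?i = "inorm d l (prefix_vecs z s) (z t)"
    have "\<beta> s / 2 * ?i \<le> dot d (x s) \<theta> - dot d (x t) \<theta> + 3 / 2 * \<beta> s * ?b s"
      using opt[of s "x t"] st x[of t] by (simp add: z)
    also have "dot d (x s) \<theta> - dot d (x t) \<theta> \<le> 3 / 2 * \<beta> t * ?b t"
      using r[of t] best(2)[of "x s"] x[of s] st by simp
    also have "3 / 2 * \<beta> t * ?b t \<le> 3 * \<beta>0 * ?b t" using up st by simp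
    also have "3 / 2 * \<beta> s * ?b s \<le> 3 * \<beta>0 * ?b s" using up st by simp
    finally have 1: "\<beta> s / 2 * ?i \<le> 3 * \<beta>0 * ?b t + 3 * \<beta>0 * ?b s" by linarith
    have "\<beta>0 / 2 * ?i \<le> \<beta> s / 2 * ?i"
      using \<beta>(2)[of s] st l by (intro mult_right_mono) auto
    with 1 have "\<beta>0 * ?i \<le> \<beta>0 * (6 * (?b s + ?b t))" by (simp add: algebra_simps)
    then show "?i \<le> 6 * (?b s + ?b t)" using \<beta>(1) by simp
  qed
  define A where "A = {s. s < n \<and> 1 \<le> ?b s}"
  define B where "B = {s. s < n \<and> ?b s < 1}"
  have AB: "{..<n} = A \<union> B" "A \<inter> B = {}" "finite A" "finite B" by (auto simp: A_def B_def)
  have R0: "0 \<le> R" using R[OF best(1)] by linarith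
  have "(\<Sum>s\<in>A. dot d (xs - x s) \<theta>) \<le> (\<Sum>s\<in>A. 2 * R)"
  proof (rule sum_mono)
    fix s assume "s \<in> A"
    then have "x s \<in> X" using x by (auto simp: A_def)
    then show "dot d (xs - x s) \<theta> \<le> 2 * R" using R[OF best(1)] R[of "x s"] by simp
  qed
  also have "\<dots> = 2 * R * card A" by simp
  also have "\<dots> \<le> 2 * R * (2 * ln (gram_det d l (prefix_vecs z n)))"
    unfolding A_def using R0 by (intro mult_left_mono card_large_bonus[OF l]) auto
  finally have 1: "(\<Sum>s\<in>A. dot d (xs - x s) \<theta>) \<le> 4 * R * ln (gram_det d l (prefix_vecs z n))" by simp
  have "(\<Sum>s\<in>B. dot d (xs - x s) \<theta>) \<le> (\<Sum>s\<in>B. 3 * \<beta>0 * ?b s)"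
    using r up by (intro sum_mono) (force simp: B_def)
  also have "\<dots> = 3 * \<beta>0 * (\<Sum>s\<in>B. ?b s)" by (simp add: sum_distrib_left)
  also have "\<dots> \<le> 3 * \<beta>0 * (194 * sqrt (real k * real n))"
    unfolding B_def using \<beta>(1) zM comp onb l by (intro mult_left_mono sum_small_bonus) auto
  finally have "(\<Sum>s\<in>B. dot d (xs - x s) \<theta>) \<le> 582 * \<beta>0 * sqrt (real k * real n)" by simp
  with 1 show ?thesis unfolding AB(1) using AB by (simp add: sum.union_disjoint)
qed

section \<open>Resampling one coordinate\<close>

text \<open>Overwriting one coordinate by an independent draw preserves the product measure. The
  inner integral replaces a conditional expectation given the other coordinates.\<close>

lemma nn_integral_PiM_resample:
  fixes f :: "('i \<Rightarrow> 'a) \<Rightarrow> ennreal"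
  assumes "prob_space N" and f: "f \<in> borel_measurable (\<Pi>\<^sub>M t\<in>UNIV. N)"
  shows "(\<integral>\<^sup>+b. f b \<partial>(\<Pi>\<^sub>M t\<in>UNIV. N)) = (\<integral>\<^sup>+b. \<integral>\<^sup>+v. f (b(i := v)) \<partial>N \<partial>(\<Pi>\<^sub>M t\<in>UNIV. N))"
proof -
  let ?P = "\<Pi>\<^sub>M t\<in>(UNIV :: 'i set). N"
  interpret N: prob_space N by fact
  interpret P: prob_space ?P by (intro prob_space_PiM assms)
  interpret pair_sigma_finite N ?P ..
  have m: "(\<lambda>(v, b). b(i := v)) \<in> N \<Otimes>\<^sub>M ?P \<rightarrow>\<^sub>M ?P"
    unfolding case_prod_unfold
    by (intro measurable_PiM_single') (auto simp: space_pair_measure space_PiM PiE_iff split: if_splits)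
  have "(\<integral>\<^sup>+b. f b \<partial>?P) = (\<integral>\<^sup>+b. f b \<partial>distr (N \<Otimes>\<^sub>M ?P) ?P (\<lambda>(v, b). b(i := v)))"
    using distr_pair_PiM_eq_PiM[of UNIV "\<lambda>_. N" i] assms(1) by simp
  also have "\<dots> = (\<integral>\<^sup>+x. f ((\<lambda>(v, b). b(i := v)) x) \<partial>(N \<Otimes>\<^sub>M ?P))"
    by (subst nn_integral_distr) (use m f in auto)
  also have "\<dots> = (\<integral>\<^sup>+b. \<integral>\<^sup>+v. f (b(i := v)) \<partial>N \<partial>?P)"
    using measurable_compose[OF m f] by (subst nn_integral_snd[symmetric]) (auto simp: case_prod_unfold)
  finally show ?thesis .
qed

definition gauss :: "real \<Rightarrow> real measure" where
  "gauss \<sigma> = density lborel (normal_density 0 \<sigma>)"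

lemma prob_space_gauss: "0 < \<sigma> \<Longrightarrow> prob_space (gauss \<sigma>)"
  unfolding gauss_def by (rule prob_space_normal_density)

lemma sets_gauss [measurable_cong, simp]: "sets (gauss \<sigma>) = sets borel"
  by (simp add: gauss_def)

lemma space_gauss [simp]: "space (gauss \<sigma>) = UNIV"
  by (simp add: gauss_def)

lemma sample_space_eq: "sample_space \<nu> \<sigma> = (\<Pi>\<^sub>M t\<in>UNIV. \<nu>) \<Otimes>\<^sub>M (\<Pi>\<^sub>M t\<in>UNIV. gauss \<sigma>)"
  by (simp add: sample_space_def gauss_def)

lemma prob_space_sample_space:
  assumes "prob_space \<nu>" "0 < \<sigma>"
  shows "prob_space (sample_space \<nu> \<sigma>)"
proof -
  interpret A: prob_space "\<Pi>\<^sub>M t\<in>(UNIV :: nat set). \<nu>" by (intro prob_space_PiM assms)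
  interpret B: prob_space "\<Pi>\<^sub>M t\<in>(UNIV :: nat set). gauss \<sigma>" by (intro prob_space_PiM prob_space_gauss assms)
  interpret pair_prob_space "\<Pi>\<^sub>M t\<in>(UNIV :: nat set). \<nu>" "\<Pi>\<^sub>M t\<in>(UNIV :: nat set). gauss \<sigma>" ..
  show ?thesis unfolding sample_space_eq by unfold_locales
qed

lemma measurable_sample_noise_upd:
  "(\<lambda>(\<omega>, v). (fst \<omega>, (snd \<omega>)(i := v))) \<in> sample_space \<nu> \<sigma> \<Otimes>\<^sub>M gauss \<sigma> \<rightarrow>\<^sub>M sample_space \<nu> \<sigma>"
proof -
  have "(\<lambda>x. (snd (fst x))(i := snd x)) \<in> sample_space \<nu> \<sigma> \<Otimes>\<^sub>M gauss \<sigma> \<rightarrow>\<^sub>M (\<Pi>\<^sub>M t\<in>UNIV. gauss \<sigma>)"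
    unfolding sample_space_eq
    by (intro measurable_PiM_single') (auto simp: space_pair_measure space_PiM PiE_iff split: if_splits)
  moreover have "(\<lambda>x. fst (fst x)) \<in> sample_space \<nu> \<sigma> \<Otimes>\<^sub>M gauss \<sigma> \<rightarrow>\<^sub>M (\<Pi>\<^sub>M t\<in>UNIV. \<nu>)"
    unfolding sample_space_eq by measurable
  ultimately show ?thesis
    by (subst sample_space_eq) (auto simp: case_prod_unfold intro!: measurable_Pair)
qed

lemma nn_integral_noise_resample:
  assumes "prob_space \<nu>" "0 < \<sigma>" and f[measurable]: "f \<in> borel_measurable (sample_space \<nu> \<sigma>)"
  shows "(\<integral>\<^sup>+\<omega>. f \<omega> \<partial>sample_space \<nu> \<sigma>) =
    (\<integral>\<^sup>+\<omega>. \<integral>\<^sup>+v. f (fst \<omega>, (snd \<omega>)(i := v)) \<partial>gauss \<sigma> \<partial>sample_space \<nu> \<sigma>)"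
proof -
  let ?A = "\<Pi>\<^sub>M t\<in>(UNIV :: nat set). \<nu>" and ?B = "\<Pi>\<^sub>M t\<in>(UNIV :: nat set). gauss \<sigma>"
  interpret B: prob_space ?B by (intro prob_space_PiM prob_space_gauss assms)
  interpret N: prob_space "gauss \<sigma>" by (intro prob_space_gauss assms)
  have f'[measurable]: "f \<in> borel_measurable (?A \<Otimes>\<^sub>M ?B)" using f by (simp add: sample_space_eq)
  have g: "(\<lambda>\<omega>. \<integral>\<^sup>+v. f (fst \<omega>, (snd \<omega>)(i := v)) \<partial>gauss \<sigma>) \<in> borel_measurable (?A \<Otimes>\<^sub>M ?B)"
    using measurable_compose[OF measurable_sample_noise_upd[of i \<nu> \<sigma>] f]
    by (intro N.borel_measurable_nn_integral) (simp add: sample_space_eq case_prod_unfold)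
  have "(\<integral>\<^sup>+\<omega>. f \<omega> \<partial>(?A \<Otimes>\<^sub>M ?B)) = (\<integral>\<^sup>+a. \<integral>\<^sup>+b. f (a, b) \<partial>?B \<partial>?A)"
    by (rule B.nn_integral_fst[symmetric]) measurable
  also have "\<dots> = (\<integral>\<^sup>+a. \<integral>\<^sup>+b. \<integral>\<^sup>+v. f (a, b(i := v)) \<partial>gauss \<sigma> \<partial>?B \<partial>?A)"
    by (intro nn_integral_cong nn_integral_PiM_resample prob_space_gauss assms) measurable
  also have "\<dots> = (\<integral>\<^sup>+\<omega>. \<integral>\<^sup>+v. f (fst \<omega>, (snd \<omega>)(i := v)) \<partial>gauss \<sigma> \<partial>(?A \<Otimes>\<^sub>M ?B))"
    using B.nn_integral_fst[OF g] by simp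
  finally show ?thesis by (simp add: sample_space_eq)
qed

section \<open>The self-normalised Gaussian martingale\<close>

text \<open>Completing the square, the density of variance \<open>\<sigma>\<^sup>2\<close> times the
  integrand is \<open>sqrt (1 + w)\<close> times a normal density with mean \<open>s\<close> and
  variance \<open>\<sigma>\<^sup>2 * (1 + w)\<close>. The value is the factor by which the square
  root of \<open>gram_det\<close> grows under the update.\<close>

lemma nn_integral_gauss_rank_one:
  assumes "0 < \<sigma>" "0 \<le> w"
  shows "(\<integral>\<^sup>+v. ennreal (exp ((2 * v * s + v\<^sup>2 * w - s\<^sup>2) / (2 * \<sigma>\<^sup>2 * (1 + w)))) \<partial>gauss \<sigma>) = ennreal (sqrt (1 + w))"
proof -
  let ?e = "\<lambda>v. exp ((2 * v * s + v\<^sup>2 * w - s\<^sup>2) / (2 * \<sigma>\<^sup>2 * (1 + w)))"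
  have \<sigma>': "0 < \<sigma> * sqrt (1 + w)" using assms by simp
  have d: "normal_density 0 \<sigma> v * ?e v = sqrt (1 + w) * normal_density s (\<sigma> * sqrt (1 + w)) v" for v
  proof -
    have "- (v - 0)\<^sup>2 / (2 * \<sigma>\<^sup>2) + (2 * v * s + v\<^sup>2 * w - s\<^sup>2) / (2 * \<sigma>\<^sup>2 * (1 + w))
        = (- v\<^sup>2 * (1 + w) + (2 * v * s + v\<^sup>2 * w - s\<^sup>2)) / (2 * \<sigma>\<^sup>2 * (1 + w))"
      unfolding add_divide_distrib[of "- v\<^sup>2 * (1 + w)"] using assms by simp
    also have "- v\<^sup>2 * (1 + w) + (2 * v * s + v\<^sup>2 * w - s\<^sup>2) = - (v - s)\<^sup>2"
      by (simp add: power2_eq_square algebra_simps)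
    finally have q: "- (v - 0)\<^sup>2 / (2 * \<sigma>\<^sup>2) + (2 * v * s + v\<^sup>2 * w - s\<^sup>2) / (2 * \<sigma>\<^sup>2 * (1 + w))
        = - (v - s)\<^sup>2 / (2 * \<sigma>\<^sup>2 * (1 + w))" .
    have D: "2 * (\<sigma> * sqrt (1 + w))\<^sup>2 = 2 * \<sigma>\<^sup>2 * (1 + w)"
      using assms by (simp add: power_mult_distrib)
    have e: "exp (- (v - 0)\<^sup>2 / (2 * \<sigma>\<^sup>2)) * ?e v = exp (- (v - s)\<^sup>2 / (2 * (\<sigma> * sqrt (1 + w))\<^sup>2))"
      by (simp only: exp_add[symmetric] q D)
    have "sqrt (2 * pi * (\<sigma> * sqrt (1 + w))\<^sup>2) = sqrt (2 * pi * \<sigma>\<^sup>2) * sqrt (1 + w)"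
      using assms by (simp add: power_mult_distrib real_sqrt_mult)
    then have c: "1 / sqrt (2 * pi * \<sigma>\<^sup>2) = sqrt (1 + w) * (1 / sqrt (2 * pi * (\<sigma> * sqrt (1 + w))\<^sup>2))"
      using assms by simp
    have "normal_density 0 \<sigma> v * ?e v = 1 / sqrt (2 * pi * \<sigma>\<^sup>2) * (exp (- (v - 0)\<^sup>2 / (2 * \<sigma>\<^sup>2)) * ?e v)"
      unfolding normal_density_def by (rule mult.assoc)
    also have "\<dots> = sqrt (1 + w) * normal_density s (\<sigma> * sqrt (1 + w)) v"
      unfolding e c normal_density_def by (rule mult.assoc)
    finally show ?thesis .
  qed
  have "(\<integral>\<^sup>+v. ennreal (?e v) \<partial>gauss \<sigma>) = (\<integral>\<^sup>+v. ennreal (normal_density 0 \<sigma> v) * ennreal (?e v) \<partial>lborel)"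
    unfolding gauss_def by (subst nn_integral_density) auto
  also have "\<dots> = (\<integral>\<^sup>+v. ennreal (sqrt (1 + w)) * ennreal (normal_density s (\<sigma> * sqrt (1 + w)) v) \<partial>lborel)"
    using assms by (intro nn_integral_cong) (simp add: d ennreal_mult[symmetric])
  also have "\<dots> = ennreal (sqrt (1 + w)) * (\<integral>\<^sup>+v. ennreal (normal_density s (\<sigma> * sqrt (1 + w)) v) \<partial>lborel)"
    by (rule nn_integral_cmult) measurable
  also have "(\<integral>\<^sup>+v. ennreal (normal_density s (\<sigma> * sqrt (1 + w)) v) \<partial>lborel) = 1"
    using prob_space.emeasure_space_1[OF prob_space_normal_density[OF \<sigma>', of s]]
    by (simp add: emeasure_density)
  finally show ?thesis by simp
qed

definition noise_vec :: "(nat \<Rightarrow> vector) \<Rightarrow> (nat \<Rightarrow> real) \<Rightarrow> nat \<Rightarrow> vector" where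
  "noise_vec z e k = (\<Sum>s<k. e s *\<^sub>R z s)"

definition self_norm :: "nat \<Rightarrow> real \<Rightarrow> (nat \<Rightarrow> vector) \<Rightarrow> (nat \<Rightarrow> real) \<Rightarrow> nat \<Rightarrow> real" where
  "self_norm d l z e k = dot d (noise_vec z e k) (gram_inv d l (prefix_vecs z k) (noise_vec z e k))"

text \<open>The likelihood ratio of the method of mixtures: the exponential martingales in a fixed
  direction, averaged over a centred Gaussian direction.\<close>

definition lik :: "nat \<Rightarrow> real \<Rightarrow> real \<Rightarrow> (nat \<Rightarrow> vector) \<Rightarrow> (nat \<Rightarrow> real) \<Rightarrow> nat \<Rightarrow> real" where
  "lik d l \<sigma> z e k = exp (self_norm d l z e k / (2 * \<sigma>\<^sup>2)) / sqrt (gram_det d l (prefix_vecs z k))"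

text \<open>By Sherman--Morrison the increment is a quadratic polynomial in the fresh noise
  \<open>e k\<close>, divided by \<open>1 + w k\<close>. Its form is the exponent of
  \<open>nn_integral_gauss_rank_one\<close>.\<close>

lemma self_norm_Suc:
  fixes d :: nat and l :: real and z :: "nat \<Rightarrow> vector" and e :: "nat \<Rightarrow> real"
  assumes "0 < l"
  defines "w \<equiv> \<lambda>k. dot d (z k) (gram_inv d l (prefix_vecs z k) (z k))"
    and "s \<equiv> \<lambda>k. dot d (z k) (gram_inv d l (prefix_vecs z k) (noise_vec z e k))"
  shows "self_norm d l z e (Suc k) = self_norm d l z e k + (2 * e k * s k + (e k)\<^sup>2 * w k - (s k)\<^sup>2) / (1 + w k)"
proof -
  let ?S = "noise_vec z e k" and ?zs = "prefix_vecs z k"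
  have w: "0 \<le> w k" using assms(1) by (simp add: w_def)
  have N: "noise_vec z e (Suc k) = ?S + e k *\<^sub>R z k" by (simp add: noise_vec_def)
  have c: "dot d ?S (gram_inv d l ?zs (z k)) = s k"
    unfolding s_def dot_gram_inv_commute[of d ?S] by (rule dot_commute)
  have "dot d (?S + e k *\<^sub>R z k) (gram_inv d l ?zs (?S + e k *\<^sub>R z k))
      = self_norm d l z e k + 2 * e k * s k + (e k)\<^sup>2 * w k"
    by (simp add: c self_norm_def power2_eq_square) (simp add: s_def w_def algebra_simps)
  moreover have "dot d (z k) (gram_inv d l ?zs (?S + e k *\<^sub>R z k)) = s k + e k * w k"
    by (simp add: s_def w_def)
  moreover have wk: "dot d (z k) (gram_inv d l ?zs (z k)) = w k" by (simp add: w_def)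
  ultimately have "self_norm d l z e (Suc k) = (self_norm d l z e k + 2 * e k * s k + (e k)\<^sup>2 * w k) - (s k + e k * w k)\<^sup>2 / (1 + w k)"
    unfolding self_norm_def[of _ _ _ _ "Suc k"] prefix_vecs_Suc dot_gram_inv_Cons N wk
    by (simp only: power2_eq_square)
  also have "\<dots> = self_norm d l z e k + (2 * e k * s k + (e k)\<^sup>2 * w k - (s k)\<^sup>2) / (1 + w k)"
    using w by (simp add: field_simps power2_eq_square)
  finally show ?thesis .
qed

lemma lik_0 [simp]: "lik d l \<sigma> z e 0 = 1"
  by (simp add: lik_def self_norm_def noise_vec_def)

lemma lik_nonneg [simp]: "0 < l \<Longrightarrow> 0 \<le> lik d l \<sigma> z e k"
  using gram_det_ge_1[of l d "prefix_vecs z k"] by (simp add: lik_def)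

lemma lik_Suc:
  fixes d :: nat and l :: real and z :: "nat \<Rightarrow> vector" and e :: "nat \<Rightarrow> real"
  assumes "0 < l"
  defines "w \<equiv> \<lambda>k. dot d (z k) (gram_inv d l (prefix_vecs z k) (z k))"
    and "s \<equiv> \<lambda>k. dot d (z k) (gram_inv d l (prefix_vecs z k) (noise_vec z e k))"
  shows "lik d l \<sigma> z e (Suc k) = lik d l \<sigma> z e k / sqrt (1 + w k) *
    exp ((2 * e k * s k + (e k)\<^sup>2 * w k - (s k)\<^sup>2) / (2 * \<sigma>\<^sup>2 * (1 + w k)))"
proof -
  have "gram_det d l (prefix_vecs z (Suc k)) = gram_det d l (prefix_vecs z k) * (1 + w k)"
    by (simp add: w_def)
  moreover have "self_norm d l z e (Suc k) / (2 * \<sigma>\<^sup>2) = self_norm d l z e k / (2 * \<sigma>\<^sup>2)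
      + (2 * e k * s k + (e k)\<^sup>2 * w k - (s k)\<^sup>2) / (2 * \<sigma>\<^sup>2 * (1 + w k))"
    unfolding self_norm_Suc[OF assms(1), of d z e k] w_def s_def by (simp add: add_divide_distrib mult.commute)
  ultimately show ?thesis
    by (simp only: lik_def exp_add real_sqrt_mult) simp
qed

lemma prefix_vecs_cong: "(\<And>s. s < k \<Longrightarrow> z s = z' s) \<Longrightarrow> prefix_vecs z k = prefix_vecs z' k"
  by (auto simp: prefix_vecs_def)

lemma lik_cong:
  assumes "\<And>s. s < k \<Longrightarrow> z s = z' s" "\<And>s. s < k \<Longrightarrow> e s = e' s"
  shows "lik d l \<sigma> z e k = lik d l \<sigma> z' e' k"
  using assms prefix_vecs_cong[of k z z'] by (simp add: lik_def self_norm_def noise_vec_def)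

section \<open>Measurability\<close>

lemma measurable_vector_iff:
  fixes f :: "'a \<Rightarrow> vector"
  shows "f \<in> borel_measurable M \<longleftrightarrow> (\<forall>i. (\<lambda>\<omega>. f \<omega> i) \<in> borel_measurable M)"
  using measurable_coordinatewise_then_product[of f M] measurable_product_then_coordinatewise[of f M] by blast

lemma measurable_vector_apply [measurable (raw)]:
  fixes f :: "'a \<Rightarrow> vector"
  shows "f \<in> borel_measurable M \<Longrightarrow> (\<lambda>\<omega>. f \<omega> i) \<in> borel_measurable M"
  by (simp add: measurable_vector_iff)

lemma measurable_dot [measurable (raw)]:
  assumes "f \<in> borel_measurable M" "g \<in> borel_measurable M"
  shows "(\<lambda>\<omega>. dot d (f \<omega>) (g \<omega>)) \<in> borel_measurable M"
  unfolding dot_def using assms by measurable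

lemma measurable_vector_diff [measurable (raw)]:
  fixes f g :: "'a \<Rightarrow> vector"
  assumes "f \<in> borel_measurable M" "g \<in> borel_measurable M"
  shows "(\<lambda>\<omega>. f \<omega> - g \<omega>) \<in> borel_measurable M"
  using assms by (simp add: measurable_vector_iff minus_apply borel_measurable_diff)

lemma measurable_vector_scaleR [measurable (raw)]:
  fixes f :: "'a \<Rightarrow> vector"
  assumes "f \<in> borel_measurable M" "c \<in> borel_measurable M"
  shows "(\<lambda>\<omega>. c \<omega> *\<^sub>R f \<omega>) \<in> borel_measurable M"
  using assms by (simp add: measurable_vector_iff scaleR_fun_apply borel_measurable_times)

lemma measurable_vector_sum [measurable (raw)]:
  fixes f :: "'i \<Rightarrow> 'a \<Rightarrow> vector"
  assumes "\<And>i. i \<in> I \<Longrightarrow> f i \<in> borel_measurable M"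
  shows "(\<lambda>\<omega>. \<Sum>i\<in>I. f i \<omega>) \<in> borel_measurable M"
  using assms by (simp add: measurable_vector_iff sum_fun_apply borel_measurable_sum)

lemma measurable_gram_inv:
  assumes "\<And>s. s < k \<Longrightarrow> Z s \<in> borel_measurable M" "V \<in> borel_measurable M"
  shows "(\<lambda>\<omega>. gram_inv d l (prefix_vecs (\<lambda>s. Z s \<omega>) k) (V \<omega>)) \<in> borel_measurable M"
  using assms
proof (induction k arbitrary: V)
  case (Suc k)
  have [measurable]: "Z k \<in> borel_measurable M" "V \<in> borel_measurable M" using Suc by auto
  have [measurable]: "(\<lambda>\<omega>. gram_inv d l (prefix_vecs (\<lambda>s. Z s \<omega>) k) (Z k \<omega>)) \<in> borel_measurable M"
    "(\<lambda>\<omega>. gram_inv d l (prefix_vecs (\<lambda>s. Z s \<omega>) k) (V \<omega>)) \<in> borel_measurable M"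
    using Suc by auto
  show ?case unfolding prefix_vecs_Suc gram_inv.simps by measurable
qed simp

lemma measurable_gram_det:
  assumes "\<And>s. s < k \<Longrightarrow> Z s \<in> borel_measurable M"
  shows "(\<lambda>\<omega>. gram_det d l (prefix_vecs (\<lambda>s. Z s \<omega>) k)) \<in> borel_measurable M"
  using assms
proof (induction k)
  case (Suc k)
  have [measurable]: "Z k \<in> borel_measurable M" using Suc by auto
  have [measurable]: "(\<lambda>\<omega>. gram_inv d l (prefix_vecs (\<lambda>s. Z s \<omega>) k) (Z k \<omega>)) \<in> borel_measurable M"
    using Suc by (intro measurable_gram_inv) auto
  have [measurable]: "(\<lambda>\<omega>. gram_det d l (prefix_vecs (\<lambda>s. Z s \<omega>) k)) \<in> borel_measurable M"
    using Suc by auto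
  show ?case unfolding prefix_vecs_Suc gram_det.simps by measurable
qed simp

lemma measurable_lik:
  assumes "\<And>s. s < k \<Longrightarrow> Z s \<in> borel_measurable M" "\<And>s. s < k \<Longrightarrow> e s \<in> borel_measurable M"
  shows "(\<lambda>\<omega>. lik d l \<sigma> (\<lambda>s. Z s \<omega>) (\<lambda>s. e s \<omega>) k) \<in> borel_measurable M"
proof -
  have [measurable]: "(\<lambda>\<omega>. noise_vec (\<lambda>s. Z s \<omega>) (\<lambda>s. e s \<omega>) k) \<in> borel_measurable M"
    unfolding noise_vec_def using assms by measurable
  have [measurable]: "(\<lambda>\<omega>. gram_inv d l (prefix_vecs (\<lambda>s. Z s \<omega>) k) (noise_vec (\<lambda>s. Z s \<omega>) (\<lambda>s. e s \<omega>) k)) \<in> borel_measurable M"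
    "(\<lambda>\<omega>. gram_det d l (prefix_vecs (\<lambda>s. Z s \<omega>) k)) \<in> borel_measurable M"
    using assms by (auto intro!: measurable_gram_inv measurable_gram_det)
  show ?thesis unfolding lik_def self_norm_def by measurable
qed

section \<open>Expectations along adapted processes\<close>

lemma measurable_noise [measurable]: "(\<lambda>\<omega>. snd \<omega> i) \<in> borel_measurable (sample_space \<nu> \<sigma>)"
proof -
  have "(\<lambda>\<omega>. snd \<omega> i) \<in> sample_space \<nu> \<sigma> \<rightarrow>\<^sub>M gauss \<sigma>"
    unfolding sample_space_eq by measurable
  then show ?thesis by (simp add: measurable_cong_sets[OF refl sets_gauss])
qed

lemma measurable_arm:
  assumes "sets \<nu> = sets borel"
  shows "(\<lambda>\<omega>. fst \<omega> i) \<in> borel_measurable (sample_space \<nu> \<sigma>)"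
proof -
  have "(\<lambda>\<omega>. fst \<omega> i) \<in> sample_space \<nu> \<sigma> \<rightarrow>\<^sub>M \<nu>"
    unfolding sample_space_eq by measurable
  then show ?thesis by (simp add: measurable_cong_sets[OF refl assms])
qed

text \<open>The vector \<open>Z s\<close> belongs to round \<open>a + s + 1\<close> and may depend
  on noise up to round \<open>a + s\<close>, the weight \<open>W\<close> on noise up to round
  \<open>a\<close>; both are expressed by invariance under overwriting. Resampling the noise of the
  last round then removes the last factor of the martingale.\<close>

lemma nn_integral_lik:
  fixes Z :: "nat \<Rightarrow> (nat \<Rightarrow> vector) \<times> (nat \<Rightarrow> real) \<Rightarrow> vector" and W :: "(nat \<Rightarrow> vector) \<times> (nat \<Rightarrow> real) \<Rightarrow> ennreal"
  assumes "prob_space \<nu>" "0 < \<sigma>" "0 < l"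
    and Z: "\<And>s. s < K \<Longrightarrow> Z s \<in> borel_measurable (sample_space \<nu> \<sigma>)"
    and Z': "\<And>s i c b v. s < K \<Longrightarrow> a + s < i \<Longrightarrow> Z s (c, b(i := v)) = Z s (c, b)"
    and W[measurable]: "W \<in> borel_measurable (sample_space \<nu> \<sigma>)"
    and W': "\<And>i c b v. a < i \<Longrightarrow> W (c, b(i := v)) = W (c, b)"
    and "k \<le> K"
  shows "(\<integral>\<^sup>+\<omega>. W \<omega> * ennreal (lik d l \<sigma> (\<lambda>s. Z s \<omega>) (\<lambda>s. snd \<omega> (a + s + 1)) k) \<partial>sample_space \<nu> \<sigma>)
    = (\<integral>\<^sup>+\<omega>. W \<omega> \<partial>sample_space \<nu> \<sigma>)"
  using assms(8)
proof (induction k)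
  case (Suc k)
  let ?P = "sample_space \<nu> \<sigma>" and ?e = "\<lambda>\<omega> s. snd \<omega> (a + s + 1)" and ?i = "a + k + 1"
  let ?L = "\<lambda>k \<omega>. lik d l \<sigma> (\<lambda>s. Z s \<omega>) (?e \<omega>) k"
  have ZM: "Z s \<in> borel_measurable ?P" if "s < Suc k" for s using Z Suc.prems that by auto
  have L[measurable]: "?L (Suc k) \<in> borel_measurable ?P"
    using ZM by (intro measurable_lik) auto
  have inner: "(\<integral>\<^sup>+v. W (fst \<omega>, (snd \<omega>)(?i := v)) * ennreal (?L (Suc k) (fst \<omega>, (snd \<omega>)(?i := v))) \<partial>gauss \<sigma>)
      = W \<omega> * ennreal (?L k \<omega>)" for \<omega>
  proof -
    define zs where "zs = prefix_vecs (\<lambda>s. Z s \<omega>) k"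
    define w where "w = dot d (Z k \<omega>) (gram_inv d l zs (Z k \<omega>))"
    define g where "g = dot d (Z k \<omega>) (gram_inv d l zs (noise_vec (\<lambda>s. Z s \<omega>) (?e \<omega>) k))"
    have w: "0 \<le> w" using assms(3) by (simp add: w_def)
    have step: "?L (Suc k) (fst \<omega>, (snd \<omega>)(?i := v))
        = ?L k \<omega> / sqrt (1 + w) * exp ((2 * v * g + v\<^sup>2 * w - g\<^sup>2) / (2 * \<sigma>\<^sup>2 * (1 + w)))" for v
    proof -
      let ?\<omega> = "(fst \<omega>, (snd \<omega>)(?i := v))"
      have Zeq: "Z s ?\<omega> = Z s \<omega>" if "s < Suc k" for s
        using Z'[of s ?i "fst \<omega>" "snd \<omega>" v] Suc.prems that by auto
      have eeq: "?e ?\<omega> s = ?e \<omega> s" if "s < k" for s using that by simp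
      have ek: "?e ?\<omega> k = v" by simp
      have Leq: "?L k ?\<omega> = ?L k \<omega>" using Zeq eeq by (intro lik_cong) auto
      have zseq: "prefix_vecs (\<lambda>s. Z s ?\<omega>) k = zs" unfolding zs_def using Zeq by (intro prefix_vecs_cong) auto
      have neq: "noise_vec (\<lambda>s. Z s ?\<omega>) (?e ?\<omega>) k = noise_vec (\<lambda>s. Z s \<omega>) (?e \<omega>) k"
        unfolding noise_vec_def using Zeq eeq by (intro sum.cong) auto
      show ?thesis
        unfolding lik_Suc[OF assms(3)] Leq zseq neq Zeq[OF lessI] ek w_def g_def ..
    qed
    have "(\<integral>\<^sup>+v. W (fst \<omega>, (snd \<omega>)(?i := v)) * ennreal (?L (Suc k) (fst \<omega>, (snd \<omega>)(?i := v))) \<partial>gauss \<sigma>)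
        = (\<integral>\<^sup>+v. W \<omega> * ennreal (?L k \<omega> / sqrt (1 + w)) * ennreal (exp ((2 * v * g + v\<^sup>2 * w - g\<^sup>2) / (2 * \<sigma>\<^sup>2 * (1 + w)))) \<partial>gauss \<sigma>)"
    proof (rule nn_integral_cong)
      fix v
      have W: "W (fst \<omega>, (snd \<omega>)(?i := v)) = W \<omega>" using W'[of ?i "fst \<omega>" "snd \<omega>" v] by simp
      have A: "0 \<le> ?L k \<omega> / sqrt (1 + w)" using w assms(3) by simp
      show "W (fst \<omega>, (snd \<omega>)(?i := v)) * ennreal (?L (Suc k) (fst \<omega>, (snd \<omega>)(?i := v)))
        = W \<omega> * ennreal (?L k \<omega> / sqrt (1 + w)) * ennreal (exp ((2 * v * g + v\<^sup>2 * w - g\<^sup>2) / (2 * \<sigma>\<^sup>2 * (1 + w))))"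
        unfolding step W ennreal_mult[OF A exp_ge_zero] by (rule mult.assoc[symmetric])
    qed
    also have "\<dots> = W \<omega> * ennreal (?L k \<omega> / sqrt (1 + w)) * ennreal (sqrt (1 + w))"
    proof -
      have "(\<lambda>v. ennreal (exp ((2 * v * g + v\<^sup>2 * w - g\<^sup>2) / (2 * \<sigma>\<^sup>2 * (1 + w))))) \<in> borel_measurable (gauss \<sigma>)"
        unfolding measurable_cong_sets[OF sets_gauss refl] by measurable
      then show ?thesis by (simp only: nn_integral_cmult nn_integral_gauss_rank_one[OF assms(2) w])
    qed
    also have "\<dots> = W \<omega> * ennreal (?L k \<omega>)"
      using w assms(3) by (simp add: mult.assoc ennreal_mult[symmetric])
    finally show ?thesis .
  qed
  have "(\<integral>\<^sup>+\<omega>. W \<omega> * ennreal (?L (Suc k) \<omega>) \<partial>?P)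
      = (\<integral>\<^sup>+\<omega>. \<integral>\<^sup>+v. W (fst \<omega>, (snd \<omega>)(?i := v)) * ennreal (?L (Suc k) (fst \<omega>, (snd \<omega>)(?i := v))) \<partial>gauss \<sigma> \<partial>?P)"
    by (rule nn_integral_noise_resample[OF assms(1,2)]) measurable
  also have "\<dots> = (\<integral>\<^sup>+\<omega>. W \<omega> * ennreal (?L k \<omega>) \<partial>?P)"
    unfolding inner ..
  also have "\<dots> = (\<integral>\<^sup>+\<omega>. W \<omega> \<partial>?P)" using Suc by simp
  finally show ?case .
qed simp

text \<open>Markov's inequality with the indicator of \<open>A\<close> as weight. Keeping the
  probability of \<open>A\<close> on the right allows a sum over disjoint events \<open>A\<close> at
  no extra cost.\<close>

lemma measure_lik_gt_le:
  fixes Z :: "nat \<Rightarrow> (nat \<Rightarrow> vector) \<times> (nat \<Rightarrow> real) \<Rightarrow> vector" and d a :: nat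
  assumes "prob_space \<nu>" "0 < \<sigma>" "0 < l"
    and Z: "\<And>s. s < K \<Longrightarrow> Z s \<in> borel_measurable (sample_space \<nu> \<sigma>)"
    and Z': "\<And>s i c b v. s < K \<Longrightarrow> a + s < i \<Longrightarrow> Z s (c, b(i := v)) = Z s (c, b)"
    and A: "A \<in> sets (sample_space \<nu> \<sigma>)"
    and A': "\<And>i c b v. a < i \<Longrightarrow> (c, b(i := v)) \<in> A \<longleftrightarrow> (c, b) \<in> A"
    and "k \<le> K" "0 < q"
  defines "B \<equiv> {\<omega> \<in> space (sample_space \<nu> \<sigma>). \<omega> \<in> A \<and> q < lik d l \<sigma> (\<lambda>s. Z s \<omega>) (\<lambda>s. snd \<omega> (a + s + 1)) k}"
  shows "B \<in> sets (sample_space \<nu> \<sigma>)"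
    and "measure (sample_space \<nu> \<sigma>) B \<le> measure (sample_space \<nu> \<sigma>) A / q"
proof -
  let ?P = "sample_space \<nu> \<sigma>"
  let ?L = "\<lambda>\<omega>. lik d l \<sigma> (\<lambda>s. Z s \<omega>) (\<lambda>s. snd \<omega> (a + s + 1)) k"
  interpret prob_space ?P by (rule prob_space_sample_space[OF assms(1,2)])
  have L[measurable]: "?L \<in> borel_measurable ?P"
    using Z assms(8) by (intro measurable_lik) auto
  note [measurable] = A
  show B: "B \<in> sets ?P" unfolding B_def by measurable
  have "ennreal q * emeasure ?P B = (\<integral>\<^sup>+\<omega>. ennreal q * indicator B \<omega> \<partial>?P)"
    using B by (simp add: nn_integral_cmult_indicator)
  also have "\<dots> \<le> (\<integral>\<^sup>+\<omega>. indicator A \<omega> * ennreal (?L \<omega>) \<partial>?P)"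
    by (intro nn_integral_mono) (auto simp: B_def split: split_indicator intro!: ennreal_leI)
  also have "\<dots> = (\<integral>\<^sup>+\<omega>. indicator A \<omega> \<partial>?P)"
  proof (rule nn_integral_lik[OF assms(1-3) Z Z' _ _ assms(8)])
    show "indicator A (c, b(i := v)) = (indicator A (c, b) :: ennreal)" if "a < i" for i c b v
      using A'[OF that] by (simp add: indicator_def)
  qed measurable
  also have "\<dots> = emeasure ?P A" using A by simp
  finally have "ennreal q * ennreal (measure ?P B) \<le> ennreal (measure ?P A)"
    by (simp add: emeasure_eq_measure)
  then have "q * measure ?P B \<le> measure ?P A"
    using assms(9) by (simp add: ennreal_mult[symmetric])
  then show "measure ?P B \<le> measure ?P A / q"
    using assms(9) by (simp add: field_simps)
qed

section \<open>Independent exploratory arms and a lower-tail Chernoff bound\<close>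

lemma nn_integral_arms:
  assumes "prob_space \<nu>" "0 < \<sigma>" "f \<in> borel_measurable (\<Pi>\<^sub>M t\<in>UNIV. \<nu>)"
  shows "(\<integral>\<^sup>+\<omega>. f (fst \<omega>) \<partial>sample_space \<nu> \<sigma>) = (\<integral>\<^sup>+a. f a \<partial>(\<Pi>\<^sub>M t\<in>UNIV. \<nu>))"
proof -
  interpret B: prob_space "\<Pi>\<^sub>M t\<in>(UNIV :: nat set). gauss \<sigma>" by (intro prob_space_PiM prob_space_gauss assms)
  have "(\<lambda>\<omega>. f (fst \<omega>)) \<in> borel_measurable ((\<Pi>\<^sub>M t\<in>(UNIV :: nat set). \<nu>) \<Otimes>\<^sub>M (\<Pi>\<^sub>M t\<in>(UNIV :: nat set). gauss \<sigma>))"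
    using assms(3) by measurable
  then show ?thesis
    unfolding sample_space_eq by (subst B.nn_integral_fst[symmetric]) (simp_all add: B.emeasure_space_1)
qed

lemma nn_integral_prod_iid:
  fixes g :: "'a \<Rightarrow> ennreal"
  assumes "prob_space \<nu>" and g[measurable]: "g \<in> borel_measurable \<nu>"
  shows "(\<integral>\<^sup>+a. (\<Prod>s<n. g (a (s + 1))) \<partial>(\<Pi>\<^sub>M t\<in>(UNIV :: nat set). \<nu>)) = (\<integral>\<^sup>+x. g x \<partial>\<nu>) ^ n"
proof (induction n)
  case 0
  interpret prob_space "\<Pi>\<^sub>M t\<in>(UNIV :: nat set). \<nu>" by (intro prob_space_PiM assms)
  show ?case by (simp add: emeasure_space_1)
next
  case (Suc n)
  let ?P = "\<Pi>\<^sub>M t\<in>(UNIV :: nat set). \<nu>"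
  have m[measurable]: "(\<lambda>a. \<Prod>s<n. g (a (s + 1))) \<in> borel_measurable ?P" for n
    by measurable
  have "(\<integral>\<^sup>+a. (\<Prod>s<Suc n. g (a (s + 1))) \<partial>?P)
      = (\<integral>\<^sup>+a. \<integral>\<^sup>+v. (\<Prod>s<Suc n. g ((a(n + 1 := v)) (s + 1))) \<partial>\<nu> \<partial>?P)"
    by (rule nn_integral_PiM_resample[OF assms(1) m])
  also have "\<dots> = (\<integral>\<^sup>+a. (\<Prod>s<n. g (a (s + 1))) * (\<integral>\<^sup>+v. g v \<partial>\<nu>) \<partial>?P)"
    by (intro nn_integral_cong) (simp add: nn_integral_cmult)
  also have "\<dots> = (\<integral>\<^sup>+v. g v \<partial>\<nu>) ^ n * (\<integral>\<^sup>+v. g v \<partial>\<nu>)"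
    using m Suc by (subst nn_integral_multc) auto
  finally show ?case by (simp add: mult.commute)
qed

lemma exp_minus_le:
  assumes "0 \<le> x" "x \<le> (1 :: real)"
  shows "exp (- x) \<le> 1 - x / 2"
proof -
  have "1 + x \<le> exp x" by (rule exp_ge_add_one_self)
  then have "exp (- x) \<le> 1 / (1 + x)" using assms by (simp add: exp_minus inverse_eq_divide frac_le)
  also have "1 / (1 + x) = 1 - x / (1 + x)" using assms by (simp add: field_simps)
  also have "\<dots> \<le> 1 - x / 2"
    using assms by (intro diff_left_mono divide_left_mono) auto
  finally show ?thesis .
qed

text \<open>Chernoff's method with parameter 1: as \<open>f\<close> takes values in the unit
  interval, exp (-f) has mean at most exp (-\<open>\<mu>\<close> / 2), and the threshold
  \<open>n * \<mu> / 4\<close> gives back half of the exponent.\<close>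

lemma measure_sum_iid_small_le:
  fixes f :: "vector \<Rightarrow> real" and n :: nat and \<mu> :: real
  assumes "prob_space \<nu>" "0 < \<sigma>" and f[measurable]: "f \<in> borel_measurable \<nu>"
    and f01: "AE x in \<nu>. 0 \<le> f x \<and> f x \<le> 1" and \<mu>: "\<mu> \<le> (\<integral>x. f x \<partial>\<nu>)"
  defines "B \<equiv> {\<omega> \<in> space (sample_space \<nu> \<sigma>). (\<Sum>s<n. f (fst \<omega> (s + 1))) < n * \<mu> / 4}"
  shows "B \<in> sets (sample_space \<nu> \<sigma>)" "measure (sample_space \<nu> \<sigma>) B \<le> exp (- n * \<mu> / 4)"
proof -
  let ?P = "sample_space \<nu> \<sigma>"
  interpret N: prob_space \<nu> by fact
  interpret prob_space ?P by (rule prob_space_sample_space[OF assms(1,2)])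
  have [measurable]: "(\<lambda>\<omega>. f (fst \<omega> i)) \<in> borel_measurable ?P" for i
    unfolding sample_space_eq by measurable
  show B[measurable]: "B \<in> sets ?P" unfolding B_def by measurable
  have int: "integrable \<nu> f"
    by (rule N.integrable_const_bound[of _ 1]) (use f01 in auto)
  have int': "integrable \<nu> (\<lambda>x. exp (- f x))"
    by (rule N.integrable_const_bound[of _ 1]) (use f01 in auto)
  have "(\<integral>x. exp (- f x) \<partial>\<nu>) \<le> (\<integral>x. 1 - f x / 2 \<partial>\<nu>)"
    using int int' f01 by (intro integral_mono_AE) (auto intro: exp_minus_le)
  also have "\<dots> = 1 - (\<integral>x. f x \<partial>\<nu>) / 2"
    using int by (simp add: N.prob_space)
  also have "\<dots> \<le> 1 + - (\<mu> / 2)" using \<mu> by simp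
  also have "\<dots> \<le> exp (- (\<mu> / 2))" by (rule exp_ge_add_one_self)
  finally have "(\<integral>\<^sup>+x. ennreal (exp (- f x)) \<partial>\<nu>) \<le> ennreal (exp (- (\<mu> / 2)))"
    using int' by (subst nn_integral_eq_integral) (auto intro: ennreal_leI)
  then have pow: "(\<integral>\<^sup>+x. ennreal (exp (- f x)) \<partial>\<nu>) ^ n \<le> ennreal (exp (- (\<mu> / 2))) ^ n"
    by (intro power_mono) auto
  have "emeasure ?P B = (\<integral>\<^sup>+\<omega>. indicator B \<omega> \<partial>?P)" by simp
  also have "\<dots> \<le> (\<integral>\<^sup>+\<omega>. ennreal (exp (n * \<mu> / 4)) * (\<Prod>s<n. ennreal (exp (- f (fst \<omega> (s + 1))))) \<partial>?P)"
  proof (intro nn_integral_mono)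
    fix \<omega>
    have "indicator B \<omega> \<le> exp (n * \<mu> / 4 + - (\<Sum>s<n. f (fst \<omega> (s + 1))))"
      by (auto simp: B_def split: split_indicator)
    also have "\<dots> = exp (n * \<mu> / 4) * (\<Prod>s<n. exp (- f (fst \<omega> (s + 1))))"
      by (simp only: exp_add exp_sum sum_negf[symmetric] finite_lessThan)
    finally have "ennreal (indicator B \<omega>) \<le> ennreal (exp (n * \<mu> / 4) * (\<Prod>s<n. exp (- f (fst \<omega> (s + 1)))))"
      by (rule ennreal_leI)
    then show "indicator B \<omega> \<le> ennreal (exp (n * \<mu> / 4)) * (\<Prod>s<n. ennreal (exp (- f (fst \<omega> (s + 1)))))"
      by (simp add: ennreal_mult prod_ennreal prod_nonneg ennreal_indicator)
  qed
  also have "\<dots> = ennreal (exp (n * \<mu> / 4)) * (\<integral>\<^sup>+\<omega>. (\<Prod>s<n. ennreal (exp (- f (fst \<omega> (s + 1))))) \<partial>?P)"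
    by (rule nn_integral_cmult) measurable
  also have "(\<integral>\<^sup>+\<omega>. (\<Prod>s<n. ennreal (exp (- f (fst \<omega> (s + 1))))) \<partial>?P) = (\<integral>\<^sup>+x. ennreal (exp (- f x)) \<partial>\<nu>) ^ n"
    using nn_integral_prod_iid[OF assms(1), of "\<lambda>x. ennreal (exp (- f x))" n]
    by (subst nn_integral_arms[OF assms(1,2), of "\<lambda>a. \<Prod>s<n. ennreal (exp (- f (a (s + 1))))"]) auto
  also have "ennreal (exp (n * \<mu> / 4)) * (\<integral>\<^sup>+x. ennreal (exp (- f x)) \<partial>\<nu>) ^ n
      \<le> ennreal (exp (n * \<mu> / 4)) * ennreal (exp (- (\<mu> / 2))) ^ n"
    using pow by (rule mult_left_mono) simp
  also have "\<dots> = ennreal (exp (- n * \<mu> / 4))"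
  proof -
    have "exp (n * \<mu> / 4) * exp (- (\<mu> / 2)) ^ n = exp (- n * \<mu> / 4)"
      unfolding exp_of_nat_mult[symmetric] exp_add[symmetric] by (simp add: field_simps)
    then show ?thesis by (simp add: ennreal_power ennreal_mult[symmetric])
  qed
  finally show "measure ?P B \<le> exp (- n * \<mu> / 4)"
    by (simp add: emeasure_eq_measure)
qed

section \<open>A lattice net of the unit sphere\<close>

text \<open>Comparison with 1 plus twice the geometric series of ratio 1/2, as exp (-1) is at most
  1/2.\<close>

lemma sum_exp_abs_int_le: "(\<Sum>j\<in>{- int N..int N}. exp (- real_of_int \<bar>j\<bar>)) \<le> 3 - 2 * (1 / 2) ^ N"
proof (induction N)
  case (Suc N)
  have "{- int (Suc N)..int (Suc N)} = insert (int (Suc N)) (insert (- int (Suc N)) {- int N..int N})" by auto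
  then have "(\<Sum>j\<in>{- int (Suc N)..int (Suc N)}. exp (- real_of_int \<bar>j\<bar>))
      = 2 * exp (- real (Suc N)) + (\<Sum>j\<in>{- int N..int N}. exp (- real_of_int \<bar>j\<bar>))"
    by simp
  also have "exp (- real (Suc N)) \<le> (1 / 2) ^ Suc N"
  proof -
    have "exp (- real (Suc N)) = exp (- 1) ^ Suc N" by (subst exp_of_nat_mult[symmetric]) simp
    also have "\<dots> \<le> (1 / 2) ^ Suc N"
      using exp_minus_le[of 1] by (intro power_mono) auto
    finally show ?thesis .
  qed
  finally show ?case using Suc by simp
qed simp

text \<open>Rounding the coordinates of a unit vector to a lattice of mesh
  \<open>h = \<epsilon> / sqrt k\<close> moves it by at most \<open>\<epsilon>\<close>. The integer
  coordinates have absolute sum at most \<open>R = k / \<epsilon> + k\<close>, because those of the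
  unit vector sum to at most \<open>sqrt k\<close>. Counting lattice points with this constraint
  takes the place of a volume argument.\<close>

lemma sphere_net:
  assumes "onb d E M" "E \<noteq> {}" "0 < \<epsilon>"
  obtains F where "finite F" "F \<subseteq> M" "real (card F) \<le> exp (card E / \<epsilon> + card E) * 3 ^ card E"
    "\<And>v. v \<in> M \<Longrightarrow> sqnorm d v = 1 \<Longrightarrow> \<exists>u\<in>F. sqnorm d (v - u) \<le> \<epsilon>\<^sup>2"
proof -
  note ED = onbD[OF assms(1)]
  define k where "k = card E"
  have k: "0 < k" using ED(1) assms(2) by (simp add: k_def card_gt_0_iff)
  define h where "h = \<epsilon> / sqrt k"
  have h: "0 < h" using k assms(3) by (simp add: h_def)
  define R where "R = k / \<epsilon> + k"
  define N where "N = nat \<lceil>R\<rceil>"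
  have R0: "0 \<le> R" using assms(3) by (simp add: R_def)
  have RN: "R \<le> N" unfolding N_def by (rule real_nat_ceiling_ge)
  define G where "G = {z \<in> PiE E (\<lambda>_. {- int N..int N}). (\<Sum>e\<in>E. real_of_int \<bar>z e\<bar>) \<le> R}"
  define F where "F = (\<lambda>z. \<Sum>e\<in>E. (h * real_of_int (z e)) *\<^sub>R e) ` G"
  have finG: "finite G" by (rule finite_subset[of _ "PiE E (\<lambda>_. {- int N..int N})"]) (use ED(1) in \<open>auto simp: G_def intro!: finite_PiE\<close>)
  have "real (card G) = (\<Sum>z\<in>G. 1)" by simp
  \<comment> \<open>The weight is at least 1 on \<open>G\<close>, and over all lattice points of the
    box it factorises into one-dimensional sums.\<close>
  also have "\<dots> \<le> (\<Sum>z\<in>G. exp (R - (\<Sum>e\<in>E. real_of_int \<bar>z e\<bar>)))"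
    by (intro sum_mono) (auto simp: G_def)
  also have "\<dots> \<le> (\<Sum>z\<in>PiE E (\<lambda>_. {- int N..int N}). exp (R - (\<Sum>e\<in>E. real_of_int \<bar>z e\<bar>)))"
    using ED(1) by (intro sum_mono2) (auto simp: G_def intro: finite_PiE)
  also have "\<dots> = (\<Sum>z\<in>PiE E (\<lambda>_. {- int N..int N}). exp R * (\<Prod>e\<in>E. exp (- real_of_int \<bar>z e\<bar>)))"
    using ED(1) by (intro sum.cong refl) (simp add: exp_diff exp_minus exp_sum divide_inverse prod_inversef[symmetric])
  also have "\<dots> = exp R * (\<Sum>z\<in>PiE E (\<lambda>_. {- int N..int N}). \<Prod>e\<in>E. exp (- real_of_int \<bar>z e\<bar>))"
    by (simp add: sum_distrib_left)
  also have "(\<Sum>z\<in>PiE E (\<lambda>_. {- int N..int N}). \<Prod>e\<in>E. exp (- real_of_int \<bar>z e\<bar>))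
      = (\<Prod>e\<in>E. \<Sum>j\<in>{- int N..int N}. exp (- real_of_int \<bar>j\<bar>))"
    using ED(1) by (subst prod_sum_PiE) auto
  also have "\<dots> \<le> (\<Prod>e\<in>E. 3)"
  proof (intro prod_mono conjI sum_nonneg)
    have "(0 :: real) \<le> 2 * (1 / 2) ^ N" by simp
    then show "(\<Sum>j\<in>{- int N..int N}. exp (- real_of_int \<bar>j\<bar>)) \<le> 3" using sum_exp_abs_int_le[of N] by linarith
  qed auto
  finally have "real (card G) \<le> exp R * 3 ^ k" by (simp add: k_def)
  moreover have "card F \<le> card G" unfolding F_def by (rule card_image_le[OF finG])
  ultimately have "real (card F) \<le> exp (card E / \<epsilon> + card E) * 3 ^ card E"
    by (simp add: R_def k_def)
  moreover have "finite F" using finG by (simp add: F_def)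
  moreover have "F \<subseteq> M" unfolding F_def using ED by (auto intro!: subspace_sum subspace_scale)
  moreover have "\<exists>u\<in>F. sqnorm d (v - u) \<le> \<epsilon>\<^sup>2" if v: "v \<in> M" "sqnorm d v = 1" for v
  proof -
    define z where "z = restrict (\<lambda>e. \<lfloor>dot d v e / h\<rfloor>) E"
    define u where "u = (\<Sum>e\<in>E. (h * real_of_int (z e)) *\<^sub>R e)"
    have ze: "\<bar>dot d v e / h - real_of_int (z e)\<bar> \<le> 1" if "e \<in> E" for e
      using that unfolding z_def by simp linarith
    have "(\<Sum>e\<in>E. \<bar>dot d v e\<bar> * 1)\<^sup>2 \<le> (\<Sum>e\<in>E. \<bar>dot d v e\<bar>\<^sup>2) * (\<Sum>e\<in>E. 1\<^sup>2)"
      by (rule Cauchy_Schwarz_ineq_sum)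
    also have "\<dots> = k" using v sqnorm_onb[OF assms(1) v(1)] by (simp add: k_def)
    finally have a1: "(\<Sum>e\<in>E. \<bar>dot d v e\<bar>) \<le> sqrt k" by (intro real_le_rsqrt) simp
    have "(\<Sum>e\<in>E. real_of_int \<bar>z e\<bar>) \<le> (\<Sum>e\<in>E. \<bar>dot d v e\<bar> / h + 1)"
    proof (rule sum_mono)
      fix e assume "e \<in> E"
      from ze[OF this] have "\<bar>real_of_int (z e)\<bar> \<le> \<bar>dot d v e / h\<bar> + 1" by linarith
      then show "real_of_int \<bar>z e\<bar> \<le> \<bar>dot d v e\<bar> / h + 1" using h by simp
    qed
    also have "\<dots> = (\<Sum>e\<in>E. \<bar>dot d v e\<bar>) / h + k" by (simp add: sum.distrib sum_divide_distrib k_def)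
    also have "\<dots> \<le> sqrt k / h + k" using a1 h by (simp add: divide_right_mono)
    also have "\<dots> = R" using k assms(3) by (simp add: R_def h_def)
    finally have zR: "(\<Sum>e\<in>E. real_of_int \<bar>z e\<bar>) \<le> R" .
    have "z e \<in> {- int N..int N}" if "e \<in> E" for e
    proof -
      have "real_of_int \<bar>z e\<bar> \<le> (\<Sum>e\<in>E. real_of_int \<bar>z e\<bar>)"
        using that ED(1) by (intro member_le_sum) auto
      also have "\<dots> \<le> N" using zR RN by linarith
      finally show ?thesis by auto
    qed
    then have "z \<in> G" unfolding G_def using zR by (auto simp: PiE_iff z_def)
    then have uF: "u \<in> F" unfolding F_def u_def by (rule imageI)
    have "v - u = (\<Sum>e\<in>E. (dot d v e - h * real_of_int (z e)) *\<^sub>R e)"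
      unfolding u_def by (subst ED(6)[OF v(1), symmetric]) (simp add: scaleR_diff_left sum_subtractf)
    then have du: "dot d (v - u) e = dot d v e - h * real_of_int (z e)" if "e \<in> E" for e
      using dot_onb_sum[OF ED(1,5) that] by simp
    have "v - u \<in> M" using v(1) uF \<open>F \<subseteq> M\<close> ED(2) by (auto intro: subspace_diff)
    then have "sqnorm d (v - u) = (\<Sum>e\<in>E. (dot d v e - h * real_of_int (z e))\<^sup>2)"
      unfolding sqnorm_onb[OF assms(1) \<open>v - u \<in> M\<close>] using du by simp
    also have "\<dots> \<le> (\<Sum>e\<in>E. h\<^sup>2)"
    proof (rule sum_mono)
      fix e assume e: "e \<in> E"
      have "dot d v e - h * real_of_int (z e) = h * (dot d v e / h - real_of_int (z e))"
        using h by (simp add: field_simps)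
      then have "\<bar>dot d v e - h * real_of_int (z e)\<bar> \<le> h * 1"
        using ze[OF e] h by (simp only: abs_mult) (intro mult_mono, auto)
      then show "(dot d v e - h * real_of_int (z e))\<^sup>2 \<le> h\<^sup>2" using h by (subst abs_le_square_iff[symmetric]) simp
    qed
    also have "\<dots> = \<epsilon>\<^sup>2" using k by (simp add: h_def power_divide k_def)
    finally show ?thesis using uF by blast
  qed
  ultimately show ?thesis using that by blast
qed

section \<open>The smallest eigenvalue of the second moment matrix\<close>

text \<open>A closed subset of the cube of all sequences with entries between -1 and 1, compact in
  the product topology by Tychonoff.\<close>

lemma compact_unit_sphere: "compact {v \<in> euclid d. sqnorm d v = 1}"
proof -
  let ?K = "PiE UNIV (\<lambda>_. {- 1..1}) :: vector set"
  have "compactin (product_topology (\<lambda>_. euclidean) UNIV) ?K"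
    by (subst compactin_PiE) auto
  then have K: "compact ?K" by (simp add: euclidean_product_topology compactin_euclidean_iff)
  have cont: "continuous_on UNIV (\<lambda>v :: vector. v i)" for i by simp
  have "closed {v :: vector. \<forall>i. i \<notin> {1..d} \<longrightarrow> v i = 0}"
    by (intro closed_Collect_all closed_Collect_imp open_Collect_const closed_Collect_eq cont continuous_on_const)
  moreover have "closed {v. sqnorm d v = 1}"
    unfolding sqnorm_def dot_def
    by (intro closed_Collect_eq continuous_on_sum continuous_on_mult cont continuous_on_const)
  ultimately have "closed ({v :: vector. \<forall>i. i \<notin> {1..d} \<longrightarrow> v i = 0} \<inter> {v. sqnorm d v = 1})"
    by (rule closed_Int)
  moreover have "{v \<in> euclid d. sqnorm d v = 1} = ?K \<inter> ({v. \<forall>i. i \<notin> {1..d} \<longrightarrow> v i = 0} \<inter> {v. sqnorm d v = 1})"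
  proof -
    have "v i \<in> {- 1..1}" if "v \<in> euclid d" "sqnorm d v = 1" for v i
    proof (cases "i \<in> {1..d}")
      case True
      then have "v i * v i \<le> (\<Sum>i=1..d. v i * v i)"
        by (intro member_le_sum[of i "{1..d}" "\<lambda>i. v i * v i"]) auto
      then have "(v i)\<^sup>2 \<le> 1" using that by (simp add: sqnorm_def dot_def power2_eq_square)
      then show ?thesis by (simp add: abs_square_le_1 abs_le_iff)
    next
      case False then show ?thesis using that by (simp add: euclid_def)
    qed
    then show ?thesis by (auto simp: euclid_def PiE_iff)
  qed
  ultimately show ?thesis using compact_Int_closed[OF K] by simp
qed

text \<open>Since \<open>lambda_min\<close> is the least eigenvalue, the minimum
  \<open>\<mu>\<close> of the quadratic form on the unit sphere has to be shown to be an eigenvalue.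
  A minimiser \<open>u\<close> exists by compactness, and vanishing of the first variation in all
  directions says that \<open>u\<close> is an eigenvector.\<close>

lemma lambda_min_le:
  fixes A :: "real mat"
  assumes A: "A \<in> carrier_mat d d" and sym: "\<And>i j. i < d \<Longrightarrow> j < d \<Longrightarrow> A $$ (i, j) = A $$ (j, i)"
    and v: "v \<in> euclid d"
  shows "lambda_min A * sqnorm d v \<le> (\<Sum>i<d. \<Sum>j<d. v (Suc i) * A $$ (i, j) * v (Suc j))"
proof -
  define Bf where "Bf u w = (\<Sum>i<d. \<Sum>j<d. u (Suc i) * A $$ (i, j) * w (Suc j))" for u w :: vector
  have Bsym: "Bf u w = Bf w u" for u w
    unfolding Bf_def by (subst sum.swap) (intro sum.cong refl, auto simp: sym mult_ac)
  have Badd: "Bf (u + s *\<^sub>R w) (u + s *\<^sub>R w) = Bf u u + 2 * s * Bf u w + s\<^sup>2 * Bf w w" for u w s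
  proof -
    have "Bf (u + s *\<^sub>R w) (u + s *\<^sub>R w) = Bf u u + s * Bf u w + s * Bf w u + s\<^sup>2 * Bf w w"
      unfolding Bf_def vector_apply
      by (simp add: algebra_simps power2_eq_square sum.distrib sum_distrib_left)
    then show ?thesis by (simp add: Bsym[of w u])
  qed
  have Bscale: "Bf (s *\<^sub>R w) (s *\<^sub>R w) = s\<^sup>2 * Bf w w" for s w
    unfolding Bf_def vector_apply by (simp add: power2_eq_square sum_distrib_left mult_ac)
  let ?S = "{v \<in> euclid d. sqnorm d v = 1}"
  show ?thesis
  proof (cases "v = 0")
    case True
    then show ?thesis by (simp add: vector_apply)
  next
    case False
    then have nv: "0 < sqnorm d v" using sqnorm_eq_0_iff[OF v] sqnorm_nonneg[of d v] by linarith
    have unit: "(1 / sqrt (sqnorm d w)) *\<^sub>R w \<in> ?S" if "w \<in> euclid d" "0 < sqnorm d w" for w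
      using that by (simp add: power_one_over)
    have "continuous_on ?S (\<lambda>w. Bf w w)"
      unfolding Bf_def
      by (intro continuous_on_sum continuous_on_mult continuous_on_const continuous_on_subset[OF continuous_on_product_coordinates subset_UNIV])
    then obtain u where u: "u \<in> ?S" "\<And>w. w \<in> ?S \<Longrightarrow> Bf u u \<le> Bf w w"
      using continuous_attains_inf[OF compact_unit_sphere, of d "\<lambda>w. Bf w w"] unit[OF v nv] by blast
    define \<mu> where "\<mu> = Bf u u"
    have ge: "\<mu> * sqnorm d w \<le> Bf w w" if w: "w \<in> euclid d" for w
    proof (cases "sqnorm d w = 0")
      case True
      then have "w = 0" using sqnorm_eq_0_iff[OF w] by simp
      then show ?thesis unfolding Bf_def by (simp add: vector_apply)
    next
      case False
      then have p: "0 < sqnorm d w" using sqnorm_nonneg[of d w] by linarith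
      have "\<mu> \<le> (1 / sqrt (sqnorm d w))\<^sup>2 * Bf w w"
        using u(2)[OF unit[OF w p]] unfolding Bscale \<mu>_def .
      then show ?thesis using p by (simp add: power_one_over field_simps)
    qed
    have crit: "Bf u w = \<mu> * dot d u w" if w: "w \<in> euclid d" for w
    proof -
      define c where "c = Bf u w - \<mu> * dot d u w"
      define e where "e = Bf w w - \<mu> * sqnorm d w"
      have e: "0 \<le> e" using ge[OF w] by (simp add: e_def)
      have q: "0 \<le> 2 * s * c + s\<^sup>2 * e" for s
      proof -
        have "u + s *\<^sub>R w \<in> euclid d" using u(1) w by simp
        from ge[OF this] have "\<mu> * (sqnorm d u + 2 * (s * dot d u w) + s\<^sup>2 * sqnorm d w) \<le> Bf u u + 2 * s * Bf u w + s\<^sup>2 * Bf w w"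
          unfolding Badd sqnorm_add by simp
        then show ?thesis using u(1) by (simp add: \<mu>_def c_def e_def algebra_simps)
      qed
      have "c = 0"
      proof (rule ccontr)
        assume "c \<noteq> 0"
        then have "0 < c\<^sup>2" by simp
        \<comment> \<open>The minimiser of the quadratic would be \<open>- c / e\<close>;
          \<open>e + 1\<close> avoids division by zero and still gives a negative value.\<close>
        have "0 \<le> 2 * (- c / (e + 1)) * c + (- c / (e + 1))\<^sup>2 * e" by (rule q)
        also have "(- c / (e + 1))\<^sup>2 * e = (c\<^sup>2 / (e + 1)) * (e / (e + 1))"
          by (simp add: power2_eq_square)
        also have "2 * (- c / (e + 1)) * c + (c\<^sup>2 / (e + 1)) * (e / (e + 1)) = (c\<^sup>2 / (e + 1)) * (e / (e + 1) - 2)"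
          by (simp add: power2_eq_square right_diff_distrib)
        also have "\<dots> < 0"
        proof (rule mult_pos_neg)
          have "e / (e + 1) \<le> 1" using e by simp
          then show "e / (e + 1) - 2 < 0" by linarith
        qed (use e \<open>0 < c\<^sup>2\<close> in auto)
        finally show False by simp
      qed
      then show ?thesis by (simp add: c_def)
    qed
    have "eigenvector A (to_vec d u) \<mu>"
      unfolding eigenvector_def
    proof (intro conjI)
      show "to_vec d u \<in> carrier_vec (dim_row A)" using A by (simp add: to_vec_def)
      show "to_vec d u \<noteq> 0\<^sub>v (dim_row A)"
      proof
        assume 0: "to_vec d u = 0\<^sub>v (dim_row A)"
        have "u (Suc i) = 0" if "i < d" for i
          using arg_cong[OF 0, of "\<lambda>x. x $ i"] that A by (simp add: to_vec_def)
        then have "sqnorm d u = 0" by (simp add: sqnorm_def dot_eq_sum_lessThan)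
        then show False using u(1) by simp
      qed
      show "A *\<^sub>v to_vec d u = \<mu> \<cdot>\<^sub>v to_vec d u"
      proof (rule eq_vecI)
        fix i assume "i < dim_vec (\<mu> \<cdot>\<^sub>v to_vec d u)"
        then have i: "i < d" by (simp add: to_vec_def)
        \<comment> \<open>Testing the first variation on a unit vector reads off one coordinate of
          the eigenvector equation.\<close>
        define w :: vector where "w = (\<lambda>j. if j = Suc i then 1 else 0)"
        have w: "w \<in> euclid d" using i by (auto simp: w_def euclid_def)
        have "Bf w u = (\<Sum>j<d. A $$ (i, j) * u (Suc j))"
        proof -
          have "Bf w u = (\<Sum>i'<d. if i' = i then (\<Sum>j<d. A $$ (i', j) * u (Suc j)) else 0)"
            unfolding Bf_def by (intro sum.cong refl) (simp add: w_def)
          with i show ?thesis by simp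
        qed
        moreover have "dot d u w = u (Suc i)"
          unfolding dot_eq_sum_lessThan w_def using i by (simp add: if_distrib cong: if_cong)
        ultimately show "(A *\<^sub>v to_vec d u) $ i = (\<mu> \<cdot>\<^sub>v to_vec d u) $ i"
          using crit[OF w] Bsym[of u w] i A by (simp add: to_vec_def scalar_prod_def atLeast0LessThan)
      qed (use A in \<open>simp add: to_vec_def\<close>)
    qed
    then have ev: "eigenvalue A \<mu>" unfolding eigenvalue_def by blast
    have "char_poly A \<noteq> 0" using degree_monic_char_poly[OF A] by auto
    then have "finite {k. eigenvalue A k}"
      using poly_roots_finite by (simp add: eigenvalue_root_char_poly[OF A])
    then have "lambda_min A \<le> \<mu>" unfolding lambda_min_def using ev by (intro Min_le) auto
    then have "lambda_min A * sqnorm d v \<le> \<mu> * sqnorm d v" by (intro mult_right_mono) auto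
    also have "\<dots> \<le> Bf v v" by (rule ge[OF v])
    finally show ?thesis by (simp add: Bf_def)
  qed
qed

lemma lambda_min_second_moment_le:
  assumes "arm_distribution d X \<nu>" "v \<in> euclid d"
  shows "lambda_min (second_moment d \<nu>) * sqnorm d v \<le> (\<integral>x. (dot d x v)\<^sup>2 \<partial>\<nu>)"
    and "integrable \<nu> (\<lambda>x. (dot d x v)\<^sup>2)"
proof -
  have int: "integrable \<nu> (\<lambda>x. x (Suc i) * x (Suc j))" if "i < d" "j < d" for i j
    using assms(1) that by (auto simp: arm_distribution_def)
  have eq: "(dot d x v)\<^sup>2 = (\<Sum>i<d. \<Sum>j<d. v (Suc i) * v (Suc j) * (x (Suc i) * x (Suc j)))" for x
    unfolding dot_eq_sum_lessThan power2_eq_square sum_product by (intro sum.cong refl) simp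
  show "integrable \<nu> (\<lambda>x. (dot d x v)\<^sup>2)"
    unfolding eq using int by (intro Bochner_Integration.integrable_sum integrable_mult_right) auto
  have "(\<integral>x. (dot d x v)\<^sup>2 \<partial>\<nu>) = (\<Sum>i<d. \<Sum>j<d. v (Suc i) * v (Suc j) * (\<integral>x. x (Suc i) * x (Suc j) \<partial>\<nu>))"
    unfolding eq using int
    by (subst Bochner_Integration.integral_sum; (intro Bochner_Integration.integrable_sum integrable_mult_right)?)
      (auto intro!: sum.cong Bochner_Integration.integral_sum simp: Bochner_Integration.integral_sum)
  also have "\<dots> = (\<Sum>i<d. \<Sum>j<d. v (Suc i) * second_moment d \<nu> $$ (i, j) * v (Suc j))"
    by (intro sum.cong refl) (simp add: second_moment_def)
  finally show "lambda_min (second_moment d \<nu>) * sqnorm d v \<le> (\<integral>x. (dot d x v)\<^sup>2 \<partial>\<nu>)"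
    using lambda_min_le[of "second_moment d \<nu>" d v] assms(2) by (simp add: second_moment_def mult.commute)
qed

section \<open>Fixed-point subspaces\<close>

definition class_vec :: "nat set \<Rightarrow> vector" where
  "class_vec c = (\<lambda>i. if i \<in> c then 1 else 0)"

text \<open>An element is the combination of the class indicators with its common values as
  coefficients. The use is a bound on the dimension by the number of classes.\<close>

lemma fixed_space_eq_span:
  assumes p: "partition_on {1..d} p"
  shows "fixed_space d p = span (class_vec ` p)"
proof
  have fin: "finite p" using p finite_elements finite_atLeastAtMost by blast
  show "fixed_space d p \<subseteq> span (class_vec ` p)"
  proof
    fix v assume v: "v \<in> fixed_space d p"
    define r where "r c = v (SOME i. i \<in> c)" for c
    have rc: "v i = r c" if "c \<in> p" "i \<in> c" for c i
    proof -
      have "(SOME i. i \<in> c) \<in> c" by (rule someI[of "\<lambda>i. i \<in> c", OF that(2)])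
      then show ?thesis using v that unfolding r_def fixed_space_def by blast
    qed
    have "v = (\<Sum>c\<in>p. r c *\<^sub>R class_vec c)"
    proof
      fix i
      show "v i = (\<Sum>c\<in>p. r c *\<^sub>R class_vec c) i"
      proof (cases "i \<in> {1..d}")
        case True
        then obtain c where c: "c \<in> p" "i \<in> c" using p unfolding partition_on_def by blast
        have "(\<Sum>c'\<in>p. r c' *\<^sub>R class_vec c') i = (\<Sum>c'\<in>p. if c' = c then r c' else 0)"
          unfolding sum_fun_apply scaleR_fun_apply class_vec_def
          using p c by (intro sum.cong refl) (auto simp: partition_on_def disjoint_def)
        then show ?thesis using c fin rc by simp
      next
        case False
        then have "i \<notin> c" if "c \<in> p" for c using p that unfolding partition_on_def by blast
        then have "(\<Sum>c\<in>p. r c *\<^sub>R class_vec c) i = 0"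
          unfolding sum_fun_apply scaleR_fun_apply class_vec_def by simp
        then show ?thesis using v False by (simp add: fixed_space_def euclid_def)
      qed
    qed
    moreover have "(\<Sum>c\<in>p. r c *\<^sub>R class_vec c) \<in> span (class_vec ` p)"
      by (intro span_sum span_scale span_base imageI)
    ultimately show "v \<in> span (class_vec ` p)" by (simp only:)
  qed
  have fsI: "v \<in> fixed_space d p"
    if "v \<in> euclid d" "\<And>c i j. c \<in> p \<Longrightarrow> i \<in> c \<Longrightarrow> j \<in> c \<Longrightarrow> v i = v j" for v
    unfolding fixed_space_def using that by blast
  have fsD: "v i = v j" if "v \<in> fixed_space d p" "c \<in> p" "i \<in> c" "j \<in> c" for v c i j
    using that unfolding fixed_space_def by blast
  have fsE: "v \<in> euclid d" if "v \<in> fixed_space d p" for v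
    using that unfolding fixed_space_def by blast
  have "subspace (fixed_space d p)"
  proof (rule subspaceI)
    show "0 \<in> fixed_space d p" by (rule fsI) (simp_all add: vector_apply)
    show "x + y \<in> fixed_space d p" if "x \<in> fixed_space d p" "y \<in> fixed_space d p" for x y
      by (rule fsI) (use that in \<open>simp_all only: vector_apply euclid_closed fsE\<close>, metis fsD)
    show "r *\<^sub>R x \<in> fixed_space d p" if "x \<in> fixed_space d p" for x r
      by (rule fsI) (use that in \<open>simp_all only: vector_apply euclid_closed fsE\<close>, metis fsD)
  qed
  moreover have "class_vec ` p \<subseteq> fixed_space d p"
  proof
    fix v assume "v \<in> class_vec ` p"
    then obtain c where c: "c \<in> p" "v = class_vec c" by auto
    have "class_vec c \<in> euclid d" using p c unfolding class_vec_def euclid_def partition_on_def by auto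
    moreover have "class_vec c i = class_vec c j" if "c' \<in> p" "i \<in> c'" "j \<in> c'" for c' i j
      using p c(1) that unfolding class_vec_def partition_on_def disjoint_def by auto
    ultimately show "v \<in> fixed_space d p" unfolding fixed_space_def c(2) by blast
  qed
  ultimately show "span (class_vec ` p) \<subseteq> fixed_space d p" by (simp add: span_minimal)
qed

lemma fixed_space_subset_euclid: "fixed_space d p \<subseteq> euclid d"
  by (auto simp: fixed_space_def)

lemma class_vec_subset_euclid:
  assumes "partition_on {1..d} p"
  shows "class_vec ` p \<subseteq> euclid d"
proof -
  have "class_vec ` p \<subseteq> span (class_vec ` p)" by (rule span_superset)
  also have "\<dots> \<subseteq> euclid d"
    unfolding fixed_space_eq_span[OF assms, symmetric] by (rule fixed_space_subset_euclid)
  finally show ?thesis .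
qed

lemma onb_fixed_space:
  assumes "partition_on {1..d} p"
  obtains E where "onb d E (fixed_space d p)" "card E \<le> card p"
proof -
  have fin: "finite p" using assms finite_elements finite_atLeastAtMost by blast
  obtain E where "onb d E (span (class_vec ` p))" "card E \<le> card (class_vec ` p)"
    using onb_exists[OF _ class_vec_subset_euclid[OF assms]] fin by auto
  moreover have "card (class_vec ` p) \<le> card p" by (rule card_image_le[OF fin])
  ultimately show ?thesis using that fixed_space_eq_span[OF assms] by simp
qed

text \<open>An element \<open>x + y\<close> of the sum is the midpoint of
  \<open>2 *\<^sub>R x\<close> and \<open>2 *\<^sub>R y\<close>, which lie in the two
  subspaces.\<close>

lemma convex_hull_Un_subspace:
  fixes S T :: "'a::real_vector set"
  assumes "subspace S" "subspace T"
  shows "convex hull (S \<union> T) = span (S \<union> T)"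
proof
  show "convex hull (S \<union> T) \<subseteq> span (S \<union> T)"
    by (intro hull_minimal span_superset subspace_imp_convex subspace_span)
  show "span (S \<union> T) \<subseteq> convex hull (S \<union> T)"
  proof
    fix v assume "v \<in> span (S \<union> T)"
    moreover have "span S = S" "span T = T" using assms by (simp_all only: span_eq_iff)
    ultimately obtain x y where xy: "v = x + y" "x \<in> S" "y \<in> T"
      unfolding span_Un by blast
    have "2 *\<^sub>R x \<in> convex hull (S \<union> T)" "2 *\<^sub>R y \<in> convex hull (S \<union> T)"
      using xy assms by (auto intro!: hull_inc subspace_scale)
    then have "(1 / 2) *\<^sub>R (2 *\<^sub>R x) + (1 / 2) *\<^sub>R (2 *\<^sub>R y) \<in> convex hull (S \<union> T)"
      by (intro convexD[OF convex_convex_hull]) auto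
    then show "v \<in> convex hull (S \<union> T)" using xy by simp
  qed
qed

lemma onb_convex_hull_fixed_spaces:
  assumes p: "partition_on {1..d} p" and q: "partition_on {1..d} q"
  obtains E where "onb d E (convex hull (fixed_space d p \<union> fixed_space d q))" "card E \<le> card p + card q"
proof -
  have fin: "finite p" "finite q" using p q finite_elements finite_atLeastAtMost by blast+
  let ?F = "class_vec ` p \<union> class_vec ` q"
  have sub: "?F \<subseteq> euclid d"
    using class_vec_subset_euclid[OF p] class_vec_subset_euclid[OF q] by blast
  have "span (span (class_vec ` p) \<union> span (class_vec ` q)) = span ?F"
    by (simp only: span_Un span_span)
  then have "convex hull (fixed_space d p \<union> fixed_space d q) = span ?F"
    unfolding fixed_space_eq_span[OF p] fixed_space_eq_span[OF q]
    by (subst convex_hull_Un_subspace) (auto simp: subspace_span)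
  moreover obtain E where "onb d E (span ?F)" "card E \<le> card ?F"
    using onb_exists[OF _ sub] fin by auto
  moreover have "card ?F \<le> card p + card q"
    using card_Un_le[of "class_vec ` p" "class_vec ` q"] card_image_le[OF fin(1), of class_vec] card_image_le[OF fin(2), of class_vec]
    by linarith
  ultimately show ?thesis using that by auto
qed

section \<open>Residuals\<close>

definition predictions :: "nat \<Rightarrow> history \<Rightarrow> vector \<Rightarrow> vector" where
  "predictions d h \<beta> = (\<lambda>t. if t \<in> {1..length h} then dot d (fst (h ! (t - 1))) \<beta> else 0)"

lemma sqnorm_rewards_predictions:
  "sqnorm (length h) (rewards h - predictions d h \<beta>) = (\<Sum>p\<leftarrow>h. (snd p - dot d (fst p) \<beta>)\<^sup>2)"
  unfolding sqnorm_def dot_eq_sum_lessThan[of "length h"]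
  by (simp add: vector_apply rewards_def predictions_def sum_list_sum_nth atLeast0LessThan power2_eq_square)

text \<open>Turns distances to the column space into sums of squared prediction errors. As
  projections are self-adjoint, the column with index \<open>i\<close> is the prediction vector of
  the projected unit vector \<open>i\<close>.\<close>

lemma column_space_eq_predictions:
  assumes "onb d E m"
  shows "column_space d m h = predictions d h ` m"
proof
  note ED = onbD[OF assms]
  have lin: "predictions d h (a + b) = predictions d h a + predictions d h b"
    "predictions d h (r *\<^sub>R a) = r *\<^sub>R predictions d h a" "predictions d h 0 = 0" for a b r
    by (auto simp: predictions_def vector_apply fun_eq_iff)
  have "subspace (predictions d h ` m)"
    unfolding subspace_def
  proof (intro conjI ballI allI)
    show "0 \<in> predictions d h ` m" by (rule image_eqI[where x=0]) (simp_all only: lin subspace_0[OF ED(2)])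
  next
    fix x y assume "x \<in> predictions d h ` m" "y \<in> predictions d h ` m"
    then obtain a b where "a \<in> m" "b \<in> m" "x = predictions d h a" "y = predictions d h b" by blast
    then show "x + y \<in> predictions d h ` m"
      using subspace_add[OF ED(2)] by (intro image_eqI[of _ _ "a + b"]) (simp_all only: lin)
  next
    fix c x assume "x \<in> predictions d h ` m"
    then obtain a where "a \<in> m" "x = predictions d h a" by blast
    then show "c *\<^sub>R x \<in> predictions d h ` m"
      using subspace_scale[OF ED(2)] by (intro image_eqI[of _ _ "c *\<^sub>R a"]) (simp_all only: lin)
  qed
  moreover have "projected_column d m h i \<in> predictions d h ` m" if "i \<in> {1..d}" for i
  proof -
    define w :: vector where "w = (\<lambda>j. if j = i then 1 else 0)"
    have "dot d y w = y i" for y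
      unfolding dot_def w_def using that by (simp add: if_distrib cong: if_cong)
    then have "proj d m x i = dot d x (proj d m w)" for x
      using proj_commute[OF assms, of x w] by simp
    then have "projected_column d m h i = predictions d h (proj d m w)"
      unfolding projected_column_def predictions_def by (simp add: fun_eq_iff)
    then show ?thesis using proj_mem[OF assms] by blast
  qed
  ultimately show "column_space d m h \<subseteq> predictions d h ` m"
    unfolding column_space_def by (intro span_minimal) auto
  show "predictions d h ` m \<subseteq> column_space d m h"
  proof
    fix v assume "v \<in> predictions d h ` m"
    then obtain \<beta> where b: "\<beta> \<in> m" "v = predictions d h \<beta>" by auto
    have "v = (\<Sum>i=1..d. \<beta> i *\<^sub>R projected_column d m h i)"
    proof
      fix t
      have "dot d x \<beta> = (\<Sum>i=1..d. \<beta> i * proj d m x i)" for x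
        using dot_proj_left[OF assms b(1), of x] by (simp add: dot_def mult.commute)
      then show "v t = (\<Sum>i=1..d. \<beta> i *\<^sub>R projected_column d m h i) t"
        unfolding b(2)
        by (cases "t \<in> {1..length h}") (simp_all only: predictions_def projected_column_def sum_fun_apply
            vector_apply real_scaleR_def if_True if_False mult_zero_right sum.neutral_const)
    qed
    also have "\<dots> \<in> column_space d m h"
      unfolding column_space_def by (intro span_sum span_scale span_base) auto
    finally show "v \<in> column_space d m h" .
  qed
qed

lemma sqnorm_diff_proj_le:
  assumes "onb d E M" "z \<in> M"
  shows "sqnorm d (x - proj d M x) \<le> sqnorm d (x - z)"
proof -
  let ?p = "proj d M x"
  have pz: "?p - z \<in> M" using proj_mem[OF assms(1)] assms(2) onbD(2)[OF assms(1)] by (simp add: subspace_diff)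
  have "dot d (x - ?p) (?p - z) = 0" using dot_proj_left[OF assms(1) pz, of x]
    by (simp only: dot_linear(2) diff_self)
  moreover have "sqnorm d (x - z) = sqnorm d ((x - ?p) + (?p - z))" by simp
  ultimately show ?thesis using sqnorm_nonneg[of d "?p - z"] by (simp only: sqnorm_add)
qed

lemma residual_properties:
  assumes "onb d E m"
  shows "\<beta> \<in> m \<Longrightarrow> residual d h m \<le> (\<Sum>p\<leftarrow>h. (snd p - dot d (fst p) \<beta>)\<^sup>2)"
    and "\<exists>\<beta>\<in>m. residual d h m = (\<Sum>p\<leftarrow>h. (snd p - dot d (fst p) \<beta>)\<^sup>2)"
proof -
  have "projected_column d m h ` {1..d} \<subseteq> euclid (length h)"
    by (auto simp: projected_column_def euclid_def)
  then obtain F where F: "onb (length h) F (column_space d m h)"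
    using onb_exists[of "projected_column d m h ` {1..d}" "length h"] by (auto simp: column_space_def)
  note C = column_space_eq_predictions[OF assms, of h]
  show "residual d h m \<le> (\<Sum>p\<leftarrow>h. (snd p - dot d (fst p) \<beta>)\<^sup>2)" if "\<beta> \<in> m"
    unfolding residual_def sqnorm_rewards_predictions[symmetric]
    by (rule sqnorm_diff_proj_le[OF F]) (use that C in auto)
  obtain \<beta> where "\<beta> \<in> m" "proj (length h) (column_space d m h) (rewards h) = predictions d h \<beta>"
    using proj_mem[OF F, of "rewards h"] unfolding C by auto
  then show "\<exists>\<beta>\<in>m. residual d h m = (\<Sum>p\<leftarrow>h. (snd p - dot d (fst p) \<beta>)\<^sup>2)"
    unfolding residual_def by (auto simp: sqnorm_rewards_predictions)
qed

section \<open>A fixed problem instance\<close>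

text \<open>Only \<open>c\<close>, \<open>B\<close> and \<open>\<kappa>\<close> are fixed in the
  theorem before its constants are chosen. Constants defined inside the locale must therefore be
  expressions in these three and, for the regret, \<open>C1\<close>.\<close>

locale symmetric_bandit_instance =
  fixes c B \<kappa> :: real and T d d0 :: nat and \<sigma> Kx Rmax Cmin \<epsilon>0 :: real
    and X :: "vector set" and \<theta> xs :: vector and G :: "(nat \<Rightarrow> nat) set" and Q :: "nat set set set"
    and \<nu> :: "vector measure"
  assumes c_pos: "0 < c" and B_pos: "0 < B" and \<kappa>_pos: "0 < \<kappa>"
    and d_ge_1: "1 \<le> d" and \<sigma>_pos: "0 < \<sigma>"
    and nondeg: "nondegenerate \<kappa> T \<sigma> Kx \<epsilon>0"
    and sym: "symmetric_bandit d X \<theta> xs G"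
    and few: "few_partitions c B d d0 G Q"
    and bounded: "bounded_arms d Kx Rmax X \<theta> Q"
    and separated: "well_separated d \<epsilon>0 \<theta> G"
    and expl: "exploratory d X \<nu>"
    and Cmin_eq: "Cmin = lambda_min (second_moment d \<nu>)"
begin

abbreviation "P \<equiv> sample_space \<nu> \<sigma>"
abbreviation "orbs \<equiv> orbit_partition d G"
text \<open>Contains \<open>\<theta>\<close> and every parameter of the model of \<open>p\<close>,
  hence all differences that the selection has to test. It belongs to \<open>models_bar\<close>, so
  \<open>Kx\<close> bounds the projected arms.\<close>

abbreviation "sep_model p \<equiv> convex hull (fixed_space d p \<union> fixed_space d orbs)"

lemma arm_distribution_\<nu>: "arm_distribution d X \<nu>"
  using expl by (simp add: exploratory_def is_arg_max_def)

lemma prob_space_\<nu>: "prob_space \<nu>" and sets_\<nu>: "sets \<nu> = sets borel" and AE_\<nu>: "AE x in \<nu>. x \<in> X"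
  using arm_distribution_\<nu> by (auto simp: arm_distribution_def)

lemma prob_space_P: "prob_space P"
  by (rule prob_space_sample_space[OF prob_space_\<nu> \<sigma>_pos])

sublocale prob_space P by (rule prob_space_P)

lemma Cmin_pos: "0 < Cmin"
  using expl by (simp add: exploratory_def Cmin_eq)

lemma T_ge_2: "2 \<le> T" and Kx_ge: "\<kappa> \<le> Kx" and \<sigma>_ge: "\<kappa> * \<epsilon>0 \<le> \<sigma>" and ln_KxT_ge: "\<kappa> \<le> ln (Kx * T)"
  using nondeg by (auto simp: nondegenerate_def)

lemma Kx_pos: "0 < Kx" and Rmax_pos: "0 < Rmax"
  using bounded by (auto simp: bounded_arms_def)

lemma \<epsilon>0_pos: "0 < \<epsilon>0"
  using separated by (simp add: well_separated_def)

lemma \<theta>_euclid: "\<theta> \<in> euclid d" and X_euclid: "X \<subseteq> euclid d"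
  and xs_X: "xs \<in> X" and xs_best: "x \<in> X \<Longrightarrow> dot d x \<theta> \<le> dot d xs \<theta>"
  using sym by (auto simp: symmetric_bandit_def is_arg_max_def not_less)

lemma Rmax_ge: "x \<in> X \<Longrightarrow> \<bar>dot d x \<theta>\<bar> \<le> Rmax"
  using bounded by (auto simp: bounded_arms_def)

lemma \<theta>_invariant: "g \<in> G \<Longrightarrow> \<theta> (g i) = \<theta> i"
  using sym unfolding symmetric_bandit_def by metis

lemma orbs_eq: "orbs = {{g i | g. g \<in> G} | i. i \<in> {1..d}}"
  by (simp add: orbit_partition_def orbits_def orbit_def)

lemma id_in_G: "id \<in> G"
proof -
  have "\<one>\<^bsub>sym_group d\<^esub> \<in> G"
    using sym by (intro subgroup.one_closed) (simp add: symmetric_bandit_def)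
  then show ?thesis by (simp add: sym_group_def)
qed

lemma orbs_in_Q: "orbs \<in> Q"
  using few by (simp add: few_partitions_def)

lemma Q_partition: "p \<in> Q \<Longrightarrow> partition_on {1..d} p" and Q_card_le: "p \<in> Q \<Longrightarrow> card p \<le> d0"
  using few by (auto simp: few_partitions_def partitions_le_def)

lemma Q_card: assumes "p \<in> Q" shows "1 \<le> card p" "card p \<le> d"
proof -
  note p = Q_partition[OF assms]
  have fin: "finite p" using p finite_elements finite_atLeastAtMost by blast
  have "1 \<in> \<Union> p" using p d_ge_1 by (simp add: partition_on_def)
  then have "p \<noteq> {}" by blast
  then show "1 \<le> card p" using fin by (simp add: Suc_leI card_gt_0_iff)
  \<comment> \<open>A class is determined by its least element, so the classes inject into
    \<open>{1..d}\<close>.\<close>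
  have "card p = card (Min ` p)"
  proof (rule card_image[symmetric], rule inj_onI)
    fix a b assume ab: "a \<in> p" "b \<in> p" "Min a = Min b"
    have "Min a \<in> a" if "a \<in> p" for a
    proof (rule Min_in)
      have "a \<subseteq> {1..d}" "a \<noteq> {}" using p that unfolding partition_on_def by auto
      then show "finite a" "a \<noteq> {}" using finite_subset by blast+
    qed
    then have "Min a \<in> a" "Min a \<in> b" using ab by metis+
    then show "a = b" using p ab(1,2) unfolding partition_on_def disjoint_def by blast
  qed
  also have "\<dots> \<le> card {1..d}"
  proof (rule card_mono, simp, rule image_subsetI)
    fix a assume "a \<in> p"
    then have "a \<subseteq> {1..d}" "a \<noteq> {}" using p unfolding partition_on_def by auto
    then show "Min a \<in> {1..d}" using Min_in[of a] finite_subset[of a "{1..d}"] by blast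
  qed
  finally show "card p \<le> d" by simp
qed

lemma d0_ge_1: "1 \<le> d0"
  using Q_card(1)[OF orbs_in_Q] Q_card_le[OF orbs_in_Q] by linarith

lemma finite_Q: "finite Q"
proof (rule finite_subset)
  show "Q \<subseteq> Pow (Pow {1..d})"
    using Q_partition by (auto simp: partition_on_def)
qed simp

lemma card_Q_ge_1: "1 \<le> card Q"
  using orbs_in_Q finite_Q by (metis One_nat_def Suc_leI card_gt_0_iff empty_iff)

lemma \<theta>_in_orbit_space: "\<theta> \<in> fixed_space d orbs"
proof -
  have "\<theta> i = \<theta> j" if "a \<in> orbs" "i \<in> a" "j \<in> a" for a i j
  proof -
    obtain k g h where "g \<in> G" "h \<in> G" "i = g k" "j = h k" using \<open>a \<in> orbs\<close> \<open>i \<in> a\<close> \<open>j \<in> a\<close> unfolding orbs_eq by blast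
    then show ?thesis by (simp only: \<theta>_invariant)
  qed
  then show ?thesis unfolding fixed_space_def using \<theta>_euclid by blast
qed

text \<open>Because \<open>\<theta>\<close> is constant on orbits, distinct values force distinct
  orbits; the gap condition thus becomes a statement about the values of \<open>\<theta>\<close>
  alone.\<close>

lemma separation:
  assumes "i \<in> {1..d}" "j \<in> {1..d}" "\<theta> i \<noteq> \<theta> j"
  shows "\<epsilon>0 \<le> \<bar>\<theta> i - \<theta> j\<bar>"
proof -
  let ?o = "\<lambda>i. {g i | g. g \<in> G}"
  have o: "?o i \<in> orbs" "?o j \<in> orbs" using assms unfolding orbs_eq by blast+
  have k: "k \<in> ?o k" for k unfolding mem_Collect_eq by (intro exI[of _ id]) (simp add: id_in_G)
  note i = k[of i] k[of j]
  have ne: "?o i \<noteq> ?o j"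
  proof
    assume "?o i = ?o j"
    then obtain g where "g \<in> G" "j = g i" using i(2) by blast
    then show False using assms(3) \<theta>_invariant by simp
  qed
  have "\<forall>a\<in>orbs. \<forall>b\<in>orbs. a \<noteq> b \<longrightarrow> (\<forall>i\<in>a. \<forall>j\<in>b. \<epsilon>0 \<le> \<bar>\<theta> i - \<theta> j\<bar>)"
    using separated unfolding well_separated_def by (rule conjunct2)
  from this[rule_format, OF o ne i] show ?thesis .
qed

text \<open>A partition whose model misses \<open>\<theta>\<close> merges two indices with different
  values. As \<open>\<beta>\<close> takes one value there, its squared errors at the two indices sum
  to at least half of the squared gap.\<close>

lemma sqnorm_model_diff_ge:
  assumes "p \<in> Q" "\<theta> \<notin> fixed_space d p" "\<beta> \<in> fixed_space d p"
  shows "\<epsilon>0\<^sup>2 / 2 \<le> sqnorm d (\<theta> - \<beta>)"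
proof -
  obtain a i j where a: "a \<in> p" "i \<in> a" "j \<in> a" "\<theta> i \<noteq> \<theta> j"
    using assms(2) \<theta>_euclid unfolding fixed_space_def by blast
  have ij: "i \<in> {1..d}" "j \<in> {1..d}" "i \<noteq> j"
    using Q_partition[OF assms(1)] a unfolding partition_on_def by blast+
  have b: "\<beta> i = \<beta> j" using assms(3) a unfolding fixed_space_def by blast
  have "\<epsilon>0\<^sup>2 \<le> \<bar>\<theta> i - \<theta> j\<bar>\<^sup>2"
    using separation[OF ij(1,2) a(4)] \<epsilon>0_pos by (intro power_mono) auto
  also have "\<dots> = ((\<theta> i - \<beta> i) - (\<theta> j - \<beta> i))\<^sup>2" by simp
  also have "\<dots> \<le> 2 * ((\<theta> i - \<beta> i)\<^sup>2 + (\<theta> j - \<beta> i)\<^sup>2)"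
    using zero_le_power2[of "(\<theta> i - \<beta> i) + (\<theta> j - \<beta> i)"] by (simp add: power2_eq_square algebra_simps)
  also have "(\<theta> i - \<beta> i)\<^sup>2 + (\<theta> j - \<beta> i)\<^sup>2 = (\<Sum>k\<in>{i, j}. ((\<theta> - \<beta>) k)\<^sup>2)"
    using ij b by (simp add: vector_apply)
  also have "\<dots> \<le> (\<Sum>k=1..d. ((\<theta> - \<beta>) k)\<^sup>2)"
    using ij by (intro sum_mono2) auto
  finally show ?thesis by (simp add: sqnorm_def dot_def power2_eq_square)
qed

lemma sep_model_in_models_bar: "p \<in> Q \<Longrightarrow> sep_model p \<in> models_bar d Q"
  unfolding models_bar_def models_def using orbs_in_Q by blast

lemma onb_sep_model:
  assumes "p \<in> Q"
  obtains E where "onb d E (sep_model p)" "card E \<le> 2 * d0"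
proof -
  obtain E where "onb d E (sep_model p)" "card E \<le> card p + card orbs"
    using onb_convex_hull_fixed_spaces[OF Q_partition[OF assms] Q_partition[OF orbs_in_Q]] by blast
  then show ?thesis using that Q_card_le[OF assms] Q_card_le[OF orbs_in_Q] by simp
qed

lemma fixed_space_subset_sep_model: "fixed_space d p \<subseteq> sep_model p" "fixed_space d orbs \<subseteq> sep_model p"
  using hull_subset[of "fixed_space d p \<union> fixed_space d orbs" convex] by blast+

lemma sqnorm_proj_sep_model_le: "p \<in> Q \<Longrightarrow> x \<in> X \<Longrightarrow> sqnorm d (proj d (sep_model p) x) \<le> Kx"
  using bounded sep_model_in_models_bar by (auto simp: bounded_arms_def)

lemma dot_squared_sep_model_le:
  assumes "p \<in> Q" "x \<in> X" "v \<in> sep_model p"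
  shows "(dot d x v)\<^sup>2 \<le> Kx * sqnorm d v"
proof -
  obtain E where E: "onb d E (sep_model p)" using onb_sep_model[OF assms(1)] by blast
  have "(dot d x v)\<^sup>2 = (dot d (proj d (sep_model p) x) v)\<^sup>2" by (simp only: dot_proj_left[OF E assms(3)])
  also have "\<dots> \<le> sqnorm d (proj d (sep_model p) x) * sqnorm d v" by (rule dot_squared_le)
  also have "\<dots> \<le> Kx * sqnorm d v"
    using sqnorm_proj_sep_model_le[OF assms(1,2)] by (intro mult_right_mono) auto
  finally show ?thesis .
qed

lemma Cmin_sqnorm_le: "v \<in> euclid d \<Longrightarrow> Cmin * sqnorm d v \<le> (\<integral>x. (dot d x v)\<^sup>2 \<partial>\<nu>)"
  unfolding Cmin_eq by (rule lambda_min_second_moment_le[OF arm_distribution_\<nu>])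

lemma integral_le_of_bounded_on_X:
  assumes "v \<in> euclid d" "\<And>x. x \<in> X \<Longrightarrow> (dot d x v)\<^sup>2 \<le> K"
  shows "(\<integral>x. (dot d x v)\<^sup>2 \<partial>\<nu>) \<le> K"
proof -
  interpret N: prob_space \<nu> by (rule prob_space_\<nu>)
  have "(\<integral>x. (dot d x v)\<^sup>2 \<partial>\<nu>) \<le> (\<integral>x. K \<partial>\<nu>)"
    using lambda_min_second_moment_le(2)[OF arm_distribution_\<nu> assms(1)] AE_\<nu> assms(2)
    by (intro integral_mono_AE) auto
  then show ?thesis by (simp add: N.prob_space)
qed

text \<open>A nonzero vector common to all models: testing on it gives \<open>Cmin \<le> Kx\<close>,
  and it shows that the spaces \<open>sep_model\<close> are nontrivial.\<close>

definition ones :: vector where "ones = class_vec {1..d}"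

lemma ones: "ones \<in> fixed_space d p" if "partition_on {1..d} p" for p
proof -
  have "ones i = ones j" if "a \<in> p" "i \<in> a" "j \<in> a" for a i j
  proof -
    have "i \<in> {1..d}" "j \<in> {1..d}" using \<open>partition_on {1..d} p\<close> that unfolding partition_on_def by blast+
    then show ?thesis by (simp add: ones_def class_vec_def)
  qed
  moreover have "ones \<in> euclid d" by (auto simp: ones_def class_vec_def euclid_def)
  ultimately show ?thesis unfolding fixed_space_def by blast
qed

lemma sqnorm_ones: "0 < sqnorm d ones"
  using d_ge_1 by (simp add: ones_def class_vec_def sqnorm_def dot_def)

lemma Cmin_le_Kx: "Cmin \<le> Kx"
proof -
  have o: "ones \<in> sep_model orbs" using ones[OF Q_partition[OF orbs_in_Q]] fixed_space_subset_sep_model by blast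
  have e: "ones \<in> euclid d" using ones[OF Q_partition[OF orbs_in_Q]] fixed_space_subset_euclid by blast
  have "Cmin * sqnorm d ones \<le> Kx * sqnorm d ones"
    using Cmin_sqnorm_le[OF e] integral_le_of_bounded_on_X[OF e dot_squared_sep_model_le[OF orbs_in_Q _ o]] by linarith
  then show ?thesis using sqnorm_ones by simp
qed

text \<open>The norm bound that OFUL needs is derived rather than assumed: the expectation of the
  squared reward mean under \<open>\<nu>\<close> is at least \<open>Cmin * sqnorm d \<theta>\<close>
  and at most \<open>Rmax\<^sup>2\<close>.\<close>

lemma sqnorm_\<theta>_le: "sqnorm d \<theta> \<le> Rmax\<^sup>2 / Cmin"
proof -
  have "(dot d x \<theta>)\<^sup>2 \<le> Rmax\<^sup>2" if "x \<in> X" for x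
    using power_mono[OF Rmax_ge[OF that], of 2] by simp
  then have "Cmin * sqnorm d \<theta> \<le> Rmax\<^sup>2"
    using Cmin_sqnorm_le[OF \<theta>_euclid] integral_le_of_bounded_on_X[OF \<theta>_euclid] by (meson order_trans)
  then show ?thesis using Cmin_pos by (simp add: field_simps)
qed

section \<open>Condition number, logarithm and size of the union bound\<close>

definition "\<rho> = Kx / Cmin"
definition "lg = ln (real d * real T)"
text \<open>Reciprocal of the probability allotted to one bad event: two events for each model, with
  total probability \<open>1 / T\<close>.\<close>

definition "fail = 2 * real T * real (card Q)"

lemma \<rho>_ge_1: "1 \<le> \<rho>"
  using Cmin_le_Kx Cmin_pos by (simp add: \<rho>_def)

lemma lg_ge: "1 / 2 \<le> lg" "ln T \<le> lg" "ln d \<le> lg"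
proof -
  have dT: "1 \<le> real d" "2 \<le> real T" using d_ge_1 T_ge_2 by auto
  have eq: "lg = ln d + ln T" using dT unfolding lg_def by (subst ln_mult) auto
  have "0 \<le> ln (real d)" "ln 2 \<le> ln (real T)"
    using dT by auto
  moreover have "1 / 2 \<le> ln (2 :: real)" using ln_add_one_ge_half[of 1] by simp
  ultimately show "1 / 2 \<le> lg" "ln T \<le> lg" "ln d \<le> lg" unfolding eq by linarith+
qed

lemma fail_ge: "4 \<le> fail"
proof -
  have "2 * 2 * 1 \<le> 2 * real T * real (card Q)" using T_ge_2 card_Q_ge_1 by (intro mult_mono) auto
  then show ?thesis by (simp add: fail_def)
qed

text \<open>The sum over the numbers of classes has at most \<open>d\<close> terms, as no partition
  has more classes than elements. So the prefactor costs \<open>ln d\<close>, and no logarithm of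
  \<open>d0\<close> appears.\<close>

lemma card_Q_le: "real (card Q) \<le> d * (B * real d powr (c * d0))"
proof -
  have "Q = (\<Union>k\<in>{1..d} \<inter> {1..d0}. {p \<in> Q. card p = k})"
    using Q_card Q_card_le by auto
  then have "card Q = card (\<Union>k\<in>{1..d} \<inter> {1..d0}. {p \<in> Q. card p = k})" by (rule arg_cong)
  also have "\<dots> \<le> (\<Sum>k\<in>{1..d} \<inter> {1..d0}. card {p \<in> Q. card p = k})"
    by (rule card_UN_le) simp
  finally have "real (card Q) \<le> (\<Sum>k\<in>{1..d} \<inter> {1..d0}. real (card {p \<in> Q. card p = k}))"
    by (simp only: of_nat_sum[symmetric] of_nat_le_iff)
  also have "\<dots> \<le> (\<Sum>k\<in>{1..d} \<inter> {1..d0}. B * real d powr (c * d0))"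
  proof (rule sum_mono)
    fix k assume k: "k \<in> {1..d} \<inter> {1..d0}"
    then have "real (card {p \<in> Q. card p = k}) \<le> B * real d powr (c * real k)"
      using few by (simp add: few_partitions_def)
    also have "\<dots> \<le> B * real d powr (c * d0)"
      using B_pos c_pos d_ge_1 k by (intro mult_left_mono powr_mono) auto
    finally show "real (card {p \<in> Q. card p = k}) \<le> B * real d powr (c * d0)" .
  qed
  also have "\<dots> = card ({1..d} \<inter> {1..d0}) * (B * real d powr (c * d0))" by simp
  also have "\<dots> \<le> d * (B * real d powr (c * d0))"
  proof (intro mult_right_mono)
    have "card ({1..d} \<inter> {1..d0}) \<le> card {1..d}" by (intro card_mono) auto
    then show "real (card ({1..d} \<inter> {1..d0})) \<le> real d" by simp
  qed (use B_pos in auto)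
  finally show ?thesis .
qed

lemma ln_fail_le: "ln fail \<le> (3 + 2 * B + c) * (d0 * lg)"
proof -
  have dT: "1 \<le> real d" "2 \<le> real T" "1 \<le> real d0" using d_ge_1 T_ge_2 d0_ge_1 by auto
  have cq: "0 < real (card Q)" using card_Q_ge_1 by linarith
  have pw: "0 < real d powr (c * d0)" using dT by simp
  have "ln fail = ln 2 + ln T + ln (card Q)"
    unfolding fail_def using dT cq by (simp add: ln_mult)
  also have "ln (card Q) \<le> ln (d * (B * real d powr (c * d0)))"
    using card_Q_le cq dT B_pos pw by (subst ln_le_cancel_iff) auto
  also have "\<dots> = ln d + (ln B + c * d0 * ln d)"
    using dT B_pos pw by (simp add: ln_mult ln_powr)
  finally have 1: "ln fail \<le> ln 2 + ln T + ln d + ln B + c * d0 * ln d" by simp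
  have "ln 2 \<le> ln T" using dT by simp
  then have 2: "ln 2 \<le> lg" using lg_ge by linarith
  have "ln B \<le> B - 1" using B_pos by (rule ln_le_minus_one)
  moreover have "B * 1 \<le> B * (2 * lg)" using lg_ge B_pos by (intro mult_left_mono) auto
  ultimately have 3: "ln B \<le> 2 * B * lg" by simp
  have 4: "c * d0 * ln d \<le> c * d0 * lg" using lg_ge c_pos by (intro mult_left_mono) auto
  have 5: "(3 + 2 * B) * lg * 1 \<le> (3 + 2 * B) * lg * d0"
    using lg_ge B_pos dT by (intro mult_left_mono) auto
  show ?thesis using 1 2 3 4 5 lg_ge(2,3) by (simp add: algebra_simps)
qed

section \<open>The empirical second moments during the exploration\<close>

text \<open>\<open>X\<close> is an arbitrary subset of \<open>euclid d\<close>, so the exceptional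
  set is enclosed in a measurable null set before it is pulled back along
  \<open>fst\<close>.\<close>

lemma AE_arms: "AE \<omega> in P. \<forall>s. fst \<omega> s \<in> X"
proof -
  let ?A = "\<Pi>\<^sub>M t\<in>(UNIV :: nat set). \<nu>"
  have "AE a in ?A. a s \<in> X" for s
    by (rule AE_PiM_component) (use prob_space_\<nu> AE_\<nu> in auto)
  then have "AE a in ?A. \<forall>s. a s \<in> X" by (simp add: AE_all_countable)
  then obtain N where N: "{a \<in> space ?A. \<not> (\<forall>s. a s \<in> X)} \<subseteq> N" "emeasure ?A N = 0" "N \<in> sets ?A"
    by (rule AE_E)
  have m: "fst \<in> P \<rightarrow>\<^sub>M ?A" unfolding sample_space_eq by measurable
  have s: "fst -` N \<inter> space P \<in> sets P" using m N(3) by (rule measurable_sets)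
  have "emeasure P (fst -` N \<inter> space P) = (\<integral>\<^sup>+\<omega>. indicator N (fst \<omega>) \<partial>P)"
    using s by (simp add: nn_integral_indicator[symmetric] del: nn_integral_indicator)
      (intro nn_integral_cong, auto split: split_indicator)
  also have "\<dots> = (\<integral>\<^sup>+a. indicator N a \<partial>?A)"
    using N(3) by (intro nn_integral_arms[OF prob_space_\<nu> \<sigma>_pos]) simp
  also have "\<dots> = 0" using N by simp
  finally have "emeasure P (fst -` N \<inter> space P) = 0" .
  moreover have "{\<omega> \<in> space P. \<not> (\<forall>s. fst \<omega> s \<in> X)} \<subseteq> fst -` N \<inter> space P"
    using N(1) measurable_space[OF m] by blast
  ultimately show ?thesis using s by (intro AE_I[where N="fst -` N \<inter> space P"])
qed

text \<open>A measurable set \<open>N\<close> covering the failures, instead of the failure event: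
  the latter quantifies over uncountably many \<open>v\<close>.\<close>

definition ill_conditioned :: "nat set set \<Rightarrow> nat \<Rightarrow> ((nat \<Rightarrow> vector) \<times> (nat \<Rightarrow> real)) set \<Rightarrow> bool" where
  "ill_conditioned p n N \<longleftrightarrow> N \<in> sets P \<and>
    (\<forall>\<omega>\<in>space P - N. (\<forall>s. fst \<omega> s \<in> X) \<longrightarrow> (\<forall>v\<in>sep_model p.
      n * Cmin / 32 * sqnorm d v \<le> (\<Sum>s<n. (dot d (fst \<omega> (s + 1)) v)\<^sup>2)))"

text \<open>Divided by \<open>Kx * sqnorm d u\<close>, the squared inner product lies in the unit
  interval and has mean at least \<open>1 / \<rho>\<close>, so the Chernoff bound applies.\<close>

lemma empirical_small_vector:
  assumes "p \<in> Q" "u \<in> sep_model p"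
  shows "{\<omega> \<in> space P. (\<Sum>s<n. (dot d (fst \<omega> (s + 1)) u)\<^sup>2) < n * Cmin / 4 * sqnorm d u} \<in> sets P"
    and "measure P {\<omega> \<in> space P. (\<Sum>s<n. (dot d (fst \<omega> (s + 1)) u)\<^sup>2) < n * Cmin / 4 * sqnorm d u}
      \<le> exp (- (real n / (4 * \<rho>)))"
proof -
  obtain E where E: "onb d E (sep_model p)" using onb_sep_model[OF assms(1)] by blast
  have ue: "u \<in> euclid d" using assms(2) onbD(3)[OF E] by blast
  let ?S = "{\<omega> \<in> space P. (\<Sum>s<n. (dot d (fst \<omega> (s + 1)) u)\<^sup>2) < n * Cmin / 4 * sqnorm d u}"
  have c: "?S \<in> sets P \<and> measure P ?S \<le> exp (- (real n / (4 * \<rho>)))"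
  proof (cases "sqnorm d u = 0")
    case True
    have "0 \<le> (\<Sum>s<n. (dot d (fst \<omega> (s + 1)) u)\<^sup>2)" for \<omega> :: "(nat \<Rightarrow> vector) \<times> (nat \<Rightarrow> real)"
      by (intro sum_nonneg) auto
    then have e: "?S = {}" using True by (auto simp: not_less)
    show ?thesis unfolding e by simp
  next
    case False
    then have u: "0 < sqnorm d u" using sqnorm_nonneg[of d u] by linarith
    define K where "K = Kx * sqnorm d u"
    have K: "0 < K" using u Kx_pos by (simp add: K_def)
    define f where "f x = (dot d x u)\<^sup>2 / K" for x
    have f: "f \<in> borel_measurable \<nu>"
      unfolding f_def measurable_cong_sets[OF sets_\<nu> refl] by measurable
    have f01: "AE x in \<nu>. 0 \<le> f x \<and> f x \<le> 1"
      using AE_\<nu>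
    proof eventually_elim
      case (elim x)
      then show ?case using dot_squared_sep_model_le[OF assms(1) elim assms(2)] K by (simp add: f_def K_def)
    qed
    have "1 / \<rho> = Cmin * sqnorm d u / K"
      using u Kx_pos by (simp add: \<rho>_def K_def)
    also have "\<dots> \<le> (\<integral>x. (dot d x u)\<^sup>2 \<partial>\<nu>) / K"
      using Cmin_sqnorm_le[OF ue] K by (intro divide_right_mono) auto
    also have "\<dots> = (\<integral>x. f x \<partial>\<nu>)" by (simp add: f_def)
    finally have \<mu>: "1 / \<rho> \<le> (\<integral>x. f x \<partial>\<nu>)" .
    have "?S = {\<omega> \<in> space P. (\<Sum>s<n. f (fst \<omega> (s + 1))) < n * (1 / \<rho>) / 4}"
    proof -
      have "n * (1 / \<rho>) / 4 = n * Cmin / 4 * sqnorm d u / K" using u Kx_pos by (simp add: \<rho>_def K_def)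
      then have "(\<Sum>s<n. f (a (s + 1))) < n * (1 / \<rho>) / 4
          \<longleftrightarrow> (\<Sum>s<n. (dot d (a (s + 1)) u)\<^sup>2) < n * Cmin / 4 * sqnorm d u" for a
        unfolding f_def sum_divide_distrib[symmetric] using K by (simp only: divide_less_cancel) auto
      then show ?thesis by simp
    qed
    then have e: "?S = {\<omega> \<in> space P. (\<Sum>s<n. f (fst \<omega> (s + 1))) < n * (1 / \<rho>) / 4}" .
    note m = measure_sum_iid_small_le[OF prob_space_\<nu> \<sigma>_pos f f01 \<mu>, of n]
    show ?thesis unfolding e
      by (rule conjI[OF m(1)], rule order_trans[OF m(2)]) simp
  qed
  show "?S \<in> sets P" by (rule conjunct1[OF c])
  show "measure P ?S \<le> exp (- (real n / (4 * \<rho>)))" by (rule conjunct2[OF c])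
qed

text \<open>Union bound over a net of the unit sphere of \<open>sep_model\<close>; the passage to
  all unit vectors loses the empirical form at \<open>u - v\<close>, which the arm bound makes
  small.\<close>

lemma ill_conditioned_exists:
  assumes "p \<in> Q"
  shows "\<exists>N. ill_conditioned p n N \<and> measure P N \<le> exp (16 * d0 * sqrt \<rho> + 2 * d0) * 3 ^ (2 * d0) * exp (- (real n / (4 * \<rho>)))"
proof -
  let ?M = "sep_model p"
  obtain E where E: "onb d E ?M" "card E \<le> 2 * d0" using onb_sep_model[OF assms] by blast
  note ED = onbD[OF E(1)]
  have "ones \<in> ?M" using ones[OF Q_partition[OF assms]] fixed_space_subset_sep_model by blast
  then have "E \<noteq> {}" using ED(6)[of ones] sqnorm_ones by auto
  \<comment> \<open>Chosen such that \<open>Kx * \<epsilon>\<^sup>2 = Cmin / 64\<close>; then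
    \<open>2 * d0 / \<epsilon>\<close> is the exponent \<open>16 * d0 * sqrt \<rho>\<close>.\<close>
  define \<epsilon> where "\<epsilon> = 1 / (8 * sqrt \<rho>)"
  have \<rho>: "0 < \<rho>" "1 \<le> \<rho>" using \<rho>_ge_1 by auto
  have \<epsilon>: "0 < \<epsilon>" "\<epsilon>\<^sup>2 = 1 / (64 * \<rho>)"
    using \<rho> by (auto simp: \<epsilon>_def power_divide power_mult_distrib)
  obtain F where F: "finite F" "F \<subseteq> ?M" "real (card F) \<le> exp (card E / \<epsilon> + card E) * 3 ^ card E"
    "\<And>v. v \<in> ?M \<Longrightarrow> sqnorm d v = 1 \<Longrightarrow> \<exists>u\<in>F. sqnorm d (v - u) \<le> \<epsilon>\<^sup>2"
  proof (rule sphere_net[OF E(1) \<open>E \<noteq> {}\<close> \<epsilon>(1)], goal_cases)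
    case (1 F)
    show thesis by (rule 1(1)[OF 1(2-5)])
  qed
  define S where "S u = {\<omega> \<in> space P. (\<Sum>s<n. (dot d (fst \<omega> (s + 1)) u)\<^sup>2) < n * Cmin / 4 * sqnorm d u}" for u
  define N where "N = (\<Union>u\<in>F. S u)"
  have S: "S u \<in> sets P" "measure P (S u) \<le> exp (- (real n / (4 * \<rho>)))" if "u \<in> F" for u
    unfolding S_def by (rule empirical_small_vector[OF assms subsetD[OF F(2) that]])+
  have N: "N \<in> sets P" unfolding N_def using S F(1) by auto
  have "measure P N \<le> (\<Sum>u\<in>F. measure P (S u))"
    unfolding N_def using S F(1) by (intro finite_measure_subadditive_finite) auto
  also have "\<dots> \<le> (\<Sum>u\<in>F. exp (- (real n / (4 * \<rho>))))" by (intro sum_mono S)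
  also have "\<dots> = card F * exp (- (real n / (4 * \<rho>)))" by simp
  also have "\<dots> \<le> (exp (16 * d0 * sqrt \<rho> + 2 * d0) * 3 ^ (2 * d0)) * exp (- (real n / (4 * \<rho>)))"
  proof (rule mult_right_mono)
    have "real (card F) \<le> exp (card E / \<epsilon> + card E) * 3 ^ card E" by (rule F(3))
    also have "\<dots> \<le> exp (16 * d0 * sqrt \<rho> + 2 * d0) * 3 ^ (2 * d0)"
    proof (intro mult_mono)
      have "card E / \<epsilon> = 8 * (real (card E) * sqrt \<rho>)" by (simp add: \<epsilon>_def)
      also have "\<dots> \<le> 8 * (real (2 * d0) * sqrt \<rho>)"
        using E(2) \<rho> by (intro mult_left_mono mult_right_mono of_nat_mono) auto
      finally show "exp (card E / \<epsilon> + card E) \<le> exp (16 * d0 * sqrt \<rho> + 2 * d0)"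
        using of_nat_mono[OF E(2), where 'a=real] by simp
      show "(3 :: real) ^ card E \<le> 3 ^ (2 * d0)" using E(2) by (intro power_increasing) auto
    qed auto
    finally show "real (card F) \<le> exp (16 * d0 * sqrt \<rho> + 2 * d0) * 3 ^ (2 * d0)" .
  qed simp
  finally have "measure P N \<le> exp (16 * d0 * sqrt \<rho> + 2 * d0) * 3 ^ (2 * d0) * exp (- (real n / (4 * \<rho>)))" .
  moreover have "ill_conditioned p n N"
    unfolding ill_conditioned_def
  proof (intro conjI ballI impI N)
    fix \<omega> v assume \<omega>: "\<omega> \<in> space P - N" and X: "\<forall>s. fst \<omega> s \<in> X" and v: "v \<in> ?M"
    let ?q = "\<lambda>v. \<Sum>s<n. (dot d (fst \<omega> (s + 1)) v)\<^sup>2"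
    have unit: "n * Cmin / 32 \<le> ?q v" if v: "v \<in> ?M" "sqnorm d v = 1" for v
    proof -
      obtain u where u: "u \<in> F" "sqnorm d (v - u) \<le> \<epsilon>\<^sup>2" using F(4)[OF v] by blast
      have uM: "u \<in> ?M" "v - u \<in> ?M" using u F(2) v ED(2) by (auto intro: subspace_diff)
      have two: "(a + b)\<^sup>2 \<le> 2 * a\<^sup>2 + 2 * b\<^sup>2" for a b :: real
        using zero_le_power2[of "a - b"] by (simp add: power2_eq_square algebra_simps)
      have "1 \<le> 2 * sqnorm d u + 2 * \<epsilon>\<^sup>2"
      proof -
        have "sqnorm d v = (\<Sum>e\<in>E. (dot d v e)\<^sup>2)" by (rule sqnorm_onb[OF E(1) v(1)])
        also have "\<dots> = (\<Sum>e\<in>E. (dot d u e + dot d (v - u) e)\<^sup>2)" by simp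
        also have "\<dots> \<le> (\<Sum>e\<in>E. 2 * (dot d u e)\<^sup>2 + 2 * (dot d (v - u) e)\<^sup>2)" by (intro sum_mono two)
        also have "\<dots> = 2 * sqnorm d u + 2 * sqnorm d (v - u)"
          unfolding sqnorm_onb[OF E(1) uM(1)] sqnorm_onb[OF E(1) uM(2)] by (simp only: sum.distrib sum_distrib_left)
        finally show ?thesis using u(2) v(2) by linarith
      qed
      moreover have "\<epsilon>\<^sup>2 \<le> 1 / 64" unfolding \<epsilon>(2) using \<rho> by (intro divide_left_mono) auto
      ultimately have su: "31 / 64 \<le> sqnorm d u" by linarith
      have "n * Cmin / 4 * (31 / 64) \<le> n * Cmin / 4 * sqnorm d u"
        using su Cmin_pos by (intro mult_left_mono) auto
      also have "\<dots> \<le> ?q u" using \<omega> u(1) unfolding N_def S_def by (auto simp: not_less)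
      also have "\<dots> = (\<Sum>s<n. (dot d (fst \<omega> (s + 1)) v + dot d (fst \<omega> (s + 1)) (u - v))\<^sup>2)" by simp
      also have "\<dots> \<le> (\<Sum>s<n. 2 * (dot d (fst \<omega> (s + 1)) v)\<^sup>2 + 2 * (dot d (fst \<omega> (s + 1)) (u - v))\<^sup>2)"
        by (intro sum_mono two)
      also have "\<dots> = 2 * ?q v + 2 * ?q (u - v)" by (simp only: sum.distrib sum_distrib_left)
      also have "?q (u - v) \<le> (\<Sum>s<n. Cmin / 64)"
      proof (rule sum_mono)
        fix s assume "s \<in> {..<n}"
        have "(dot d (fst \<omega> (s + 1)) (u - v))\<^sup>2 = (dot d (fst \<omega> (s + 1)) (v - u))\<^sup>2"
          by (simp add: power2_commute)
        also have "\<dots> \<le> Kx * sqnorm d (v - u)"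
          using dot_squared_sep_model_le[OF assms _ uM(2)] X by blast
        also have "\<dots> \<le> Kx * \<epsilon>\<^sup>2" using u(2) Kx_pos by simp
        also have "\<dots> = Cmin / 64" using Kx_pos Cmin_pos by (simp add: \<epsilon>(2) \<rho>_def)
        finally show "(dot d (fst \<omega> (s + 1)) (u - v))\<^sup>2 \<le> Cmin / 64" .
      qed
      also have "(\<Sum>s<n. Cmin / 64) = n * Cmin / 64" by simp
      \<comment> \<open>This leaves 23/512 of \<open>n * Cmin\<close> for \<open>?q v\<close>, more
        than the claimed 1/32.\<close>
      finally have "n * Cmin * (31 / 256) \<le> 2 * ?q v + 2 * (n * Cmin / 64)" by simp
      moreover have "0 \<le> n * Cmin" using Cmin_pos by simp
      ultimately show ?thesis by linarith
    qed
    show "n * Cmin / 32 * sqnorm d v \<le> ?q v"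
    proof (cases "sqnorm d v = 0")
      case True
      then show ?thesis by (simp add: sum_nonneg)
    next
      case False
      then have sv: "0 < sqnorm d v" using sqnorm_nonneg[of d v] by linarith
      define r where "r = 1 / sqrt (sqnorm d v)"
      have r: "r\<^sup>2 = 1 / sqnorm d v" using sv by (simp add: r_def power_one_over)
      have "n * Cmin / 32 \<le> ?q (r *\<^sub>R v)"
        by (rule unit) (use v ED(2) sv r in \<open>auto intro: subspace_scale\<close>)
      also have "\<dots> = r\<^sup>2 * ?q v" by (simp add: power_mult_distrib sum_distrib_left)
      finally show ?thesis using sv by (simp add: r field_simps)
    qed
  qed
  ultimately show ?thesis by blast
qed

end

section \<open>Runs\<close>

lemma length_run [simp]: "length (run d \<theta> t2 pol n \<omega>) = n"
  by (induction n) (auto simp: Let_def)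

lemma arm_at_Suc: "arm_at d \<theta> t2 pol (Suc n) \<omega> = (if Suc n \<le> t2 then fst \<omega> (Suc n) else pol (run d \<theta> t2 pol n \<omega>))"
  by (simp add: arm_at_def Let_def)

lemma run_eq_map: "run d \<theta> t2 pol n \<omega> =
  map (\<lambda>s. (arm_at d \<theta> t2 pol (s + 1) \<omega>, dot d (arm_at d \<theta> t2 pol (s + 1) \<omega>) \<theta> + snd \<omega> (s + 1))) [0..<n]"
proof (induction n)
  case (Suc n)
  have "run d \<theta> t2 pol (Suc n) \<omega> = run d \<theta> t2 pol n \<omega> @
      [(arm_at d \<theta> t2 pol (Suc n) \<omega>, dot d (arm_at d \<theta> t2 pol (Suc n) \<omega>) \<theta> + snd \<omega> (Suc n))]"
    unfolding arm_at_Suc by (simp add: Let_def)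
  with Suc show ?case by simp
qed simp

text \<open>Adaptedness: the history of \<open>n\<close> rounds does not see the noise of later
  rounds.\<close>

lemma run_noise_upd: "n < i \<Longrightarrow> run d \<theta> t2 pol n (a, b(i := v)) = run d \<theta> t2 pol n (a, b)"
  by (induction n) (auto simp: Let_def)

lemma arm_at_noise_upd: "n < i \<Longrightarrow> arm_at d \<theta> t2 pol (Suc n) (a, b(i := v)) = arm_at d \<theta> t2 pol (Suc n) (a, b)"
  by (simp add: arm_at_Suc run_noise_upd)

lemma drop_run: "drop t2 (run d \<theta> t2 pol (t2 + n) \<omega>) =
  map (\<lambda>s. (arm_at d \<theta> t2 pol (t2 + s + 1) \<omega>, dot d (arm_at d \<theta> t2 pol (t2 + s + 1) \<omega>) \<theta> + snd \<omega> (t2 + s + 1))) [0..<n]"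
  by (rule nth_equalityI) (auto simp: run_eq_map)

lemma take_run: "take t2 (run d \<theta> t2 pol (t2 + n) \<omega>) = run d \<theta> t2 pol t2 \<omega>"
  by (simp add: run_eq_map take_map)

lemma measurable_proj:
  assumes "onb d E m" "f \<in> borel_measurable M"
  shows "(\<lambda>\<omega>. proj d m (f \<omega>)) \<in> borel_measurable M"
  unfolding proj_onb[OF assms(1)] using assms(2)
  by (intro measurable_vector_sum measurable_vector_scaleR measurable_dot measurable_const) auto

context symmetric_bandit_instance
begin

section \<open>The exploration rate and its constants\<close>

definition "C3 = 3 + 2 * B + c"
text \<open>The first summand serves \<open>n_signal\<close> through
  \<open>\<kappa> \<le> Kx\<close>, the second \<open>n_tail\<close> through
  \<open>\<kappa> * \<epsilon>0 \<le> \<sigma>\<close>. \<open>C3\<close> is the coefficient of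
  \<open>ln_fail_le\<close>.\<close>

definition "C0 = 1024 * (C3 + 66) / \<kappa> + 4 * (44 + C3) / \<kappa>\<^sup>2"
definition "rate = exploration_rate \<sigma> Kx d0 d T Cmin \<epsilon>0"

lemma C3_pos: "0 < C3" using B_pos c_pos by (simp add: C3_def)

lemma C0_pos: "0 < C0"
  unfolding C0_def using C3_pos \<kappa>_pos by (intro add_pos_pos divide_pos_pos) auto

lemma d0lg_ge: "1 / 2 \<le> d0 * lg"
proof -
  have "1 * (1 / 2) \<le> d0 * lg" using d0_ge_1 lg_ge by (intro mult_mono) auto
  then show ?thesis by simp
qed

lemma \<rho>d0lg_ge: "1 / 2 \<le> \<rho> * (d0 * lg)" "d0 * lg \<le> \<rho> * (d0 * lg)" "\<rho> / 2 \<le> \<rho> * (d0 * lg)"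
proof -
  have "1 * (d0 * lg) \<le> \<rho> * (d0 * lg)" using \<rho>_ge_1 d0lg_ge by (intro mult_right_mono) auto
  then show "d0 * lg \<le> \<rho> * (d0 * lg)" "1 / 2 \<le> \<rho> * (d0 * lg)" using d0lg_ge by auto
  have "\<rho> * (1 / 2) \<le> \<rho> * (d0 * lg)" using \<rho>_ge_1 d0lg_ge by (intro mult_left_mono) auto
  then show "\<rho> / 2 \<le> \<rho> * (d0 * lg)" by simp
qed

lemma rate_eq: "rate = (\<sigma> / \<epsilon>0)\<^sup>2 * (\<rho>\<^sup>2 * (d0 * lg))"
  by (simp add: rate_def exploration_rate_def \<rho>_def lg_def power_divide mult_ac)

lemma rate_ge: "\<kappa>\<^sup>2 * (\<rho> * (\<rho> * (d0 * lg))) \<le> rate"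
proof -
  have "\<kappa> \<le> \<sigma> / \<epsilon>0" using \<sigma>_ge \<epsilon>0_pos by (simp add: field_simps)
  then have "\<kappa>\<^sup>2 \<le> (\<sigma> / \<epsilon>0)\<^sup>2" using \<kappa>_pos by (intro power_mono) auto
  then have "\<kappa>\<^sup>2 * (\<rho>\<^sup>2 * (d0 * lg)) \<le> rate"
    unfolding rate_eq using d0lg_ge by (intro mult_right_mono) auto
  then show ?thesis by (simp add: power2_eq_square mult.assoc)
qed

lemma rate_ge': "\<kappa>\<^sup>2 * (\<rho> * (d0 * lg)) \<le> rate" "\<kappa>\<^sup>2 / 2 \<le> rate" "\<kappa>\<^sup>2 * (d0 * lg) \<le> rate" "\<kappa>\<^sup>2 * (\<rho> * d0) \<le> 2 * rate" "0 < rate"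
proof -
  have k: "0 < \<kappa>\<^sup>2" using \<kappa>_pos by simp
  have "1 * (\<rho> * (d0 * lg)) \<le> \<rho> * (\<rho> * (d0 * lg))"
    using \<rho>_ge_1 \<rho>d0lg_ge by (intro mult_right_mono) auto
  then have "\<kappa>\<^sup>2 * (\<rho> * (d0 * lg)) \<le> \<kappa>\<^sup>2 * (\<rho> * (\<rho> * (d0 * lg)))" using k by simp
  then show 1: "\<kappa>\<^sup>2 * (\<rho> * (d0 * lg)) \<le> rate" using rate_ge by linarith
  have "\<kappa>\<^sup>2 * (1 / 2) \<le> \<kappa>\<^sup>2 * (\<rho> * (d0 * lg))" using k \<rho>d0lg_ge(1) by (intro mult_left_mono) auto
  then show "\<kappa>\<^sup>2 / 2 \<le> rate" using 1 by simp
  then show "0 < rate" using k by linarith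
  have "\<kappa>\<^sup>2 * (d0 * lg) \<le> \<kappa>\<^sup>2 * (\<rho> * (d0 * lg))" using k \<rho>d0lg_ge(2) by (intro mult_left_mono) auto
  then show "\<kappa>\<^sup>2 * (d0 * lg) \<le> rate" using 1 by simp
  have "\<kappa>\<^sup>2 * (\<rho> * d0) * (1 / 2) \<le> \<kappa>\<^sup>2 * (\<rho> * d0) * lg" using k \<rho>_ge_1 lg_ge by (intro mult_left_mono) auto
  then show "\<kappa>\<^sup>2 * (\<rho> * d0) \<le> 2 * rate" using 1 by (simp add: mult_ac)
qed

section \<open>Model selection after an exploration of length \<open>n\<close>\<close>

context
  fixes n :: nat
  assumes n: "C0 * rate \<le> n"
begin

lemma n_pos: "0 < n"
proof -
  have "0 < C0 * rate" using C0_pos rate_ge'(5) by simp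
  then show ?thesis using n by simp
qed

text \<open>The left-hand side is 64 times the upper bound that \<open>no_confusion\<close> finds
  for the empirical form, with 66 in place of 65 so that the comparison is strict.\<close>

lemma n_signal: "1024 * \<sigma>\<^sup>2 * ((C3 + 66) * (\<rho> * (d0 * lg))) \<le> n * Cmin * \<epsilon>0\<^sup>2"
proof -
  have r: "rate * Cmin * \<epsilon>0\<^sup>2 = Kx * (\<sigma>\<^sup>2 * (\<rho> * (d0 * lg)))"
    using Cmin_pos \<epsilon>0_pos by (simp add: rate_eq \<rho>_def power_divide power2_eq_square)
  have k: "1024 * (C3 + 66) / \<kappa> \<le> C0"
    unfolding C0_def using C3_pos \<kappa>_pos by simp
  have "1024 * \<sigma>\<^sup>2 * ((C3 + 66) * (\<rho> * (d0 * lg))) = 1024 * (C3 + 66) / \<kappa> * (\<kappa> * (\<sigma>\<^sup>2 * (\<rho> * (d0 * lg))))"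
    using \<kappa>_pos by simp
  also have "\<dots> \<le> C0 * (Kx * (\<sigma>\<^sup>2 * (\<rho> * (d0 * lg))))"
    using k Kx_ge C3_pos \<kappa>_pos \<rho>d0lg_ge(1) C0_pos \<rho>_ge_1 lg_ge(1) by (intro mult_mono mult_right_mono mult_nonneg_nonneg) auto
  also have "\<dots> = (C0 * rate) * (Cmin * \<epsilon>0\<^sup>2)"
    unfolding r[symmetric] by (simp only: mult.assoc)
  also have "\<dots> \<le> n * (Cmin * \<epsilon>0\<^sup>2)"
    using n Cmin_pos by (intro mult_right_mono) auto
  finally show ?thesis by (simp only: mult.assoc)
qed

lemma n_tail: "(44 + C3) * (\<rho> * (d0 * lg)) \<le> n / (4 * \<rho>)"
proof -
  have k: "4 * (44 + C3) / \<kappa>\<^sup>2 \<le> C0"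
    unfolding C0_def using C3_pos \<kappa>_pos by simp
  have "4 * (44 + C3) * (\<rho> * (\<rho> * (d0 * lg))) = 4 * (44 + C3) / \<kappa>\<^sup>2 * (\<kappa>\<^sup>2 * (\<rho> * (\<rho> * (d0 * lg))))"
    using \<kappa>_pos by simp
  also have "\<dots> \<le> C0 * rate"
    using k rate_ge C0_pos C3_pos \<kappa>_pos \<rho>_ge_1 \<rho>d0lg_ge(1) by (intro mult_mono) auto
  also have "\<dots> \<le> n" by (rule n)
  finally show ?thesis using \<rho>_ge_1 by (simp add: field_simps)
qed

lemma ill_conditioned_small:
  assumes "p \<in> Q"
  shows "\<exists>N. ill_conditioned p n N \<and> measure P N \<le> 1 / fail"
proof -
  obtain N where N: "ill_conditioned p n N"
    "measure P N \<le> exp (16 * d0 * sqrt \<rho> + 2 * d0) * 3 ^ (2 * d0) * exp (- (real n / (4 * \<rho>)))"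
    using ill_conditioned_exists[OF assms] by blast
  have f: "0 < fail" using fail_ge by linarith
  have "(3 :: real) ^ (2 * d0) \<le> exp 2 ^ (2 * d0)"
    using exp_ge_add_one_self[of 2] by (intro power_mono) auto
  also have "\<dots> = exp (4 * d0)" by (simp add: exp_of_nat_mult[symmetric])
  finally have 3: "(3 :: real) ^ (2 * d0) \<le> exp (4 * d0)" .
  have "sqrt \<rho> \<le> sqrt (\<rho> * \<rho>)" using \<rho>_ge_1 by (intro real_sqrt_le_mono) simp
  then have "sqrt \<rho> \<le> \<rho>" using \<rho>_ge_1 by simp
  then have "d0 * sqrt \<rho> \<le> d0 * \<rho>" by (intro mult_left_mono) auto
  moreover have "real d0 * 1 \<le> real d0 * \<rho>" using \<rho>_ge_1 by (intro mult_left_mono) auto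
  moreover have "\<rho> * d0 * (1 / 2) \<le> \<rho> * d0 * lg" using \<rho>_ge_1 lg_ge by (intro mult_left_mono) auto
  \<comment> \<open>As \<open>lg \<ge> 1 / 2\<close>, each multiple of \<open>\<rho> * d0\<close> is
    at most twice that multiple of \<open>\<rho> * (d0 * lg)\<close>, and 2 * (16 + 2 + 4) =
    44.\<close>
  ultimately have "16 * d0 * sqrt \<rho> + 2 * d0 + 4 * d0 \<le> 44 * (\<rho> * (d0 * lg))" by (simp add: mult_ac)
  moreover have "ln fail \<le> C3 * (\<rho> * (d0 * lg))"
  proof -
    have "C3 * (d0 * lg) \<le> C3 * (\<rho> * (d0 * lg))" using C3_pos \<rho>d0lg_ge(2) by (intro mult_left_mono) auto
    then show ?thesis using ln_fail_le by (simp add: C3_def)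
  qed
  ultimately have "16 * d0 * sqrt \<rho> + 2 * d0 + 4 * d0 + - (real n / (4 * \<rho>)) \<le> - ln fail"
    using n_tail by (simp add: distrib_right)
  then have "exp (16 * d0 * sqrt \<rho> + 2 * d0) * exp (4 * d0) * exp (- (real n / (4 * \<rho>))) \<le> exp (- ln fail)"
    unfolding exp_add[symmetric] by (subst exp_le_cancel_iff)
  also have "exp (- ln fail) = 1 / fail" using f by (simp add: exp_minus inverse_eq_divide)
  finally have "exp (16 * d0 * sqrt \<rho> + 2 * d0) * exp (4 * d0) * exp (- (real n / (4 * \<rho>))) \<le> 1 / fail" .
  moreover have "exp (16 * d0 * sqrt \<rho> + 2 * d0) * 3 ^ (2 * d0) * exp (- (real n / (4 * \<rho>)))
      \<le> exp (16 * d0 * sqrt \<rho> + 2 * d0) * exp (4 * d0) * exp (- (real n / (4 * \<rho>)))"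
    using 3 by (intro mult_right_mono mult_left_mono) auto
  ultimately show ?thesis using N by (intro exI[of _ N] conjI) linarith+
qed

text \<open>Equal to the guaranteed curvature of the empirical form. The regularised form is then at
  most twice the empirical one, and \<open>n * Kx / expl_reg\<close> is \<open>32 * \<rho>\<close>,
  so \<open>ln n\<close> does not enter the determinant.\<close>

definition "expl_reg = n * Cmin / 32"

definition "expl_vec p s \<omega> = proj d (sep_model p) (fst \<omega> (s + 1))"
  for \<omega> :: "(nat \<Rightarrow> vector) \<times> (nat \<Rightarrow> real)"

lemma expl_reg_pos: "0 < expl_reg"
  using n_pos Cmin_pos by (simp add: expl_reg_def)

text \<open>Otherwise Cauchy--Schwarz with the regularised form bounds the empirical form
  \<open>?q\<close> by \<open>8 * sn\<close>, and \<open>sn\<close> is of order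
  \<open>\<sigma>\<^sup>2 * (ln fail + ln ?D)\<close>. But good conditioning and separation make
  \<open>?q\<close> at least \<open>n * Cmin * \<epsilon>0\<^sup>2 / 64\<close>, which is
  larger.\<close>

lemma no_confusion:
  assumes p: "p \<in> Q" and N: "ill_conditioned p n N" "\<omega> \<in> space P - N" and X: "\<forall>s. fst \<omega> s \<in> X"
    and lik: "lik d expl_reg \<sigma> (\<lambda>s. expl_vec p s \<omega>) (\<lambda>s. snd \<omega> (s + 1)) n \<le> fail"
    and v: "v \<in> sep_model p" "\<epsilon>0\<^sup>2 / 2 \<le> sqnorm d v"
  shows "2 * (\<Sum>s<n. snd \<omega> (s + 1) * dot d (fst \<omega> (s + 1)) v) < (\<Sum>s<n. (dot d (fst \<omega> (s + 1)) v)\<^sup>2)"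
proof (rule ccontr)
  let ?z = "\<lambda>s. expl_vec p s \<omega>" and ?e = "\<lambda>s. snd \<omega> (s + 1)" and ?l = expl_reg
  let ?q = "\<Sum>s<n. (dot d (fst \<omega> (s + 1)) v)\<^sup>2"
  assume "\<not> ?thesis"
  then have le: "?q \<le> 2 * (\<Sum>s<n. ?e s * dot d (fst \<omega> (s + 1)) v)" by simp
  obtain E where E: "onb d E (sep_model p)" "card E \<le> 2 * d0" using onb_sep_model[OF p] by blast
  have dz: "dot d (?z s) v = dot d (fst \<omega> (s + 1)) v" for s
    unfolding expl_vec_def by (rule dot_proj_left[OF E(1) v(1)])
  define S where "S = noise_vec ?z ?e n"
  have "dot d S v = (\<Sum>s<n. ?e s * dot d (fst \<omega> (s + 1)) v)"
    unfolding S_def noise_vec_def dot_sum_left by (simp add: dz)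
  with le have 1: "?q \<le> 2 * dot d S v" by simp
  have 2: "?l * sqnorm d v \<le> ?q"
    using N X v(1) unfolding ill_conditioned_def expl_reg_def by blast
  have q0: "0 < ?q"
  proof -
    have "0 < \<epsilon>0\<^sup>2 / 2" using \<epsilon>0_pos by simp
    then have "0 < sqnorm d v" using v(2) by linarith
    then have "0 < ?l * sqnorm d v" using expl_reg_pos by simp
    then show ?thesis using 2 by linarith
  qed
  have "dot d v (gram_op d ?l (prefix_vecs ?z n) v) = ?l * sqnorm d v + ?q"
  proof -
    have "(\<Sum>z\<leftarrow>prefix_vecs ?z n. (dot d z v)\<^sup>2) = ?q"
      by (simp add: prefix_vecs_def rev_map[symmetric] sum_list_rev o_def dz interv_sum_list_conv_sum_set_nat atLeast0LessThan)
    then show ?thesis by (simp only: dot_gram_op_self)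
  qed
  then have 3: "dot d v (gram_op d ?l (prefix_vecs ?z n) v) \<le> 2 * ?q" using 2 by linarith
  define sn where "sn = self_norm d ?l ?z ?e n"
  have sn: "sn = dot d S (gram_inv d ?l (prefix_vecs ?z n) S)" by (simp add: sn_def self_norm_def S_def)
  have sn0: "0 \<le> sn" unfolding sn using expl_reg_pos by simp
  have "?q\<^sup>2 \<le> (2 * dot d S v)\<^sup>2" using 1 q0 by (intro power_mono) auto
  also have "\<dots> = 4 * (dot d S v)\<^sup>2" by (simp add: power_mult_distrib)
  also have "\<dots> \<le> 4 * (sn * dot d v (gram_op d ?l (prefix_vecs ?z n) v))"
    unfolding sn using dot_squared_le_gram[OF expl_reg_pos, of d S v "prefix_vecs ?z n"] by simp
  also have "\<dots> \<le> 4 * (sn * (2 * ?q))" using 3 sn0 by (intro mult_left_mono) auto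
  finally have "?q * ?q \<le> (8 * sn) * ?q" by (simp add: power2_eq_square)
  then have 4: "?q \<le> 8 * sn" using q0 by (simp only: mult_le_cancel_right_pos)
  let ?D = "gram_det d ?l (prefix_vecs ?z n)"
  have D1: "1 \<le> ?D" by (rule gram_det_ge_1[OF expl_reg_pos])
  have lnD: "ln ?D \<le> 64 * (d0 * \<rho>) + 1"
  proof -
    have "ln ?D \<le> card E * ln (1 + n * Kx / ?l) + 1"
    proof (rule ln_gram_det_le[OF E(1) expl_reg_pos Kx_pos])
      show "set (prefix_vecs ?z n) \<subseteq> sep_model p"
        unfolding set_prefix_vecs expl_vec_def using proj_mem[OF E(1)] by blast
      show "sqnorm d y \<le> Kx" if "y \<in> set (prefix_vecs ?z n)" for y
        using that sqnorm_proj_sep_model_le[OF p] X unfolding set_prefix_vecs expl_vec_def by blast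
    qed simp
    also have "n * Kx / ?l = 32 * \<rho>"
      using n_pos Cmin_pos by (simp add: expl_reg_def \<rho>_def)
    also have "card E * ln (1 + 32 * \<rho>) \<le> (2 * d0) * (32 * \<rho>)"
    proof (intro mult_mono)
      show "ln (1 + 32 * \<rho>) \<le> 32 * \<rho>" using \<rho>_ge_1 by (intro ln_add_one_self_le_self) auto
      show "real (card E) \<le> real (2 * d0)" using E(2) by (rule of_nat_mono)
    qed (use \<rho>_ge_1 in auto)
    finally show ?thesis by (simp add: mult_ac)
  qed
  have "exp (sn / (2 * \<sigma>\<^sup>2)) \<le> fail * sqrt ?D"
    using lik D1 by (simp add: lik_def sn_def field_simps)
  then have "sn / (2 * \<sigma>\<^sup>2) \<le> ln (fail * sqrt ?D)"
    using fail_ge D1 by (subst ln_ge_iff) auto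
  also have "\<dots> = ln fail + ln ?D / 2"
    using fail_ge D1 by (simp add: ln_mult ln_sqrt)
  \<comment> \<open>Half of \<open>64 * (d0 * \<rho>) + 1\<close> is at most 64 + 1 times
    \<open>\<rho> * (d0 * lg)\<close>.\<close>
  also have "\<dots> \<le> (C3 + 65) * (\<rho> * (d0 * lg))"
  proof -
    have "C3 * (d0 * lg) \<le> C3 * (\<rho> * (d0 * lg))" using C3_pos \<rho>d0lg_ge(2) by (intro mult_left_mono) auto
    then have a: "ln fail \<le> C3 * (\<rho> * (d0 * lg))" using ln_fail_le by (simp add: C3_def)
    have "\<rho> * d0 * (1 / 2) \<le> \<rho> * d0 * lg" using \<rho>_ge_1 lg_ge by (intro mult_left_mono) auto
    then have "d0 * \<rho> \<le> 2 * (\<rho> * (d0 * lg))" by (simp add: mult_ac)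
    then show ?thesis using a lnD \<rho>d0lg_ge(1) by (simp add: distrib_right)
  qed
  finally have "sn \<le> 2 * \<sigma>\<^sup>2 * ((C3 + 65) * (\<rho> * (d0 * lg)))"
    using \<sigma>_pos by (simp add: field_simps)
  then have 5: "?q \<le> 16 * \<sigma>\<^sup>2 * ((C3 + 65) * (\<rho> * (d0 * lg)))" using 4 by simp
  have "?l * (\<epsilon>0\<^sup>2 / 2) \<le> ?l * sqnorm d v" using v(2) expl_reg_pos by (intro mult_left_mono) auto
  moreover have "?l * (\<epsilon>0\<^sup>2 / 2) = n * Cmin * \<epsilon>0\<^sup>2 / 64" by (simp add: expl_reg_def)
  ultimately have "n * Cmin * \<epsilon>0\<^sup>2 \<le> 64 * ?q" using 2 by linarith
  then have "1024 * \<sigma>\<^sup>2 * ((C3 + 66) * (\<rho> * (d0 * lg))) \<le> 64 * (16 * \<sigma>\<^sup>2 * ((C3 + 65) * (\<rho> * (d0 * lg))))"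
    using 5 n_signal by linarith
  then have "\<sigma>\<^sup>2 * (\<rho> * (d0 * lg)) \<le> 0" by (simp add: algebra_simps)
  moreover have "0 < \<sigma>\<^sup>2 * (\<rho> * (d0 * lg))" using \<sigma>_pos \<rho>_ge_1 d0_ge_1 lg_ge(1) by (intro mult_pos_pos) auto
  ultimately show False by linarith
qed

lemma wrong_model_confusion:
  assumes "least_squares_selector d Q n sel" "\<theta> \<notin> selected_model d \<theta> n sel pol \<omega>"
  shows "\<exists>p\<in>Q. \<exists>v\<in>sep_model p. \<epsilon>0\<^sup>2 / 2 \<le> sqnorm d v \<and>
    (\<Sum>s<n. (dot d (fst \<omega> (s + 1)) v)\<^sup>2) \<le> 2 * (\<Sum>s<n. snd \<omega> (s + 1) * dot d (fst \<omega> (s + 1)) v)"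
proof -
  define h where "h = run d \<theta> n pol n \<omega>"
  have h: "h = map (\<lambda>s. (fst \<omega> (s + 1), dot d (fst \<omega> (s + 1)) \<theta> + snd \<omega> (s + 1))) [0..<n]"
    unfolding h_def run_eq_map by (intro map_cong refl) (auto simp: arm_at_Suc)
  have sum: "(\<Sum>p\<leftarrow>h. (snd p - dot d (fst p) \<beta>)\<^sup>2)
      = (\<Sum>s<n. (snd \<omega> (s + 1) - dot d (fst \<omega> (s + 1)) (\<beta> - \<theta>))\<^sup>2)" for \<beta>
    unfolding h by (simp add: o_def interv_sum_list_conv_sum_set_nat atLeast0LessThan algebra_simps)
  have min: "is_arg_min (residual d h) (\<lambda>m. m \<in> models d Q) (sel h)"
    using assms(1) unfolding least_squares_selector_def h_def by simp
  then obtain p where p: "p \<in> Q" "sel h = fixed_space d p"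
    unfolding is_arg_min_def models_def by blast
  have np: "\<theta> \<notin> fixed_space d p" using assms(2) p(2) by (simp add: selected_model_def h_def)
  obtain E where E: "onb d E (fixed_space d p)" using onb_fixed_space[OF Q_partition[OF p(1)]] by blast
  obtain F where F: "onb d F (fixed_space d orbs)" using onb_fixed_space[OF Q_partition[OF orbs_in_Q]] by blast
  obtain \<beta> where \<beta>: "\<beta> \<in> fixed_space d p" "residual d h (fixed_space d p) = (\<Sum>p\<leftarrow>h. (snd p - dot d (fst p) \<beta>)\<^sup>2)"
    using residual_properties(2)[OF E] by blast
  have "residual d h (fixed_space d p) \<le> residual d h (fixed_space d orbs)"
    using min orbs_in_Q unfolding is_arg_min_def p(2) models_def by (force simp: not_less)
  also have "\<dots> \<le> (\<Sum>p\<leftarrow>h. (snd p - dot d (fst p) \<theta>)\<^sup>2)"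
    by (rule residual_properties(1)[OF F \<theta>_in_orbit_space])
  finally have "(\<Sum>s<n. (snd \<omega> (s + 1) - dot d (fst \<omega> (s + 1)) (\<beta> - \<theta>))\<^sup>2) \<le> (\<Sum>s<n. (snd \<omega> (s + 1))\<^sup>2)"
    unfolding \<beta>(2) sum by simp
  also have "(\<Sum>s<n. (snd \<omega> (s + 1) - dot d (fst \<omega> (s + 1)) (\<beta> - \<theta>))\<^sup>2) = (\<Sum>s<n. (snd \<omega> (s + 1))\<^sup>2)
      - 2 * (\<Sum>s<n. snd \<omega> (s + 1) * dot d (fst \<omega> (s + 1)) (\<beta> - \<theta>)) + (\<Sum>s<n. (dot d (fst \<omega> (s + 1)) (\<beta> - \<theta>))\<^sup>2)"
    by (simp only: power2_diff sum.distrib sum_subtractf sum_distrib_left mult.assoc)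
  finally have le: "(\<Sum>s<n. (dot d (fst \<omega> (s + 1)) (\<beta> - \<theta>))\<^sup>2)
      \<le> 2 * (\<Sum>s<n. snd \<omega> (s + 1) * dot d (fst \<omega> (s + 1)) (\<beta> - \<theta>))" by linarith
  obtain H where H: "onb d H (sep_model p)" using onb_sep_model[OF p(1)] by blast
  have "\<beta> - \<theta> \<in> sep_model p"
    using \<beta>(1) \<theta>_in_orbit_space fixed_space_subset_sep_model[of p] by (intro subspace_diff onbD(2)[OF H]) auto
  moreover have "sqnorm d (\<beta> - \<theta>) = sqnorm d (\<theta> - \<beta>)"
    using sqnorm_scaleR[of d "- 1" "\<theta> - \<beta>"] by simp
  ultimately show ?thesis using sqnorm_model_diff_ge[OF p(1) np \<beta>(1)] le p(1) by (intro bexI[of _ p] bexI[of _ "\<beta> - \<theta>"]) auto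
qed

lemma measure_wrong_model_le:
  assumes "least_squares_selector d Q n sel"
    and "selected_model d \<theta> n sel pol \<in> P \<rightarrow>\<^sub>M count_space (models d Q)"
  shows "{\<omega> \<in> space P. \<theta> \<notin> selected_model d \<theta> n sel pol \<omega>} \<in> sets P"
    and "measure P {\<omega> \<in> space P. \<theta> \<notin> selected_model d \<theta> n sel pol \<omega>} \<le> 1 / T"
proof -
  let ?W = "{\<omega> \<in> space P. \<theta> \<notin> selected_model d \<theta> n sel pol \<omega>}"
  have "?W = selected_model d \<theta> n sel pol -` {m \<in> models d Q. \<theta> \<notin> m} \<inter> space P"
    using measurable_space[OF assms(2)] by auto
  then show W: "?W \<in> sets P" using measurable_sets[OF assms(2), of "{m \<in> models d Q. \<theta> \<notin> m}"] by simp
  have "\<forall>p\<in>Q. \<exists>N. ill_conditioned p n N \<and> measure P N \<le> 1 / fail" using ill_conditioned_small by blast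
  then obtain N where N: "\<And>p. p \<in> Q \<Longrightarrow> ill_conditioned p n (N p)" "\<And>p. p \<in> Q \<Longrightarrow> measure P (N p) \<le> 1 / fail"
    by metis
  \<comment> \<open>The second membership in \<open>space P\<close> and the offset 0 match
    \<open>measure_lik_gt_le\<close> with the trivial event and no preceding rounds.\<close>
  define L where "L p = {\<omega> \<in> space P. \<omega> \<in> space P \<and>
    fail < lik d expl_reg \<sigma> (\<lambda>s. expl_vec p s \<omega>) (\<lambda>s. snd \<omega> (0 + s + 1)) n}" for p
  have L: "L p \<in> sets P \<and> measure P (L p) \<le> 1 / fail" if p: "p \<in> Q" for p
  proof -
    obtain E where E: "onb d E (sep_model p)" using onb_sep_model[OF p] by blast
    have Z: "expl_vec p s \<in> borel_measurable P" for s
      using measurable_proj[OF E measurable_arm[OF sets_\<nu>], of "s + 1" \<sigma>] by (simp add: expl_vec_def[abs_def])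
    have Z': "expl_vec p s (a, b(i := v)) = expl_vec p s (a, b)" for s i a b v by (simp add: expl_vec_def)
    have sp: "(a, b(i := v)) \<in> space P \<longleftrightarrow> (a, b) \<in> space P" for i a b v
      unfolding sample_space_eq by (simp add: space_pair_measure space_PiM)
    show ?thesis
      using measure_lik_gt_le[OF prob_space_\<nu> \<sigma>_pos expl_reg_pos, of n "expl_vec p" 0 "space P" n fail d, OF Z Z' sets.top sp order_refl]
        fail_ge prob_space unfolding L_def by simp
  qed
  have NS: "N p \<in> sets P" if "p \<in> Q" for p using N(1)[OF that] by (simp add: ill_conditioned_def)
  have "AE \<omega> in P. \<omega> \<in> ?W \<longrightarrow> \<omega> \<in> (\<Union>p\<in>Q. N p \<union> L p)"
    using AE_arms
  proof eventually_elim
    case (elim \<omega>)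
    show ?case
    proof (intro impI, rule ccontr)
      assume \<omega>: "\<omega> \<in> ?W" and not: "\<omega> \<notin> (\<Union>p\<in>Q. N p \<union> L p)"
      then have "\<theta> \<notin> selected_model d \<theta> n sel pol \<omega>" by simp
      from wrong_model_confusion[OF assms(1) this] obtain p v where pv: "p \<in> Q" "v \<in> sep_model p" "\<epsilon>0\<^sup>2 / 2 \<le> sqnorm d v"
        "(\<Sum>s<n. (dot d (fst \<omega> (s + 1)) v)\<^sup>2) \<le> 2 * (\<Sum>s<n. snd \<omega> (s + 1) * dot d (fst \<omega> (s + 1)) v)"
        by blast
      have "lik d expl_reg \<sigma> (\<lambda>s. expl_vec p s \<omega>) (\<lambda>s. snd \<omega> (s + 1)) n \<le> fail"
        using not pv(1) \<omega> unfolding L_def by (auto simp: not_less)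
      moreover have "\<omega> \<in> space P - N p" using not pv(1) \<omega> by auto
      ultimately show False
        using no_confusion[OF pv(1) N(1)[OF pv(1)] _ elim _ pv(2,3)] pv(4) by linarith
    qed
  qed
  then have "measure P ?W \<le> measure P (\<Union>p\<in>Q. N p \<union> L p)"
    using NS L finite_Q by (intro finite_measure_mono_AE) auto
  also have "\<dots> \<le> (\<Sum>p\<in>Q. measure P (N p \<union> L p))"
    using NS L finite_Q by (intro finite_measure_subadditive_finite) auto
  also have "\<dots> \<le> (\<Sum>p\<in>Q. 2 / fail)"
  proof (rule sum_mono)
    fix p assume p: "p \<in> Q"
    have "measure P (N p \<union> L p) \<le> measure P (N p) + measure P (L p)"
      using NS[OF p] L[OF p] by (intro measure_Un_le) auto
    then show "measure P (N p \<union> L p) \<le> 2 / fail" using N(2)[OF p] L[OF p] by simp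
  qed
  also have "\<dots> = 1 / T" using card_Q_ge_1 T_ge_2 by (simp add: fail_def)
  finally show "measure P ?W \<le> 1 / T" .
qed

end

section \<open>Regret of OFUL on the selected model\<close>

text \<open>With this regularisation \<open>ln (1 + T * Kx / l)\<close> is still \<open>O(ln T)\<close>, while the bias
  \<open>sqrt l * oful_bound\<close> of the ridge estimate contributes only \<open>O(Rmax * \<rho> * d0)\<close> to the regret.\<close>

definition "oful_reg = Kx / T"
definition "oful_bound = 2 * Rmax / sqrt Cmin"
definition "oful_conf = 1 / real T ^ (16 * d0)"
text \<open>The confidence radius before any OFUL data, when the determinant ratio is 1. All later
  radii stay within a factor 2 of it.\<close>

definition "init_radius = \<sigma> * sqrt (32 * (d0 * ln T)) + sqrt oful_reg * oful_bound"

lemma oful_reg_pos: "0 < oful_reg"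
  using Kx_pos T_ge_2 by (simp add: oful_reg_def)

lemma oful_conf: "0 < oful_conf" "oful_conf < 1"
proof -
  show "0 < oful_conf" using T_ge_2 by (simp add: oful_conf_def)
  have 1: "1 < real T ^ (16 * d0)" using T_ge_2 d0_ge_1 by (intro one_less_power) auto
  then have "0 < real T ^ (16 * d0)" by linarith
  then show "oful_conf < 1" using 1 by (simp only: oful_conf_def divide_less_eq_1_pos)
qed

lemma sqrt_sqnorm_\<theta>_le: "sqrt (sqnorm d \<theta>) \<le> oful_bound / 2"
proof -
  have "sqrt (sqnorm d \<theta>) \<le> sqrt (Rmax\<^sup>2 / Cmin)" by (intro real_sqrt_le_mono sqnorm_\<theta>_le)
  also have "\<dots> = Rmax / sqrt Cmin" using Rmax_pos by (simp add: real_sqrt_divide)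
  finally show ?thesis by (simp add: oful_bound_def)
qed

lemma oful_bound_pos: "0 < oful_bound"
  using Rmax_pos Cmin_pos by (simp add: oful_bound_def)

lemma lnT_ge: "1 / 2 \<le> ln T"
proof -
  have "1 / 2 \<le> ln (2 :: real)" using ln_add_one_ge_half[of 1] by simp
  also have "\<dots> \<le> ln T" using T_ge_2 by simp
  finally show ?thesis .
qed

lemma d0lnT_ge: "ln T \<le> d0 * ln T" "1 / 2 \<le> d0 * ln T"
proof -
  have "1 * ln T \<le> d0 * ln T" using d0_ge_1 lnT_ge by (intro mult_right_mono) auto
  then show "ln T \<le> d0 * ln T" by simp
  then show "1 / 2 \<le> d0 * ln T" using lnT_ge by linarith
qed

lemma init_radius_pos: "0 < init_radius"
proof -
  have "0 < \<sigma> * sqrt (32 * (d0 * ln T))" using \<sigma>_pos d0lnT_ge by simp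
  moreover have "0 \<le> sqrt oful_reg * oful_bound" using oful_reg_pos oful_bound_pos by simp
  ultimately show ?thesis by (simp add: init_radius_def)
qed

lemma sqnorm_proj_model_le:
  assumes "p \<in> Q" "x \<in> X"
  shows "sqnorm d (proj d (fixed_space d p) x) \<le> Kx"
proof -
  obtain E where E: "onb d E (fixed_space d p)" using onb_fixed_space[OF Q_partition[OF assms(1)]] by blast
  have "convex hull (fixed_space d p \<union> fixed_space d p) = fixed_space d p"
    using onbD(2)[OF E] by (simp add: hull_same subspace_imp_convex)
  then have "fixed_space d p \<in> models_bar d Q"
    unfolding models_bar_def models_def using assms(1) by blast
  then show ?thesis using bounded assms(2) by (simp add: bounded_arms_def)
qed

text \<open>The confidence level is so small that the radius exceeds twice the actual estimation error.\<close>

lemma radius_bounds: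
  assumes "0 \<le> lnD" "lnD \<le> 5 * (d0 * ln T)"
  shows "init_radius \<le> \<sigma> * sqrt (2 * (lnD / 2 - ln oful_conf)) + sqrt oful_reg * oful_bound"
    and "\<sigma> * sqrt (2 * (lnD / 2 - ln oful_conf)) + sqrt oful_reg * oful_bound \<le> 2 * init_radius"
    and "2 * (\<sigma> * sqrt (2 * (lnD / 2 + 2 * ln T))) \<le> \<sigma> * sqrt (2 * (lnD / 2 - ln oful_conf))"
proof -
  have lc: "ln oful_conf = - (16 * (d0 * ln T))"
    using T_ge_2 by (simp add: oful_conf_def ln_div ln_realpow)
  have b: "0 \<le> sqrt oful_reg * oful_bound" using oful_reg_pos oful_bound_pos by simp
  have "\<sigma> * sqrt (32 * (d0 * ln T)) \<le> \<sigma> * sqrt (2 * (lnD / 2 - ln oful_conf))"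
    unfolding lc using assms \<sigma>_pos by (intro mult_left_mono real_sqrt_le_mono) auto
  then show "init_radius \<le> \<sigma> * sqrt (2 * (lnD / 2 - ln oful_conf)) + sqrt oful_reg * oful_bound"
    by (simp add: init_radius_def)
  have "\<sigma> * sqrt (2 * (lnD / 2 - ln oful_conf)) \<le> \<sigma> * sqrt (4 * (32 * (d0 * ln T)))"
    unfolding lc using assms \<sigma>_pos d0lnT_ge by (intro mult_left_mono real_sqrt_le_mono) auto
  also have "\<dots> = 2 * (\<sigma> * sqrt (32 * (d0 * ln T)))"
    by (simp only: real_sqrt_mult[of 4]) simp
  finally show "\<sigma> * sqrt (2 * (lnD / 2 - ln oful_conf)) + sqrt oful_reg * oful_bound \<le> 2 * init_radius"
    using b unfolding init_radius_def distrib_left by linarith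
  \<comment> \<open>Here the exponent \<open>16 * d0\<close> of \<open>oful_conf\<close> is used: 4
    \<open>lnD\<close> + 16 \<open>ln T\<close> has to be at most \<open>lnD\<close> + 32
    \<open>d0 * ln T\<close>, and 3 * 5 + 16 = 31.\<close>
  have "2 * sqrt (2 * (lnD / 2 + 2 * ln T)) = sqrt (4 * (2 * (lnD / 2 + 2 * ln T)))"
    by (simp only: real_sqrt_mult[of 4]) simp
  also have "\<dots> \<le> sqrt (2 * (lnD / 2 - ln oful_conf))"
    unfolding lc using assms d0lnT_ge by (intro real_sqrt_le_mono) auto
  finally have "\<sigma> * (2 * sqrt (2 * (lnD / 2 + 2 * ln T))) \<le> \<sigma> * sqrt (2 * (lnD / 2 - ln oful_conf))"
    using \<sigma>_pos by (intro mult_left_mono) auto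
  then show "2 * (\<sigma> * sqrt (2 * (lnD / 2 + 2 * ln T))) \<le> \<sigma> * sqrt (2 * (lnD / 2 - ln oful_conf))" by simp
qed

section \<open>One run of the algorithm with these OFUL parameters\<close>

context
  fixes t2 :: nat and sel :: "history \<Rightarrow> vector set" and pol :: "history \<Rightarrow> vector"
  assumes etc: "explore_then_commit d X \<theta> Q \<nu> \<sigma> oful_reg oful_bound oful_conf T t2 sel pol"
begin

lemma oful_arm_run:
  assumes "\<And>s. s < n \<Longrightarrow> arm_at d \<theta> t2 pol (s + 1) \<omega> \<in> X" "t2 \<le> n" "n < T"
  shows "oful_arm d X \<sigma> oful_reg oful_bound oful_conf (sel (run d \<theta> t2 pol t2 \<omega>)) (drop t2 (run d \<theta> t2 pol n \<omega>))
    (arm_at d \<theta> t2 pol (n + 1) \<omega>)"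
proof -
  have X: "fst ` set (run d \<theta> t2 pol n \<omega>) \<subseteq> X"
    unfolding run_eq_map using assms(1) by auto
  have "take t2 (run d \<theta> t2 pol n \<omega>) = run d \<theta> t2 pol t2 \<omega>"
    using take_run[of t2 d \<theta> pol "n - t2" \<omega>] assms(2) by simp
  moreover have "arm_at d \<theta> t2 pol (n + 1) \<omega> = pol (run d \<theta> t2 pol n \<omega>)"
    using assms(2) arm_at_Suc[of d \<theta> t2 pol n \<omega>] by simp
  ultimately show ?thesis
    using etc X assms(2,3) unfolding explore_then_commit_def oful_after_exploration_def by (metis length_run)
qed

text \<open>By induction on the number of rounds, as the policy is prescribed only on histories
  whose arms lie in \<open>X\<close>.\<close>

lemma arm_at_in_X:
  assumes "\<forall>s. fst \<omega> s \<in> X" "n \<le> T" "s < n"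
  shows "arm_at d \<theta> t2 pol (s + 1) \<omega> \<in> X"
  using assms(2,3)
proof (induction n arbitrary: s)
  case (Suc n)
  show ?case
  proof (cases "s < n")
    case True
    then show ?thesis using Suc by simp
  next
    case False
    then have s: "s = n" using Suc by simp
    show ?thesis
    proof (cases "Suc n \<le> t2")
      case True
      then show ?thesis unfolding s using arm_at_Suc[of d \<theta> t2 pol n \<omega>] assms(1) by simp
    next
      case False
      have "oful_arm d X \<sigma> oful_reg oful_bound oful_conf (sel (run d \<theta> t2 pol t2 \<omega>)) (drop t2 (run d \<theta> t2 pol n \<omega>))
        (arm_at d \<theta> t2 pol (n + 1) \<omega>)"
        using Suc False by (intro oful_arm_run) auto
      then show ?thesis unfolding s oful_arm_def is_arg_max_def by blast
    qed
  qed
qed simp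

definition "oful_vec p s \<omega> = proj d (fixed_space d p) (arm_at d \<theta> t2 pol (t2 + s + 1) \<omega>)"

text \<open>The deterministic part: as long as the martingale stays below \<open>T\<^sup>2\<close>,
  the estimation error is at most half of the radius and optimism applies in every round. With
  \<open>oful_reg\<close> the ratio \<open>T * Kx / ?l\<close> is \<open>T\<^sup>2\<close>, which
  gives the bound \<open>5 * (d0 * ln T)\<close> on the log determinants.\<close>

lemma oful_phase_regret:
  assumes p: "p \<in> Q" "sel (run d \<theta> t2 pol t2 \<omega>) = fixed_space d p" "\<theta> \<in> fixed_space d p"
    and X: "\<forall>s. fst \<omega> s \<in> X" and N: "t2 + N \<le> T"
    and lik: "\<And>k. k < N \<Longrightarrow> lik d oful_reg \<sigma> (\<lambda>s. oful_vec p s \<omega>) (\<lambda>s. snd \<omega> (t2 + s + 1)) k \<le> (real T)\<^sup>2"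
  shows "(\<Sum>s<N. dot d (xs - arm_at d \<theta> t2 pol (t2 + s + 1) \<omega>) \<theta>)
    \<le> 20 * Rmax * (d0 * ln T) + 582 * init_radius * sqrt (real d0 * real N)"
proof -
  let ?m = "fixed_space d p" and ?l = oful_reg
  let ?x = "\<lambda>s. arm_at d \<theta> t2 pol (t2 + s + 1) \<omega>" and ?z = "\<lambda>s. oful_vec p s \<omega>" and ?e = "\<lambda>s. snd \<omega> (t2 + s + 1)"
  obtain E where E: "onb d E ?m" "card E \<le> d0"
    using onb_fixed_space[OF Q_partition[OF p(1)]] Q_card_le[OF p(1)] order_trans by metis
  have xX: "?x s \<in> X" if "s < N" for s
    using arm_at_in_X[OF X, of T "t2 + s"] N that by simp
  have z: "?z s = proj d ?m (?x s)" for s by (simp add: oful_vec_def)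
  define D where "D k = gram_det d ?l (prefix_vecs ?z k)" for k
  have D1: "1 \<le> D k" for k unfolding D_def by (rule gram_det_ge_1[OF oful_reg_pos])
  have lnD: "0 \<le> ln (D k)" "ln (D k) \<le> 5 * (d0 * ln T)" if "k \<le> N" for k
  proof -
    show "0 \<le> ln (D k)" using D1[of k] by simp
    have "ln (D k) \<le> card E * ln (1 + T * Kx / ?l) + 1"
      unfolding D_def
    proof (rule ln_gram_det_le[OF E(1) oful_reg_pos Kx_pos])
      show "set (prefix_vecs ?z k) \<subseteq> ?m"
        unfolding set_prefix_vecs z using proj_mem[OF E(1)] by blast
      show "sqnorm d y \<le> Kx" if "y \<in> set (prefix_vecs ?z k)" for y
        using that sqnorm_proj_model_le[OF p(1)] xX \<open>k \<le> N\<close> unfolding set_prefix_vecs z by force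
      show "length (prefix_vecs ?z k) \<le> T" using \<open>k \<le> N\<close> N by simp
    qed
    also have "T * Kx / ?l = real T ^ 2"
      using T_ge_2 Kx_pos by (simp add: oful_reg_def power2_eq_square)
    also have "card E * ln (1 + real T ^ 2) \<le> d0 * (3 * ln T)"
    proof (intro mult_mono)
      have "1 + real T ^ 2 \<le> real T ^ 3"
      proof -
        have "2 * real T ^ 2 \<le> real T * real T ^ 2" using T_ge_2 by (intro mult_right_mono) auto
        moreover have "1 \<le> real T ^ 2" using T_ge_2 by simp
        ultimately show ?thesis by (simp add: power3_eq_cube power2_eq_square)
      qed
      then have "ln (1 + real T ^ 2) \<le> ln (real T ^ 3)"
        using T_ge_2 by (subst ln_le_cancel_iff) (auto intro!: add_pos_nonneg)
      then show "ln (1 + real T ^ 2) \<le> 3 * ln T" using T_ge_2 by (simp add: ln_realpow)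
    qed (use E(2) T_ge_2 in auto)
    finally show "ln (D k) \<le> 5 * (d0 * ln T)" using d0lnT_ge lnT_ge by linarith
  qed
  have noise: "inorm d ?l (prefix_vecs ?z k) (noise_vec ?z ?e k) \<le> \<sigma> * sqrt (2 * (ln (D k) / 2 + 2 * ln T))"
    if "k < N" for k
  proof -
    let ?s = "self_norm d ?l ?z ?e k"
    have "exp (?s / (2 * \<sigma>\<^sup>2)) \<le> (real T)\<^sup>2 * sqrt (D k)"
      using lik[OF that] D1[of k] by (simp add: lik_def D_def[symmetric] field_simps)
    then have "?s / (2 * \<sigma>\<^sup>2) \<le> ln ((real T)\<^sup>2 * sqrt (D k))"
      using T_ge_2 D1[of k] by (subst ln_ge_iff) auto
    also have "\<dots> = ln (D k) / 2 + 2 * ln T"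
      using T_ge_2 D1[of k] by (simp add: ln_mult ln_sqrt ln_realpow)
    finally have "?s \<le> \<sigma>\<^sup>2 * (2 * (ln (D k) / 2 + 2 * ln T))"
      using \<sigma>_pos by (simp add: field_simps)
    then have "sqrt ?s \<le> sqrt (\<sigma>\<^sup>2 * (2 * (ln (D k) / 2 + 2 * ln T)))" by (rule real_sqrt_le_mono)
    also have "\<dots> = \<sigma> * sqrt (2 * (ln (D k) / 2 + 2 * ln T))"
      using \<sigma>_pos by (simp only: real_sqrt_mult real_sqrt_abs abs_of_pos)
    finally show ?thesis by (simp only: inorm_def self_norm_def)
  qed
  define h where "h s = drop t2 (run d \<theta> t2 pol (t2 + s) \<omega>)" for s
  have h: "h s = map (\<lambda>s. (?x s, dot d (?x s) \<theta> + ?e s)) [0..<s]" for s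
    unfolding h_def by (rule drop_run)
  have projs: "arm_projs d ?m (h s) = prefix_vecs ?z s" for s
    by (simp add: arm_projs_def h prefix_vecs_def o_def oful_vec_def)
  have nsum: "noise_sum d ?m \<theta> (h s) = noise_vec ?z ?e s" for s
    by (simp add: noise_sum_def h noise_vec_def o_def oful_vec_def interv_sum_list_conv_sum_set_nat atLeast0LessThan)
  define \<beta> where "\<beta> s = confidence_radius d \<sigma> ?l oful_bound oful_conf (gram d ?l ?m (h s))" for s
  have \<beta>: "\<beta> s = \<sigma> * sqrt (2 * (ln (D s) / 2 - ln oful_conf)) + sqrt ?l * oful_bound" for s
    unfolding \<beta>_def gram_eq projs confidence_radius_gram_mat[OF oful_reg_pos] D_def[symmetric]
    using D1[of s] oful_conf by (simp add: ln_div ln_sqrt)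
  have \<beta>b: "init_radius \<le> \<beta> s \<and> \<beta> s \<le> 2 * init_radius" if "s < N" for s
    unfolding \<beta> using radius_bounds(1,2)[OF lnD] that by simp
  have opt: "dot d x' \<theta> + \<beta> s / 2 * inorm d ?l (prefix_vecs ?z s) (proj d ?m x')
      \<le> dot d (?x s) \<theta> + 3 / 2 * \<beta> s * bonus d ?l ?z s" if s: "s < N" and x': "x' \<in> X" for s x'
  proof -
    have oa: "oful_arm d X \<sigma> ?l oful_bound oful_conf ?m (h s) (?x s)"
      using oful_arm_run[of "t2 + s" \<omega>] arm_at_in_X[OF X, of T] N s p(2) by (simp add: h_def)
    have "vnorm d ?l (arm_projs d ?m (h s)) (\<theta> - ridge d ?l ?m (h s))
        \<le> sqrt ?l * sqrt (sqnorm d \<theta>) + inorm d ?l (prefix_vecs ?z s) (noise_vec ?z ?e s)"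
      using ridge_error[OF E(1) oful_reg_pos p(3), of "h s"] unfolding projs nsum .
    also have "\<dots> \<le> sqrt ?l * (oful_bound / 2) + \<sigma> * sqrt (2 * (ln (D s) / 2 + 2 * ln T))"
      using sqrt_sqnorm_\<theta>_le oful_reg_pos noise[OF s] by (intro add_mono mult_left_mono) auto
    also have "\<dots> \<le> \<beta> s / 2"
      unfolding \<beta> using radius_bounds(3)[OF lnD[of s]] s by simp
    finally have err: "vnorm d ?l (arm_projs d ?m (h s)) (\<theta> - ridge d ?l ?m (h s)) \<le> \<beta> s / 2" .
    have \<beta>0: "0 \<le> \<beta> s" using \<beta>b[OF s] init_radius_pos by linarith
    show ?thesis
      using oful_arm_optimistic(2)[OF E(1) oful_reg_pos p(3) oa \<beta>_def \<beta>0 err x']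
      unfolding projs bonus_def z .
  qed
  have "(\<Sum>s<N. dot d (xs - ?x s) \<theta>)
      \<le> 4 * Rmax * ln (D N) + 582 * init_radius * sqrt (real d0 * real N)"
    unfolding D_def
    by (rule optimistic_regret[where X=X and z="?z" and M="?m" and \<beta>=\<beta>, OF E d0_ge_1 oful_reg_pos xX z xs_X xs_best Rmax_ge init_radius_pos \<beta>b opt])
  moreover have "4 * Rmax * ln (D N) \<le> 4 * Rmax * (5 * (d0 * ln T))"
    using lnD(2)[of N] Rmax_pos by (intro mult_left_mono) auto
  ultimately show ?thesis by simp
qed

definition "wrong = {\<omega> \<in> space P. \<theta> \<notin> selected_model d \<theta> t2 sel pol \<omega>}"
definition "selected m = {\<omega> \<in> space P. selected_model d \<theta> t2 sel pol \<omega> = m}"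
text \<open>One factor \<open>T\<close> of the threshold is spent on the union over rounds, the
  other is the resulting failure probability.\<close>

definition "deviant p k = {\<omega> \<in> space P. \<omega> \<in> selected (fixed_space d p) \<and>
  (real T)\<^sup>2 < lik d oful_reg \<sigma> (\<lambda>s. oful_vec p s \<omega>) (\<lambda>s. snd \<omega> (t2 + s + 1)) k}"

lemma selected_sets: "m \<in> models d Q \<Longrightarrow> selected m \<in> sets P"
proof -
  assume m: "m \<in> models d Q"
  have sm: "selected_model d \<theta> t2 sel pol \<in> P \<rightarrow>\<^sub>M count_space (models d Q)"
    using etc by (simp add: explore_then_commit_def)
  have "selected m = selected_model d \<theta> t2 sel pol -` {m} \<inter> space P" by (auto simp: selected_def)
  then show ?thesis using measurable_sets[OF sm, of "{m}"] m by simp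
qed

text \<open>The selected model depends on noise up to round \<open>t2\<close> only, so its event can
  serve as the weight of a martingale started at that round.\<close>

lemma deviant:
  assumes "p \<in> Q" "t2 + k \<le> T"
  shows "deviant p k \<in> sets P" "measure P (deviant p k) \<le> measure P (selected (fixed_space d p)) / (real T)\<^sup>2"
proof -
  obtain E where E: "onb d E (fixed_space d p)" using onb_fixed_space[OF Q_partition[OF assms(1)]] by blast
  have m: "fixed_space d p \<in> models d Q" using assms(1) by (simp add: models_def)
  have Z: "oful_vec p s \<in> borel_measurable P" if "s < k" for s
  proof -
    have "arm_at d \<theta> t2 pol (t2 + s + 1) \<in> borel_measurable P"
      using etc that assms(2) by (auto simp: explore_then_commit_def)
    from measurable_proj[OF E this] show ?thesis by (simp add: oful_vec_def[abs_def])
  qed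
  have Z': "oful_vec p s (a, b(i := v)) = oful_vec p s (a, b)" if "t2 + s < i" for s i a b v
    using arm_at_noise_upd[OF that, of d \<theta> t2 pol a b v] by (simp add: oful_vec_def)
  have A': "(a, b(i := v)) \<in> selected (fixed_space d p) \<longleftrightarrow> (a, b) \<in> selected (fixed_space d p)" if "t2 < i" for i a b v
    using run_noise_upd[OF that, of d \<theta> t2 pol a b v]
    unfolding selected_def selected_model_def sample_space_eq by (simp add: space_pair_measure space_PiM)
  have T: "0 < (real T)\<^sup>2" using T_ge_2 by simp
  note m = measure_lik_gt_le[OF prob_space_\<nu> \<sigma>_pos oful_reg_pos Z Z' selected_sets[OF m] A' order_refl T]
  show "deviant p k \<in> sets P" unfolding deviant_def by (rule m(1))
  show "measure P (deviant p k) \<le> measure P (selected (fixed_space d p)) / (real T)\<^sup>2"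
    unfolding deviant_def by (rule m(2))
qed

text \<open>The events are disjoint; this replaces a union bound over the models.\<close>

lemma sum_selected_le: "(\<Sum>m\<in>models d Q. measure P (selected m)) \<le> 1"
proof -
  have "(\<Sum>m\<in>models d Q. measure P (selected m)) = measure P (\<Union>m\<in>models d Q. selected m)"
    using finite_Q selected_sets
    by (intro finite_measure_finite_Union[symmetric]) (auto simp: models_def disjoint_family_on_def selected_def)
  then show ?thesis by simp
qed

text \<open>Exploratory rounds cost at most \<open>2 * Rmax\<close> each. A wrong model and a
  deviating noise have probability at most \<open>1 / T\<close> each, and either costs at most
  \<open>2 * Rmax * T\<close>, hence the summand \<open>4 * Rmax\<close>.\<close>

lemma expected_regret_le:
  assumes wrong: "wrong \<in> sets P" "measure P wrong \<le> 1 / T"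
  shows "expected_regret d \<theta> xs \<nu> \<sigma> T t2 pol \<le>
    2 * Rmax * t2 + (20 * Rmax * (d0 * ln T) + 582 * init_radius * sqrt (real d0 * real T)) + 4 * Rmax"
proof -
  define Gd where "Gd = 20 * Rmax * (d0 * ln T) + 582 * init_radius * sqrt (real d0 * real T)"
  define r where "r \<omega> t = dot d (xs - arm_at d \<theta> t2 pol t \<omega>) \<theta>" for \<omega> t
  define R where "R \<omega> = (\<Sum>t=1..T. r \<omega> t)" for \<omega>
  define N where "N = T - t2"
  \<comment> \<open>Indexed by models, with one chosen partition for each, so that disjointness of
    the events \<open>selected m\<close> applies directly.\<close>
  define dev where "dev = (\<Union>m\<in>models d Q. \<Union>k<N. deviant (SOME p. p \<in> Q \<and> fixed_space d p = m) k)"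
  have Gd0: "0 \<le> Gd"
    unfolding Gd_def using Rmax_pos lnT_ge init_radius_pos by (intro add_nonneg_nonneg mult_nonneg_nonneg) auto
  have rep: "(SOME p. p \<in> Q \<and> fixed_space d p = m) \<in> Q" "fixed_space d (SOME p. p \<in> Q \<and> fixed_space d p = m) = m"
    if "m \<in> models d Q" for m
    using that someI_ex[of "\<lambda>p. p \<in> Q \<and> fixed_space d p = m"] by (auto simp: models_def)
  have fm: "finite (models d Q)" using finite_Q by (simp add: models_def)
  have dev_sets: "dev \<in> sets P"
    unfolding dev_def using fm rep(1) deviant(1) by (intro sets.finite_UN) (auto simp: N_def)
  have "measure P dev \<le> (\<Sum>m\<in>models d Q. measure P (\<Union>k<N. deviant (SOME p. p \<in> Q \<and> fixed_space d p = m) k))"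
    unfolding dev_def using fm rep(1) deviant(1)
    by (intro finite_measure_subadditive_finite) (auto simp: N_def intro!: sets.finite_UN)
  also have "\<dots> \<le> (\<Sum>m\<in>models d Q. measure P (selected m) * (1 / T))"
  proof (rule sum_mono)
    fix m assume m: "m \<in> models d Q"
    let ?p = "SOME p. p \<in> Q \<and> fixed_space d p = m"
    have "measure P (\<Union>k<N. deviant ?p k) \<le> (\<Sum>k<N. measure P (deviant ?p k))"
      using deviant(1)[OF rep(1)[OF m]] by (intro finite_measure_subadditive_finite) (auto simp: N_def)
    also have "\<dots> \<le> (\<Sum>k<N. measure P (selected m) / (real T)\<^sup>2)"
      using deviant(2)[OF rep(1)[OF m]] rep(2)[OF m] by (intro sum_mono) (simp add: N_def)
    also have "\<dots> = N * (measure P (selected m) / (real T)\<^sup>2)" by simp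
    also have "\<dots> \<le> T * (measure P (selected m) / (real T)\<^sup>2)"
      by (intro mult_right_mono) (auto simp: N_def)
    also have "\<dots> = measure P (selected m) * (1 / T)" using T_ge_2 by (simp add: power2_eq_square)
    finally show "measure P (\<Union>k<N. deviant ?p k) \<le> measure P (selected m) * (1 / T)" .
  qed
  also have "\<dots> = (\<Sum>m\<in>models d Q. measure P (selected m)) * (1 / T)" by (simp only: sum_distrib_right)
  also have "\<dots> \<le> 1 * (1 / T)" using sum_selected_le by (intro mult_right_mono) auto
  finally have dev_le: "measure P dev \<le> 1 / T" by simp
  have r_le: "\<bar>r \<omega> t\<bar> \<le> 2 * Rmax" if "\<forall>s. fst \<omega> s \<in> X" "t \<in> {1..T}" for \<omega> t
  proof -
    have "arm_at d \<theta> t2 pol (t - 1 + 1) \<omega> \<in> X" using arm_at_in_X[OF that(1), of T "t - 1"] that(2) by auto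
    then have "arm_at d \<theta> t2 pol t \<omega> \<in> X" using that(2) by simp
    then show ?thesis using Rmax_ge[OF xs_X] Rmax_ge[of "arm_at d \<theta> t2 pol t \<omega>"] by (simp add: r_def)
  qed
  have R_le: "\<bar>R \<omega>\<bar> \<le> 2 * Rmax * T" if "\<forall>s. fst \<omega> s \<in> X" for \<omega>
  proof -
    have "\<bar>R \<omega>\<bar> \<le> (\<Sum>t=1..T. \<bar>r \<omega> t\<bar>)" unfolding R_def by (rule sum_abs)
    also have "\<dots> \<le> (\<Sum>t=1..T. 2 * Rmax)" by (intro sum_mono r_le that)
    finally show ?thesis by (simp add: mult_ac)
  qed
  have good: "R \<omega> \<le> 2 * Rmax * t2 + Gd" if X: "\<forall>s. fst \<omega> s \<in> X" and \<omega>: "\<omega> \<in> space P" "\<omega> \<notin> wrong" "\<omega> \<notin> dev" for \<omega>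
  proof (cases "t2 \<le> T")
    case False
    \<comment> \<open>If the exploration outlasts the horizon, its own term already covers all
      \<open>T\<close> rounds.\<close>
    have "R \<omega> \<le> 2 * Rmax * T" using R_le[OF X] by simp
    also have "\<dots> \<le> 2 * Rmax * t2" using False Rmax_pos by (intro mult_left_mono) auto
    finally show ?thesis using Gd0 by linarith
  next
    case True
    let ?m = "selected_model d \<theta> t2 sel pol \<omega>"
    have sm: "selected_model d \<theta> t2 sel pol \<in> P \<rightarrow>\<^sub>M count_space (models d Q)"
      using etc by (simp add: explore_then_commit_def)
    have m: "?m \<in> models d Q" using measurable_space[OF sm \<omega>(1)] by simp
    define p where "p = (SOME p. p \<in> Q \<and> fixed_space d p = ?m)"
    have p: "p \<in> Q" "fixed_space d p = ?m" unfolding p_def using rep[OF m] by blast+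
    have \<theta>m: "\<theta> \<in> fixed_space d p" using \<omega>(1,2) unfolding p(2) by (simp add: wrong_def)
    have lik: "lik d oful_reg \<sigma> (\<lambda>s. oful_vec p s \<omega>) (\<lambda>s. snd \<omega> (t2 + s + 1)) k \<le> (real T)\<^sup>2" if "k < N" for k
    proof (rule ccontr)
      assume "\<not> ?thesis"
      then have "\<omega> \<in> deviant p k" unfolding deviant_def selected_def p(2) using \<omega>(1) by simp
      then have "\<omega> \<in> dev" unfolding dev_def p_def using m that by blast
      then show False using \<omega>(3) by contradiction
    qed
    have TN: "T = t2 + N" using True by (simp add: N_def)
    have "R \<omega> = (\<Sum>s<T. r \<omega> (s + 1))"
      unfolding R_def by (simp add: sum.atLeast1_atMost_eq)
    also have "\<dots> = (\<Sum>s<t2. r \<omega> (s + 1)) + (\<Sum>s<N. r \<omega> (t2 + s + 1))"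
      unfolding TN by (induction N) auto
    also have "(\<Sum>s<t2. r \<omega> (s + 1)) \<le> (\<Sum>s<t2. 2 * Rmax)"
    proof (rule sum_mono)
      fix s assume "s \<in> {..<t2}"
      then have "s + 1 \<in> {1..T}" using True by simp
      then have "\<bar>r \<omega> (s + 1)\<bar> \<le> 2 * Rmax" by (rule r_le[OF X])
      then show "r \<omega> (s + 1) \<le> 2 * Rmax" by linarith
    qed
    also have "(\<Sum>s<N. r \<omega> (t2 + s + 1)) \<le> 20 * Rmax * (d0 * ln T) + 582 * init_radius * sqrt (real d0 * real N)"
      unfolding r_def
      by (rule oful_phase_regret[OF p(1) _ \<theta>m X _ lik]) (use p(2) TN in \<open>auto simp: selected_model_def\<close>)
    also have "\<dots> \<le> Gd"
      unfolding Gd_def using init_radius_pos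
      by (intro add_left_mono mult_left_mono real_sqrt_le_mono) (auto simp: N_def)
    finally show ?thesis by (simp add: mult.commute)
  qed
  have meas: "R \<in> borel_measurable P"
  proof -
    have "arm_at d \<theta> t2 pol t \<in> borel_measurable P" if "t \<in> {1..T}" for t
      using etc that by (simp add: explore_then_commit_def)
    then show ?thesis
      unfolding R_def[abs_def] r_def
      by (intro borel_measurable_sum measurable_dot measurable_vector_diff measurable_const) simp_all
  qed
  let ?U = "\<lambda>\<omega>. 2 * Rmax * t2 + Gd + 2 * Rmax * T * (indicator wrong \<omega> + indicator dev \<omega>)"
  have intR: "integrable P R"
    by (rule integrable_const_bound[of _ "2 * Rmax * T"])
      (use AE_arms R_le meas in \<open>auto elim!: eventually_mono\<close>)
  have ind: "integrable P (indicator wrong :: _ \<Rightarrow> real)" "integrable P (indicator dev :: _ \<Rightarrow> real)"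
    using wrong(1) dev_sets by (auto intro!: integrable_real_indicator simp: emeasure_eq_measure)
  have intU: "integrable P ?U"
    using ind by (intro Bochner_Integration.integrable_add integrable_const integrable_mult_right)
  have "(\<integral>\<omega>. R \<omega> \<partial>P) \<le> (\<integral>\<omega>. ?U \<omega> \<partial>P)"
  proof (rule integral_mono_AE[OF intR intU])
    show "AE \<omega> in P. R \<omega> \<le> ?U \<omega>"
      using AE_arms AE_space
    proof eventually_elim
      case (elim \<omega>)
      have RT: "0 \<le> 2 * Rmax * T" using Rmax_pos by simp
      show ?case
      proof (cases "\<omega> \<in> wrong \<or> \<omega> \<in> dev")
        case True
        then have "1 \<le> indicator wrong \<omega> + (indicator dev \<omega> :: real)" by (auto simp: indicator_def)
        then have "2 * Rmax * T * 1 \<le> 2 * Rmax * T * (indicator wrong \<omega> + indicator dev \<omega>)"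
          using RT by (rule mult_left_mono)
        moreover have "0 \<le> 2 * Rmax * t2" using Rmax_pos by simp
        ultimately show ?thesis using R_le[OF elim(1)] Gd0 by linarith
      next
        case False
        then show ?thesis using good[OF elim] by simp
      qed
    qed
  qed
  also have "(\<integral>\<omega>. ?U \<omega> \<partial>P) = 2 * Rmax * t2 + Gd + 2 * Rmax * T * (measure P wrong + measure P dev)"
    using ind wrong(1) dev_sets by (simp add: prob_space)
  also have "\<dots> \<le> 2 * Rmax * t2 + Gd + 2 * Rmax * T * (1 / T + 1 / T)"
    using wrong(2) dev_le Rmax_pos by (intro add_left_mono mult_left_mono add_mono) auto
  also have "2 * Rmax * T * (1 / T + 1 / T) = 4 * Rmax" using T_ge_2 by simp
  finally show ?thesis
    by (simp add: expected_regret_def R_def r_def Gd_def)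
qed

end

section \<open>The regret in terms of the exploration rate\<close>

definition "log_ratio = 1 + \<bar>ln \<kappa>\<bar> / \<kappa>"

text \<open>A small \<open>Kx\<close> lowers \<open>ln (Kx * T)\<close> by at most
  \<open>\<bar>ln \<kappa>\<bar>\<close>, which the lower bound \<open>\<kappa>\<close> on this
  logarithm turns into a constant factor.\<close>

lemma lnT_le: "ln T \<le> log_ratio * ln (Kx * T)"
proof -
  have "ln (Kx * T) = ln Kx + ln T" using Kx_pos T_ge_2 by (simp add: ln_mult)
  moreover have "ln \<kappa> \<le> ln Kx" using Kx_ge \<kappa>_pos by simp
  ultimately have "ln T \<le> ln (Kx * T) + \<bar>ln \<kappa>\<bar>" by linarith
  moreover have "\<bar>ln \<kappa>\<bar> / \<kappa> * \<kappa> \<le> \<bar>ln \<kappa>\<bar> / \<kappa> * ln (Kx * T)"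
    using ln_KxT_ge \<kappa>_pos by (intro mult_left_mono) auto
  ultimately show ?thesis using \<kappa>_pos by (simp add: log_ratio_def distrib_right)
qed

text \<open>In the bias part the choice of \<open>oful_reg\<close> cancels \<open>T\<close>, leaving
  \<open>2 * Rmax * sqrt (\<rho> * d0)\<close>, which the exploration cost absorbs. In the noise
  part 32 is rounded up to the square of 6.\<close>

lemma init_radius_le:
  "init_radius * sqrt (real d0 * real T) \<le> 6 * sqrt log_ratio * (\<sigma> * d0 * sqrt (T * ln (Kx * T))) + 2 * Rmax * (\<rho> * d0)"
proof -
  have T: "0 < real T" using T_ge_2 by simp
  have c: "0 < log_ratio" using \<kappa>_pos by (auto simp: log_ratio_def intro!: add_pos_nonneg)
  have "sqrt (32 * (d0 * ln T)) * sqrt (real d0 * real T) = sqrt (32 * (real d0)\<^sup>2 * (T * ln T))"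
    by (simp only: real_sqrt_mult[symmetric]) (simp add: power2_eq_square mult_ac)
  also have "\<dots> \<le> sqrt ((6 * real d0)\<^sup>2 * (T * (log_ratio * ln (Kx * T))))"
    using lnT_le T lnT_ge by (intro real_sqrt_le_mono mult_mono mult_left_mono) (auto simp: power_mult_distrib)
  also have "\<dots> = 6 * real d0 * (sqrt log_ratio * sqrt (T * ln (Kx * T)))"
    by (simp add: real_sqrt_mult)
  finally have "\<sigma> * (sqrt (32 * (d0 * ln T)) * sqrt (real d0 * real T)) \<le> \<sigma> * (6 * real d0 * (sqrt log_ratio * sqrt (T * ln (Kx * T))))"
    using \<sigma>_pos by (intro mult_left_mono) auto
  then have 1: "\<sigma> * sqrt (32 * (d0 * ln T)) * sqrt (real d0 * real T) \<le> 6 * sqrt log_ratio * (\<sigma> * d0 * sqrt (T * ln (Kx * T)))"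
    by (simp add: mult_ac)
  have "sqrt oful_reg * oful_bound * sqrt (real d0 * real T) = 2 * Rmax * sqrt (\<rho> * d0)"
    using T Cmin_pos by (simp add: oful_reg_def oful_bound_def \<rho>_def real_sqrt_mult real_sqrt_divide)
  also have "\<dots> \<le> 2 * Rmax * (\<rho> * d0)"
  proof (intro mult_left_mono)
    have "1 * 1 \<le> \<rho> * d0" using \<rho>_ge_1 d0_ge_1 by (intro mult_mono) auto
    then have one: "1 \<le> \<rho> * d0" by simp
    then have "(\<rho> * d0) * 1 \<le> (\<rho> * d0) * (\<rho> * d0)" by (intro mult_left_mono) auto
    then have "sqrt (\<rho> * d0) \<le> sqrt ((\<rho> * d0)\<^sup>2)" by (intro real_sqrt_le_mono) (simp add: power2_eq_square)
    then show "sqrt (\<rho> * d0) \<le> \<rho> * d0" using one by simp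
  qed (use Rmax_pos in auto)
  finally show ?thesis using 1 by (simp add: init_radius_def distrib_right)
qed

text \<open>Sum of the separate contributions: 2356 = 20 + 2328 + 8 from the log determinant, the
  bias and the bad events, and 3492 = 582 * 6 from the noise part of the radius.\<close>

definition "C2 C1 = 2 * C1 + 2356 / \<kappa>\<^sup>2 + 3492 * sqrt log_ratio"

lemma regret_bound_le:
  assumes "real t2 \<le> C1 * rate" "0 \<le> C1"
  shows "2 * Rmax * t2 + (20 * Rmax * (d0 * ln T) + 582 * init_radius * sqrt (real d0 * real T)) + 4 * Rmax
    \<le> C2 C1 * (Rmax * rate + \<sigma> * d0 * sqrt (T * ln (Kx * T)))"
proof -
  let ?A = "Rmax * rate" and ?B = "\<sigma> * d0 * sqrt (T * ln (Kx * T))"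
  have k: "0 < \<kappa>\<^sup>2" using \<kappa>_pos by simp
  have A0: "0 \<le> ?A" using Rmax_pos rate_ge'(5) by simp
  have B0: "0 \<le> ?B" using \<sigma>_pos ln_KxT_ge \<kappa>_pos by simp
  have a1: "2 * Rmax * t2 \<le> 2 * C1 * ?A"
    using mult_left_mono[OF assms(1), of "2 * Rmax"] Rmax_pos by (simp add: mult_ac)
  have "d0 * ln T \<le> d0 * lg" using lg_ge(2) by (intro mult_left_mono) auto
  then have "\<kappa>\<^sup>2 * (d0 * ln T) \<le> rate" using rate_ge'(3) k by (meson mult_le_cancel_left_pos order_trans)
  then have "d0 * ln T \<le> rate / \<kappa>\<^sup>2" using k by (simp add: field_simps)
  then have a2: "20 * Rmax * (d0 * ln T) \<le> 20 / \<kappa>\<^sup>2 * ?A"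
    using mult_left_mono[of "d0 * ln T" "rate / \<kappa>\<^sup>2" "20 * Rmax"] Rmax_pos by (simp add: mult_ac)
  have "\<rho> * d0 \<le> 2 * rate / \<kappa>\<^sup>2" using rate_ge'(4) k by (simp add: field_simps)
  then have a3: "1164 * Rmax * (\<rho> * d0) \<le> 2328 / \<kappa>\<^sup>2 * ?A"
    using mult_left_mono[of "\<rho> * d0" "2 * rate / \<kappa>\<^sup>2" "1164 * Rmax"] Rmax_pos by (simp add: mult_ac)
  have "1 \<le> 2 * rate / \<kappa>\<^sup>2" using rate_ge'(2) k by (simp add: field_simps)
  then have a4: "4 * Rmax \<le> 8 / \<kappa>\<^sup>2 * ?A"
    using mult_left_mono[of 1 "2 * rate / \<kappa>\<^sup>2" "4 * Rmax"] Rmax_pos by (simp add: mult_ac)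
  have a5: "582 * init_radius * sqrt (real d0 * real T) \<le> 3492 * sqrt log_ratio * ?B + 1164 * Rmax * (\<rho> * d0)"
    using init_radius_le by simp
  have "2 * Rmax * t2 + (20 * Rmax * (d0 * ln T) + 582 * init_radius * sqrt (real d0 * real T)) + 4 * Rmax
      \<le> 2 * C1 * ?A + (20 / \<kappa>\<^sup>2 * ?A + (3492 * sqrt log_ratio * ?B + 2328 / \<kappa>\<^sup>2 * ?A)) + 8 / \<kappa>\<^sup>2 * ?A"
    using a1 a2 a3 a4 a5 by linarith
  also have "\<dots> = (2 * C1 + 2356 / \<kappa>\<^sup>2) * ?A + 3492 * sqrt log_ratio * ?B"
    by (simp add: distrib_right add_divide_distrib[symmetric])
  also have "\<dots> \<le> C2 C1 * ?A + C2 C1 * ?B"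
  proof (intro add_mono mult_right_mono A0 B0)
    have "0 \<le> log_ratio" using \<kappa>_pos by (auto simp: log_ratio_def)
    then show "2 * C1 + 2356 / \<kappa>\<^sup>2 \<le> C2 C1" by (simp add: C2_def)
    show "3492 * sqrt log_ratio \<le> C2 C1" using assms(2) by (simp add: C2_def)
  qed
  finally show ?thesis by (simp only: distrib_left)
qed

lemma correct_selection_and_regret:
  assumes etc: "explore_then_commit d X \<theta> Q \<nu> \<sigma> oful_reg oful_bound oful_conf T t2 sel pol"
    and t2: "C0 * rate \<le> t2" and C1: "0 \<le> C1"
  shows "1 - 1 / T \<le> measure P {\<omega> \<in> space P. \<theta> \<in> selected_model d \<theta> t2 sel pol \<omega>}"
    and "real t2 \<le> C1 * rate \<Longrightarrow>
      expected_regret d \<theta> xs \<nu> \<sigma> T t2 pol \<le> C2 C1 * (Rmax * rate + \<sigma> * d0 * sqrt (T * ln (Kx * T)))"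
proof -
  have W: "wrong t2 sel pol \<in> sets P" "measure P (wrong t2 sel pol) \<le> 1 / T"
    unfolding wrong_def[OF etc]
    using measure_wrong_model_le[OF t2, of sel pol] etc by (auto simp: explore_then_commit_def)
  have "{\<omega> \<in> space P. \<theta> \<in> selected_model d \<theta> t2 sel pol \<omega>} = space P - wrong t2 sel pol"
    by (auto simp: wrong_def[OF etc])
  then show "1 - 1 / T \<le> measure P {\<omega> \<in> space P. \<theta> \<in> selected_model d \<theta> t2 sel pol \<omega>}"
    using W prob_compl[OF W(1)] by simp
  show "expected_regret d \<theta> xs \<nu> \<sigma> T t2 pol \<le> C2 C1 * (Rmax * rate + \<sigma> * d0 * sqrt (T * ln (Kx * T)))"
    if "real t2 \<le> C1 * rate"
    using expected_regret_le[OF etc W] regret_bound_le[OF that C1] by linarith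
qed

end

text \<open>\<open>C0\<close> is the sufficiently large constant of the exploration length,
  \<open>C1\<close> any constant bounding that length from above, \<open>C2\<close> the constant of
  the regret; all precede the instance. The OFUL parameters are given by functions that see neither
  \<open>\<epsilon>0\<close> nor \<open>\<theta>\<close> nor \<open>t2\<close>, and the conclusion
  includes that they are admissible.\<close>

theorem theorem2:
  fixes c B \<kappa> :: real
  assumes "0 < c" and "0 < B" and "0 < \<kappa>"
  shows "\<exists>C0>0. \<exists>reg nbd conf :: nat \<Rightarrow> nat \<Rightarrow> nat \<Rightarrow> real \<Rightarrow> real \<Rightarrow> real \<Rightarrow> real \<Rightarrow> real.
    \<forall>C1\<ge>C0. \<exists>C2>0.
    \<forall>(T::nat) (d::nat) (d0::nat) (\<sigma>::real) (Kx::real) (Rmax::real) (Cmin::real) (\<epsilon>0::real)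
      (X::vector set) (\<theta>::vector) (xs::vector) (G::(nat \<Rightarrow> nat) set) (Q::nat set set set)
      (\<nu>::vector measure) (l::real) (S::real) (\<delta>::real).
      1 \<le> d \<longrightarrow> 0 < \<sigma> \<longrightarrow> nondegenerate \<kappa> T \<sigma> Kx \<epsilon>0 \<longrightarrow>
      symmetric_bandit d X \<theta> xs G \<longrightarrow>
      few_partitions c B d d0 G Q \<longrightarrow>
      bounded_arms d Kx Rmax X \<theta> Q \<longrightarrow>
      well_separated d \<epsilon>0 \<theta> G \<longrightarrow>
      exploratory d X \<nu> \<longrightarrow> Cmin = lambda_min (second_moment d \<nu>) \<longrightarrow>
      l = reg T d d0 \<sigma> Kx Rmax Cmin \<longrightarrow>
      S = nbd T d d0 \<sigma> Kx Rmax Cmin \<longrightarrow>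
      \<delta> = conf T d d0 \<sigma> Kx Rmax Cmin \<longrightarrow>
      0 < l \<and> 0 < \<delta> \<and> \<delta> < 1 \<and> sqrt (sqnorm d \<theta>) \<le> S \<and>
      (\<forall>t2 sel pol.
        explore_then_commit d X \<theta> Q \<nu> \<sigma> l S \<delta> T t2 sel pol \<longrightarrow>
        C0 * exploration_rate \<sigma> Kx d0 d T Cmin \<epsilon>0 \<le> real t2 \<longrightarrow>
        measure (sample_space \<nu> \<sigma>)
            {\<omega> \<in> space (sample_space \<nu> \<sigma>). \<theta> \<in> selected_model d \<theta> t2 sel pol \<omega>}
          \<ge> 1 - 1 / real T \<and>
        (real t2 \<le> C1 * exploration_rate \<sigma> Kx d0 d T Cmin \<epsilon>0 \<longrightarrow>
          expected_regret d \<theta> xs \<nu> \<sigma> T t2 pol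
            \<le> C2 * (Rmax * exploration_rate \<sigma> Kx d0 d T Cmin \<epsilon>0
                     + \<sigma> * real d0 * sqrt (real T * ln (Kx * real T)))))"
proof -
  \<comment> \<open>Written out in \<open>c\<close>, \<open>B\<close> and \<open>\<kappa>\<close>,
    because the constants of the locale become available only after an instance is fixed.\<close>
  define C0 where "C0 = 1024 * (3 + 2 * B + c + 66) / \<kappa> + 4 * (44 + (3 + 2 * B + c)) / \<kappa>\<^sup>2"
  define C2 where "C2 C1 = 2 * C1 + 2356 / \<kappa>\<^sup>2 + 3492 * sqrt (1 + \<bar>ln \<kappa>\<bar> / \<kappa>)" for C1
  have C0: "0 < C0"
    unfolding C0_def using assms by (intro add_pos_pos divide_pos_pos mult_pos_pos) auto
  show ?thesis
  proof (rule exI[of _ C0], intro conjI C0,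
      rule exI[of _ "\<lambda>T d d0 \<sigma> Kx Rmax Cmin. Kx / real T"],
      rule exI[of _ "\<lambda>T d d0 \<sigma> Kx Rmax Cmin. 2 * Rmax / sqrt Cmin"],
      rule exI[of _ "\<lambda>T d d0 \<sigma> Kx Rmax Cmin. 1 / real T ^ (16 * d0)"],
      intro allI impI)
    fix C1 assume C1: "C0 \<le> C1"
    have C1': "0 \<le> C1" using C0 C1 by linarith
    have C2: "0 < C2 C1"
      unfolding C2_def using C1' assms(3) by (intro add_nonneg_pos add_nonneg_nonneg) (auto intro!: add_pos_nonneg)
    show "\<exists>C2>0. \<forall>(T::nat) (d::nat) (d0::nat) (\<sigma>::real) (Kx::real) (Rmax::real) (Cmin::real) (\<epsilon>0::real)
      (X::vector set) (\<theta>::vector) (xs::vector) (G::(nat \<Rightarrow> nat) set) (Q::nat set set set)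
      (\<nu>::vector measure) (l::real) (S::real) (\<delta>::real).
      1 \<le> d \<longrightarrow> 0 < \<sigma> \<longrightarrow> nondegenerate \<kappa> T \<sigma> Kx \<epsilon>0 \<longrightarrow>
      symmetric_bandit d X \<theta> xs G \<longrightarrow>
      few_partitions c B d d0 G Q \<longrightarrow>
      bounded_arms d Kx Rmax X \<theta> Q \<longrightarrow>
      well_separated d \<epsilon>0 \<theta> G \<longrightarrow>
      exploratory d X \<nu> \<longrightarrow> Cmin = lambda_min (second_moment d \<nu>) \<longrightarrow>
      l = Kx / real T \<longrightarrow>
      S = 2 * Rmax / sqrt Cmin \<longrightarrow>
      \<delta> = 1 / real T ^ (16 * d0) \<longrightarrow>
      0 < l \<and> 0 < \<delta> \<and> \<delta> < 1 \<and> sqrt (sqnorm d \<theta>) \<le> S \<and>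
      (\<forall>t2 sel pol.
        explore_then_commit d X \<theta> Q \<nu> \<sigma> l S \<delta> T t2 sel pol \<longrightarrow>
        C0 * exploration_rate \<sigma> Kx d0 d T Cmin \<epsilon>0 \<le> real t2 \<longrightarrow>
        measure (sample_space \<nu> \<sigma>)
            {\<omega> \<in> space (sample_space \<nu> \<sigma>). \<theta> \<in> selected_model d \<theta> t2 sel pol \<omega>}
          \<ge> 1 - 1 / real T \<and>
        (real t2 \<le> C1 * exploration_rate \<sigma> Kx d0 d T Cmin \<epsilon>0 \<longrightarrow>
          expected_regret d \<theta> xs \<nu> \<sigma> T t2 pol
            \<le> C2 * (Rmax * exploration_rate \<sigma> Kx d0 d T Cmin \<epsilon>0
                     + \<sigma> * real d0 * sqrt (real T * ln (Kx * real T)))))"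
    proof (rule exI[of _ "C2 C1"], intro conjI C2 allI impI)
      fix T d d0 :: nat and \<sigma> Kx Rmax Cmin \<epsilon>0 :: real and X :: "vector set" and \<theta> xs :: vector
        and G :: "(nat \<Rightarrow> nat) set" and Q :: "nat set set set" and \<nu> :: "vector measure" and l S \<delta> :: real
      assume "1 \<le> d" "0 < \<sigma>" "nondegenerate \<kappa> T \<sigma> Kx \<epsilon>0" "symmetric_bandit d X \<theta> xs G"
        "few_partitions c B d d0 G Q" "bounded_arms d Kx Rmax X \<theta> Q" "well_separated d \<epsilon>0 \<theta> G"
        "exploratory d X \<nu>" "Cmin = lambda_min (second_moment d \<nu>)"
      then interpret I: symmetric_bandit_instance c B \<kappa> T d d0 \<sigma> Kx Rmax Cmin \<epsilon>0 X \<theta> xs G Q \<nu>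
        using assms by unfold_locales
      have C0_eq: "I.C0 = C0" unfolding I.C0_def I.C3_def C0_def ..
      have C2_eq: "I.C2 C1 = C2 C1" unfolding I.C2_def I.log_ratio_def C2_def ..
      assume l: "l = Kx / real T" and S: "S = 2 * Rmax / sqrt Cmin" and \<delta>: "\<delta> = 1 / real T ^ (16 * d0)"
      have eqs: "l = I.oful_reg" "S = I.oful_bound" "\<delta> = I.oful_conf"
        unfolding l S \<delta> I.oful_reg_def I.oful_bound_def I.oful_conf_def by (rule refl)+
      show "0 < l" unfolding eqs by (rule I.oful_reg_pos)
      show "0 < \<delta>" "\<delta> < 1" unfolding eqs by (rule I.oful_conf)+
      show "sqrt (sqnorm d \<theta>) \<le> S"
        unfolding eqs using I.sqrt_sqnorm_\<theta>_le I.oful_bound_pos by linarith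
      fix t2 sel pol
      assume "explore_then_commit d X \<theta> Q \<nu> \<sigma> l S \<delta> T t2 sel pol"
        and "C0 * exploration_rate \<sigma> Kx d0 d T Cmin \<epsilon>0 \<le> real t2"
      then have etc: "explore_then_commit d X \<theta> Q \<nu> \<sigma> I.oful_reg I.oful_bound I.oful_conf T t2 sel pol"
        and t2: "I.C0 * I.rate \<le> real t2"
        unfolding eqs C0_eq I.rate_def by simp_all
      show "1 - 1 / real T \<le> measure (sample_space \<nu> \<sigma>)
          {\<omega> \<in> space (sample_space \<nu> \<sigma>). \<theta> \<in> selected_model d \<theta> t2 sel pol \<omega>}"
        by (rule I.correct_selection_and_regret(1)[OF etc t2 C1'])
      assume "real t2 \<le> C1 * exploration_rate \<sigma> Kx d0 d T Cmin \<epsilon>0"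
      then show "expected_regret d \<theta> xs \<nu> \<sigma> T t2 pol
          \<le> C2 C1 * (Rmax * exploration_rate \<sigma> Kx d0 d T Cmin \<epsilon>0
                     + \<sigma> * real d0 * sqrt (real T * ln (Kx * real T)))"
        using I.correct_selection_and_regret(2)[OF etc t2 C1'] unfolding C2_eq I.rate_def by blast
    qed
  qed
qed

end
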